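(* Let $n$ be a positive integer, and let $$\gamma_n(k)=\begin{cases}\binom{2n}{n+k}\binom{2n}{n}^{-1} & \text{if } |k|=0,1,2,\dots,n,\\ 0&\text{otherwise.}\end{cases}$$ Let $\{\xi_k\}_{k\in\mathbb{Z}}$ be the stationary, centered, complex Gaussian process with covariance function $\{\gamma_n(k)\}_{k\in\mathbb{Z}}$, i.e. $\mathbb{E}[\xi_k\overline{\xi_l}]=\gamma_n(l-k)$, and let $f(z)=\sum_{k=0}^\infty\xi_kz^k$. For $r\in(0,1)$ let $N_f(r)$ be the number of zeros of $f$ in $\{z\in\mathbb{C}:|z|<r\}$. Then, as $r\to1_-$, $$\mathbb{E}N_f(r)=\frac{r^2}{1-r^2}-D_n(1-r^2)^{-\frac{2n-1}{2n}}+O\left((1-r^2)^{-\frac{2n-3}{2n}}\right),$$ where $$D_n=\frac{1}{2n\sin\frac{\pi}{2n}}\left\{\binom{2(n-1)}{n-1}\right\}^{\frac1{2n}}.$$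
   Context: Complex Gaussian processes are circularly symmetric, so that their law is determined by the covariance $\mathbb{E}[\xi_k\overline{\xi_l}]$. The covariance is normalized so that $\gamma_n(0)=1$. The asymptotics are for fixed $n$.
   Formalization: For n=1 the error term is O(1) instead of O((1-r^2)^{1/2}): there E N_f(r) = r^2/(1-r^2) - (1/2)(1-r^2)^{-1/2} + 1/2 exactly, so the printed bound fails; for n≥2 the error term is as printed. *)

theory Defs
  imports
    "HOL-Probability.Probability"
    "HOL-Complex_Analysis.Complex_Analysis"
    "HOL-Library.Landau_Symbols"
begin

definition gamma_cov :: "nat \<Rightarrow> int \<Rightarrow> real" where
  "gamma_cov n k =
     (if \<bar>k\<bar> \<le> int n
      then real ((2 * n) choose nat (int n + k)) / real ((2 * n) choose n)
      else 0)"

(* Point masses count as (degenerate) Gaussian laws. *)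
definition gaussian_rv :: "'a measure \<Rightarrow> ('a \<Rightarrow> real) \<Rightarrow> bool" where
  "gaussian_rv M X \<longleftrightarrow>
     (\<exists>\<mu> \<sigma>. 0 < \<sigma> \<and> distributed M lborel X (\<lambda>x. ennreal (normal_density \<mu> \<sigma> x))) \<or>
     (\<exists>\<mu>. distr M borel X = return borel \<mu>)"

(* The real parts of complex linear combinations of the xi k are exactly the real linear
   combinations of all Re (xi k) and Im (xi k), so the second conjunct is joint Gaussianity
   of the real and imaginary parts. *)
definition complex_gaussian_process :: "'a measure \<Rightarrow> (int \<Rightarrow> 'a \<Rightarrow> complex) \<Rightarrow> bool" where
  "complex_gaussian_process M \<xi> \<longleftrightarrow>
     (\<forall>k. \<xi> k \<in> borel_measurable M) \<and>
     (\<forall>F c. finite F \<longrightarrow> gaussian_rv M (\<lambda>\<omega>. Re (\<Sum>k\<in>F. c k * \<xi> k \<omega>)))"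

definition process_law :: "'a measure \<Rightarrow> (int \<Rightarrow> 'a \<Rightarrow> complex) \<Rightarrow> (int \<Rightarrow> complex) measure" where
  "process_law M \<xi> = distr M (Pi\<^sub>M UNIV (\<lambda>_. borel)) (\<lambda>\<omega> k. \<xi> k \<omega>)"

definition circularly_symmetric :: "'a measure \<Rightarrow> (int \<Rightarrow> 'a \<Rightarrow> complex) \<Rightarrow> bool" where
  "circularly_symmetric M \<xi> \<longleftrightarrow>
     (\<forall>\<theta>. process_law M (\<lambda>k \<omega>. cis \<theta> * \<xi> k \<omega>) = process_law M \<xi>)"

definition stationary :: "'a measure \<Rightarrow> (int \<Rightarrow> 'a \<Rightarrow> complex) \<Rightarrow> bool" where
  "stationary M \<xi> \<longleftrightarrow> (\<forall>m. process_law M (\<lambda>k. \<xi> (k + m)) = process_law M \<xi>)"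

definition centered :: "'a measure \<Rightarrow> (int \<Rightarrow> 'a \<Rightarrow> complex) \<Rightarrow> bool" where
  "centered M \<xi> \<longleftrightarrow> (\<forall>k. integrable M (\<xi> k) \<and> (\<integral>\<omega>. \<xi> k \<omega> \<partial>M) = 0)"

definition has_covariance ::
    "'a measure \<Rightarrow> (int \<Rightarrow> 'a \<Rightarrow> complex) \<Rightarrow> (int \<Rightarrow> real) \<Rightarrow> bool" where
  "has_covariance M \<xi> \<gamma> \<longleftrightarrow>
     (\<forall>k l. integrable M (\<lambda>\<omega>. \<xi> k \<omega> * cnj (\<xi> l \<omega>)) \<and>
            (\<integral>\<omega>. \<xi> k \<omega> * cnj (\<xi> l \<omega>) \<partial>M) = complex_of_real (\<gamma> (l - k)))"

definition random_series :: "(int \<Rightarrow> 'a \<Rightarrow> complex) \<Rightarrow> 'a \<Rightarrow> complex \<Rightarrow> complex" where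
  "random_series \<xi> \<omega> z = (\<Sum>k. \<xi> (int k) \<omega> * z ^ k)"

(* Zeros are counted with multiplicity; the sum is unordered, so infinitely many zeros
   give infinity.  The value is only meaningful for g holomorphic and not identically zero. *)
definition zero_count :: "(complex \<Rightarrow> complex) \<Rightarrow> complex set \<Rightarrow> ennreal" where
  "zero_count g S = (\<Sum>\<^sub>\<infinity>z\<in>{z \<in> S. g z = 0}. of_nat (nat (zorder g z)))"

(* A nonnegative integral is used because it depends on the zero count only up to null sets:
   where the series has radius of convergence below 1, or vanishes identically, the count
   is an arbitrary value that need not be measurable. *)
definition expected_zeros :: "'a measure \<Rightarrow> (int \<Rightarrow> 'a \<Rightarrow> complex) \<Rightarrow> real \<Rightarrow> ennreal" where
  "expected_zeros M \<xi> r = (\<integral>\<^sup>+\<omega>. zero_count (random_series \<xi> \<omega>) {z. cmod z < r} \<partial>M)"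

definition D_const :: "nat \<Rightarrow> real" where
  "D_const n =
     1 / (2 * real n * sin (pi / (2 * real n))) *
     real ((2 * (n - 1)) choose (n - 1)) powr (1 / (2 * real n))"

(* For n = 1 the exponent -(2n-3)/(2n) is positive, but E N(r) can be computed exactly:
   the kernel is K(z,z) = (1 + Re z) / (1 - |z|^2), whose logarithm has circular mean
   ln ((1 + s) / 2) - 2 ln s with s = sqrt (1 - r^2), so that
   E N(r) = r^2 / (1 - r^2) - 1 / (2 s) + 1 / 2.
   The remainder is the constant 1/2, hence O(1) and not O(s). *)
definition error_scale :: "nat \<Rightarrow> real \<Rightarrow> real" where
  "error_scale n t =
     (if n = 1 then 1 else t powr (- ((2 * real n - 3) / (2 * real n))))"

end

theory Submission
  imports Defs
begin

text \<open>
  Jensen's formula sandwiches the number of zeros in a disc between difference quotients of the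
  circular mean of $\log|f|$. In expectation this mean is, up to a constant that does not depend on
  the radius, half the circular mean $h(r)$ of $\log K$, where $K(z) = E|f(z)|^2$; letting the
  radii merge gives $E N(r) = r h'(r)/2$.

  The covariance is that of a moving average with weights $\binom{n}{j}$ (Vandermonde). Writing the
  kernel as a sum of squares accordingly,
  $\binom{2n}{n} K(z) = |1+z|^{2n}/(1-|z|^2) + R(z)$ with
  $R(z) = \sum_{m<n} |\sum_{k\le m} \binom{n}{m-k} z^k|^2 \ge 1$ and
  $R(-1) = \sum_m \binom{n-1}{m}^2 = \binom{2n-2}{n-1} =: c$.
  The mean of the logarithmic derivative of $(1-r^2)K$ concentrates at $z = -1$: with $z = -r e^{i\phi}$ and
  $t = 1-r^2$ it is compared with the integral of $-2c/(\phi^{2n} + ct)$, which a Beta integral evaluates.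
\<close>

section \<open>Jensen bounds for the zero count\<close>

text \<open>Only one-point laws enter: f(z) is complex Gaussian with variance K(z), so E log|f(z)|
  is log K(z) / 2 plus an absolute constant, and Fubini does the rest. The factor 1/(1-|z|^2) of K
  alone contributes r^2/(1-r^2). Since an expansion of h could not be differentiated, the
  asymptotics are proved for the logarithmic derivative itself, pointwise in \<phi>. With a =
  1/(2n), the scaling \<phi> = (ct)^a u gives the model integral over the line the value -2c
  (ct)^(a-1) times 2 pi a / sin(pi a); division by 4 pi yields -D_n t^(a-1), which explains the
  exponent of the binomial in D_n. Numerator and denominator deviate from the model by errors of
  relative size \<phi>^2 + t, so the remainder is controlled by the integral of (\<phi>^2 +
  t)/(\<phi>^(2n) + t). For n \<ge> 2 this is O(t^(3a-1)), as the scaling \<phi> ~ t^a suggests; for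
  n = 1 the integrand is 1, hence the bound O(1).\<close>

definition circ :: "real \<Rightarrow> real \<Rightarrow> complex" where
  "circ s x = complex_of_real s * cis (2 * pi * x)"

text \<open>Circular means become expectations, so that they can be exchanged with the expectation
  over \<open>M\<close> by Fubini and tolerate null sets of angles.\<close>

definition unif :: "real measure" where
  "unif = restrict_space lborel {0..1}"

lemma norm_circ [simp]: "cmod (circ s x) = \<bar>s\<bar>"
  by (simp add: circ_def norm_mult)

lemma continuous_on_circ [continuous_intros]: "continuous_on A (circ s)"
  unfolding circ_def by (intro continuous_intros)

lemma space_unif [simp]: "space unif = {0..1}"
  by (simp add: unif_def)

lemma sets_unif [measurable_cong]: "sets unif = sets (restrict_space borel {0..1})"
  by (simp add: unif_def sets_restrict_space)

lemma prob_space_unif: "prob_space unif"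
  by (rule prob_spaceI) (simp add: unif_def emeasure_restrict_space)

interpretation unif: prob_space unif
  by (rule prob_space_unif)

lemma borel_measurable_unif: "f \<in> borel_measurable borel \<Longrightarrow> f \<in> borel_measurable unif"
  unfolding unif_def by (rule measurable_restrict_space1) simp

lemma circ_measurable [measurable]: "circ s \<in> borel_measurable unif"
  by (intro borel_measurable_unif borel_measurable_continuous_onI continuous_intros)

lemma has_bochner_integral_unif_continuous:
  fixes f :: "real \<Rightarrow> 'a :: euclidean_space"
  assumes "continuous_on {0..1} f"
  shows "has_bochner_integral unif f (integral {0..1} f)"
proof -
  have "set_integrable lborel {0..1} f"
    unfolding set_integrable_def by (intro borel_integrable_compact) (use assms in auto)
  moreover from this have "(LINT x:{0..1}|lborel. f x) = integral {0..1} f"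
    by (rule set_borel_integral_eq_integral)
  ultimately show ?thesis
    unfolding unif_def has_bochner_integral_iff
    by (auto simp: integrable_restrict_space integral_restrict_space set_integrable_def
        set_lebesgue_integral_def)
qed

text \<open>Two parameters that hit the same point differ by an integer, so the exceptional set is
  countable. This removes the singularities of log |z - a| on the circle.\<close>

lemma AE_circ_neq:
  assumes "0 < s"
  shows "AE x in unif. circ s x \<noteq> a"
proof (cases "\<exists>x0. circ s x0 = a")
  case True
  then obtain x0 where x0: "circ s x0 = a" by blast
  have sub: "{x. circ s x = a} \<subseteq> range (\<lambda>k::int. x0 + of_int k)"
  proof
    fix x assume "x \<in> {x. circ s x = a}"
    hence "cis (2 * pi * x) = cis (2 * pi * x0)"
      using assms x0 by (auto simp: circ_def)
    hence "cis (2 * pi * x - 2 * pi * x0) = 1"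
      by (simp add: cis_divide [symmetric])
    hence "cos (2 * pi * x - 2 * pi * x0) = 1"
      by (metis cis.simps(1) one_complex.simps(1))
    then obtain k :: int where "2 * pi * x - 2 * pi * x0 = of_int k * 2 * pi"
      using cos_one_2pi_int by auto
    hence "pi * (2 * (x - x0 - of_int k)) = 0"
      by (simp add: algebra_simps)
    hence "x = x0 + of_int k"
      by simp
    thus "x \<in> range (\<lambda>k::int. x0 + of_int k)" by blast
  qed
  have "countable {x. circ s x = a}"
    by (rule countable_subset[OF sub]) auto
  hence "AE x in lborel. x \<notin> {x. circ s x = a}"
    using AE_not_in countable_imp_null_set_lborel by blast
  thus ?thesis
    unfolding unif_def by (subst AE_restrict_space_iff) auto
qed auto

text \<open>Cauchy's formula at the centre: the derivative of the circle is 2 pi i times the circle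
  itself, which cancels the denominator.\<close>

lemma holomorphic_circle_mean:
  assumes "g holomorphic_on ball 0 R" "0 < s" "s < R"
  shows "has_bochner_integral unif (\<lambda>x. g (circ s x)) (g 0)"
proof -
  have hol: "g holomorphic_on cball 0 s"
    using assms by (auto intro: holomorphic_on_subset)
  have cont: "continuous_on {0..1} (\<lambda>x. g (circ s x))"
    by (rule continuous_on_compose2[OF holomorphic_on_imp_continuous_on[OF hol]])
       (use assms in \<open>auto intro!: continuous_intros\<close>)
  have "((\<lambda>u. g u / (u - 0)) has_contour_integral (2 * of_real pi * \<i> * g 0)) (circlepath 0 s)"
    using assms hol by (intro Cauchy_integral_circlepath_simple) auto
  hence "((\<lambda>x. g (circlepath 0 s x) / (circlepath 0 s x) *
      vector_derivative (circlepath 0 s) (at x within {0..1})) has_integral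
      (2 * of_real pi * \<i> * g 0)) {0..1}"
    by (simp add: has_contour_integral_def)
  moreover have "g (circlepath 0 s x) / (circlepath 0 s x) *
      vector_derivative (circlepath 0 s) (at x within {0..1}) =
      2 * of_real pi * \<i> * g (circ s x)" if "x \<in> {0..1}" for x
  proof -
    have "circlepath 0 s x = circ s x"
      by (simp add: circlepath circ_def cis_conv_exp mult_ac)
    moreover have "vector_derivative (circlepath 0 s) (at x within {0..1}) = 2 * of_real pi * \<i> * circ s x"
      using that by (simp add: vector_derivative_circlepath01 circ_def cis_conv_exp mult_ac)
    moreover have "circ s x \<noteq> 0" using assms by (simp add: circ_def)
    ultimately show ?thesis by simp
  qed
  ultimately have "((\<lambda>x. 2 * of_real pi * \<i> * g (circ s x)) has_integral
      (2 * of_real pi * \<i> * g 0)) {0..1}"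
    by (rule has_integral_eq[rotated])
  from has_integral_mult_right[OF this, of "1 / (2 * of_real pi * \<i>)"]
  have "((\<lambda>x. g (circ s x)) has_integral g 0) {0..1}"
    by simp
  thus ?thesis
    using has_bochner_integral_unif_continuous[OF cont] by (simp add: integral_unique)
qed

text \<open>On a disc a zero-free \<open>g\<close> has a holomorphic logarithm, and ln |g| is its
  real part, which inherits the mean value property.\<close>

lemma log_circle_mean_nonzero:
  assumes "g holomorphic_on ball 0 R" "0 < s" "s < R" "\<And>z. z \<in> ball 0 R \<Longrightarrow> g z \<noteq> 0"
  shows "has_bochner_integral unif (\<lambda>x. ln (cmod (g (circ s x)))) (ln (cmod (g 0)))"
proof -
  obtain h where h: "h holomorphic_on ball 0 R" "\<And>z. z \<in> ball 0 R \<Longrightarrow> exp (h z) = g z"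
    using holomorphic_logarithm_exists[of "ball 0 R" g 0] assms by auto
  have eq: "ln (cmod (g z)) = Re (h z)" if "z \<in> ball 0 R" for z
    using h(2)[OF that, symmetric] by simp
  have "has_bochner_integral unif (\<lambda>x. Re (h (circ s x))) (Re (h 0))"
    using holomorphic_circle_mean[OF h(1) assms(2,3)]
    by (rule has_bochner_integral_bounded_linear[OF bounded_linear_Re])
  thus ?thesis
    using eq assms(2,3) by simp
qed

section \<open>Circular means of log |z - a|\<close>

lemma log_circle_mean_outside:
  assumes "0 < s" "s < cmod a"
  shows "has_bochner_integral unif (\<lambda>x. ln (cmod (circ s x - a))) (ln (cmod a))"
  using log_circle_mean_nonzero[of "\<lambda>z. z - a" "cmod a" s] assms
  by (force intro!: holomorphic_intros)

text \<open>On the circle, |z - a| = |s - cnj a * z / s|. The right-hand function has its only zero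
  at the mirror image of \<open>a\<close>, at distance R = s^2/|a| > s, so the zero-free case
  applies; its value at 0 is s.\<close>

lemma log_circle_mean_inside:
  assumes "cmod a < s"
  shows "has_bochner_integral unif (\<lambda>x. ln (cmod (circ s x - a))) (ln s)"
proof (cases "a = 0")
  case True
  thus ?thesis
    using assms norm_ge_zero[of a] unif.prob_space
    by (auto simp: has_bochner_integral_iff simp del: norm_ge_zero)
next
  case False
  have s: "s > 0" using assms norm_ge_zero[of a] by linarith
  define R where "R = s\<^sup>2 / cmod a"
  have nz: "of_real s - cnj a * z / of_real s \<noteq> 0" if "z \<in> ball 0 R" for z
  proof
    assume "of_real s - cnj a * z / of_real s = 0"
    hence "cnj a * z = of_real (s\<^sup>2)"
      using s by (simp add: field_simps power2_eq_square)
    hence "cmod (cnj a * z) = s\<^sup>2" by (simp del: of_real_power)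
    thus False using that False s by (auto simp: R_def norm_mult field_simps)
  qed
  have sR: "s < R"
    using assms False s by (simp add: R_def field_simps power2_eq_square)
  have "has_bochner_integral unif
      (\<lambda>x. ln (cmod (of_real s - cnj a * circ s x / of_real s)))
      (ln (cmod (of_real s - cnj a * 0 / of_real s)))"
    using s sR nz by (intro log_circle_mean_nonzero[of _ R]) (auto intro!: holomorphic_intros)
  moreover have "cmod (of_real s - cnj a * circ s x / of_real s) = cmod (circ s x - a)" for x
  proof -
    have "circ s x - a = cis (2*pi*x) * cnj (of_real s - cnj a * circ s x / of_real s)"
      using s by (simp add: circ_def algebra_simps cis_cnj cis_mult)
    thus ?thesis by (simp only: norm_mult norm_cis complex_mod_cnj mult_1)
  qed
  ultimately show ?thesis using s by simp
qed

text \<open>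
  The singularity lies on the circle. Approaching it from inside, Fatou's lemma first gives
  integrability and then a dominating function, so no explicit integral is needed.
\<close>

lemma log_circle_mean_on:
  assumes a: "cmod a = s" and s: "0 < s"
  shows "has_bochner_integral unif (\<lambda>x. ln (cmod (circ s x - a))) (ln s)"
proof -
  define \<rho> where "\<rho> k = 1 - 1 / real (k + 2)" for k :: nat
  have \<rho>: "0 < \<rho> k" "\<rho> k < 1" for k
    by (auto simp: \<rho>_def)
  have \<rho>lim: "\<rho> \<longlonglongrightarrow> 1"
    unfolding \<rho>_def by real_asymp
  define F where "F k x = ln (cmod (of_real (\<rho> k) * circ s x - a))" for k x
  define G where "G x = ln (cmod (circ s x - a))" for x
  have F: "has_bochner_integral unif (F k) (ln s)" for k
  proof -
    have "of_real (\<rho> k) * circ s x = circ (\<rho> k * s) x" for x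
      by (simp add: circ_def)
    thus ?thesis
      using log_circle_mean_outside[of "\<rho> k * s" a] \<rho>[of k] s a
      by (simp add: F_def[abs_def])
  qed
  have G_meas [measurable]: "G \<in> borel_measurable unif"
    unfolding G_def by measurable
  have F_meas [measurable]: "F k \<in> borel_measurable unif" for k
    using F has_bochner_integral_iff by blast
  have lim: "(\<lambda>k. F k x) \<longlonglongrightarrow> G x" if "circ s x \<noteq> a" for x
  proof -
    have "(\<lambda>k. cmod (of_real (\<rho> k) * circ s x - a)) \<longlonglongrightarrow> cmod (of_real 1 * circ s x - a)"
      by (intro tendsto_intros \<rho>lim)
    thus ?thesis
      unfolding F_def G_def using that by (intro tendsto_ln) auto
  qed
  have upper: "F k x \<le> ln (2 * s)" for k x
  proof -
    have "cmod (of_real (\<rho> k) * circ s x - a) \<le> cmod (of_real (\<rho> k) * circ s x) + cmod a"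
      by (rule norm_triangle_ineq4)
    also have "\<dots> \<le> 2 * s"
      using \<rho>[of k] s a by (simp add: norm_mult)
    finally have "cmod (of_real (\<rho> k) * circ s x - a) \<le> 2 * s" .
    moreover have "cmod (of_real (\<rho> k) * circ s x - a) > 0"
    proof -
      have "cmod (of_real (\<rho> k) * circ s x) < cmod a"
        using \<rho>[of k] s a by (simp add: norm_mult)
      thus ?thesis by auto
    qed
    ultimately show ?thesis using s by (simp add: F_def)
  qed
  \<comment> \<open>With w = \<open>circ s x\<close>, the displacement |w - \<rho> w| = (1 - \<rho>)
    s is the distance from \<rho> w to the circle, hence at most |\<rho> w - a|. Moving out to w
    therefore at most doubles the distance to \<open>a\<close>, and \<open>G\<close> itself can
    dominate once it is integrable.\<close>
  have lower: "F k x \<ge> G x - ln 2" if "circ s x \<noteq> a" for k x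
  proof -
    have *: "cmod (of_real (\<rho> k) * circ s x) < cmod a"
      using \<rho>[of k] s a by (simp add: norm_mult)
    have "cmod (circ s x - a) \<le> cmod (of_real (\<rho> k) * circ s x - a) + cmod (circ s x - of_real (\<rho> k) * circ s x)"
      using norm_triangle_ineq[of "of_real (\<rho> k) * circ s x - a" "circ s x - of_real (\<rho> k) * circ s x"] by simp
    also have "cmod (circ s x - of_real (\<rho> k) * circ s x) = (1 - \<rho> k) * s"
    proof -
      have "circ s x - of_real (\<rho> k) * circ s x = of_real (1 - \<rho> k) * circ s x"
        by (simp add: algebra_simps)
      thus ?thesis using \<rho>[of k] s by (simp only: norm_mult norm_of_real norm_circ)
    qed
    also have "(1 - \<rho> k) * s \<le> cmod (of_real (\<rho> k) * circ s x - a)"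
      using norm_triangle_ineq2[of a "of_real (\<rho> k) * circ s x"] \<rho>[of k] s a
      by (simp add: norm_mult algebra_simps norm_minus_commute)
    finally have "cmod (circ s x - a) \<le> 2 * cmod (of_real (\<rho> k) * circ s x - a)" by simp
    hence "ln (cmod (circ s x - a)) \<le> ln (2 * cmod (of_real (\<rho> k) * circ s x - a))"
      using that * by (intro iffD2[OF ln_le_cancel_iff]) auto
    also have "\<dots> = ln 2 + F k x"
      using * by (subst ln_mult) (auto simp: F_def)
    finally show ?thesis by (simp add: G_def)
  qed
  have ae: "AE x in unif. circ s x \<noteq> a"
    using s by (rule AE_circ_neq)
  have nn: "(\<integral>\<^sup>+x. ennreal (ln (2 * s) - G x) \<partial>unif) \<le> ennreal (ln (2 * s) - ln s)"
  proof -
    have "(\<integral>\<^sup>+x. ennreal (ln (2 * s) - G x) \<partial>unif) =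
          (\<integral>\<^sup>+x. liminf (\<lambda>k. ennreal (ln (2 * s) - F k x)) \<partial>unif)"
    proof (intro nn_integral_cong_AE, use ae in eventually_elim)
      fix x assume "circ s x \<noteq> a"
      hence "(\<lambda>k. ennreal (ln (2 * s) - F k x)) \<longlonglongrightarrow> ennreal (ln (2 * s) - G x)"
        by (intro tendsto_intros lim)
      thus "ennreal (ln (2 * s) - G x) = liminf (\<lambda>k. ennreal (ln (2 * s) - F k x))"
        by (simp add: lim_imp_Liminf)
    qed
    also have "\<dots> \<le> liminf (\<lambda>k. \<integral>\<^sup>+x. ennreal (ln (2 * s) - F k x) \<partial>unif)"
      by (intro nn_integral_liminf) measurable
    also have "(\<lambda>k. \<integral>\<^sup>+x. ennreal (ln (2 * s) - F k x) \<partial>unif) = (\<lambda>k. ennreal (ln (2 * s) - ln s))"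
    proof
      fix k
      have I: "integrable unif (F k)" "integral\<^sup>L unif (F k) = ln s"
        using F has_bochner_integral_iff by blast+
      show "(\<integral>\<^sup>+x. ennreal (ln (2 * s) - F k x) \<partial>unif) = ennreal (ln (2 * s) - ln s)"
        by (subst nn_integral_eq_integral) (use I upper unif.prob_space in \<open>auto simp: measure_def\<close>)
    qed
    finally show ?thesis by (simp add: Liminf_const)
  qed
  have "G x \<le> ln (2 * s)" if "circ s x \<noteq> a" for x
    using lim[OF that] upper by (intro LIMSEQ_le_const2) auto
  hence "AE x in unif. 0 \<le> ln (2 * s) - G x"
    using ae by auto
  hence "integrable unif (\<lambda>x. ln (2 * s) - G x)"
    using nn by (intro integrableI_nonneg) (auto simp: top_unique intro: le_less_trans)
  from Bochner_Integration.integrable_diff[OF unif.integrable_const[of "ln (2 * s)"] this]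
  have Gint: "integrable unif G"
    by simp
  have dom: "integrable unif (\<lambda>x. \<bar>ln (2 * s)\<bar> + ln 2 + \<bar>G x\<bar>)"
    using Gint by auto
  have bound: "AE x in unif. norm (F k x) \<le> \<bar>ln (2 * s)\<bar> + ln 2 + \<bar>G x\<bar>" for k
    using ae
  proof eventually_elim
    case (elim x)
    have "ln 2 > (0::real)" by simp
    thus ?case using upper[of k x] lower[OF elim, of k] unfolding real_norm_def by linarith
  qed
  have "(\<lambda>k. integral\<^sup>L unif (F k)) \<longlonglongrightarrow> integral\<^sup>L unif G"
    by (rule integral_dominated_convergence[OF _ _ dom _ bound]) (use ae lim in auto)
  moreover have "integral\<^sup>L unif (F k) = ln s" for k
    using F has_bochner_integral_iff by blast
  ultimately have "integral\<^sup>L unif G = ln s"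
    by (simp add: LIMSEQ_const_iff)
  thus ?thesis using Gint by (simp add: has_bochner_integral_iff G_def[abs_def])
qed

text \<open>This is Jensen's formula for the single factor z - a: the mean starts to grow with
  \<open>s\<close> only once the circle encloses \<open>a\<close>.\<close>

lemma log_circle_mean:
  assumes "0 < s"
  shows "has_bochner_integral unif (\<lambda>x. ln (cmod (circ s x - a))) (ln (max s (cmod a)))"
  using log_circle_mean_inside[of a s] log_circle_mean_on[of a s] log_circle_mean_outside[of s a] assms
  by (cases "cmod a" s rule: linorder_cases) (auto simp: max_def)

text \<open>Compactness of the smaller closed disc makes the zeros finite in number. The polynomial
  over them has the same order as \<open>f\<close> at every point of the open disc, so the quotient
  extends without zeros.\<close>

lemma zero_factorization:
  assumes f: "f holomorphic_on ball 0 R" and f0: "f 0 \<noteq> 0" and R1: "0 < R1" "R1 < R"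
  defines "Z \<equiv> {z \<in> ball 0 R1. f z = 0}"
  obtains h where "finite Z" "h holomorphic_on ball 0 R1" "\<And>z. z \<in> ball 0 R1 \<Longrightarrow> h z \<noteq> 0"
    "\<And>z. z \<in> ball 0 R1 \<Longrightarrow> f z = h z * (\<Prod>a\<in>Z. (z - a) ^ nat (zorder f a))"
proof -
  have finZ: "finite Z"
  proof -
    have "finite {z \<in> cball 0 R1. f z = 0}"
    proof (cases "f constant_on ball 0 R")
      case True
      then obtain c where "\<And>z. z \<in> ball 0 R \<Longrightarrow> f z = c" by (auto simp: constant_on_def)
      hence "f z = f 0" if "z \<in> cball 0 R1" for z using that R1 by auto
      hence "{z \<in> cball 0 R1. f z = 0} = {}" using f0 by auto
      thus ?thesis by (simp only: finite.emptyI)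
    next
      case False
      thus ?thesis using R1 by (intro holomorphic_compact_finite_zeros[OF f]) auto
    qed
    thus ?thesis by (rule finite_subset[rotated]) (auto simp: Z_def)
  qed
  have nz: "eventually (\<lambda>w. f w \<noteq> 0) (at z)" if "z \<in> ball 0 R" for z
    using non_zero_neighbour_alt[of f "ball 0 R" z 0] that f f0 R1
    by (auto elim: eventually_mono)
  define P where "P z = (\<Prod>a\<in>Z. (z - a) ^ nat (zorder f a))" for z
  have pos: "zorder f z > 0 \<longleftrightarrow> f z = 0" if "z \<in> ball 0 R1" for z
    using that R1 nz[of z] by (intro zorder_pos_iff[OF f]) (auto intro!: eventually_frequently)
  have P0: "P z = 0 \<longleftrightarrow> f z = 0" if "z \<in> ball 0 R1" for z
    using pos that finZ by (auto simp: P_def Z_def prod_zero_iff)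
  have ord0: "zorder f z = 0" if "z \<in> ball 0 R1" "f z \<noteq> 0" for z
    using that R1 f by (intro zorder_eq_0I) (auto simp: analytic_at intro!: exI[of _ "ball 0 R"])
  have ordP: "zorder P z = zorder f z" if z: "z \<in> ball 0 R1" for z
  proof (cases "f z = 0")
    case False
    moreover have "P analytic_on {z}"
      unfolding P_def by (intro analytic_intros)
    ultimately show ?thesis using P0[OF z] ord0[OF z] by (simp add: zorder_eq_0I)
  next
    case True
    hence zZ: "z \<in> Z" using z by (simp add: Z_def)
    define Q where "Q w = (\<Prod>a\<in>Z-{z}. (w - a) ^ nat (zorder f a))" for w
    have Peq: "P w = Q w * (w - z) powi zorder f z" for w
      unfolding P_def Q_def using zZ finZ pos[OF z] True
      by (subst prod.remove[of Z z]) (auto simp: power_int_def)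
    show ?thesis
      by (rule zorder_eqI[of UNIV _ Q])
         (use finZ Peq in \<open>auto simp: Q_def[abs_def] intro!: holomorphic_intros\<close>)
  qed
  have Phol: "P holomorphic_on ball 0 R1"
    unfolding P_def by (intro holomorphic_intros)
  have fhol: "f holomorphic_on ball 0 R1"
    using R1 by (intro holomorphic_on_subset[OF f]) auto
  show ?thesis
    by (rule holomorphic_zorder_factorization[OF fhol _ _ Phol P0 ordP])
       (auto intro: that[OF finZ] simp: P_def)
qed

text \<open>Between the radii the mean grows by the sum over the zeros of m(a) (log max(\<rho>,|a|)
  - log max(r,|a|)). Each bracket is log(\<rho>/r) if |a| < r, zero if |a| \<ge> \<rho>, and in
  between otherwise.\<close>

lemma jensen_bounds:
  assumes f: "f holomorphic_on ball 0 R" and f0: "f 0 \<noteq> 0" and r: "0 < r" "r < \<rho>" "\<rho> < R"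
  defines "L \<equiv> \<lambda>s. (\<integral>x. ln (cmod (f (circ s x))) \<partial>unif)"
  shows "L r \<le> L \<rho>"
    and "ennreal (ln (\<rho> / r)) * zero_count f {z. cmod z < r} \<le> ennreal (L \<rho> - L r)"
    and "ennreal (L \<rho> - L r) \<le> ennreal (ln (\<rho> / r)) * zero_count f {z. cmod z < \<rho>}"
proof -
  obtain R1 where R1: "\<rho> < R1" "R1 < R" using r dense by blast
  define Z where "Z = {z \<in> ball 0 R1. f z = 0}"
  define m where "m a = nat (zorder f a)" for a
  obtain h where h: "finite Z" "h holomorphic_on ball 0 R1" "\<And>z. z \<in> ball 0 R1 \<Longrightarrow> h z \<noteq> 0"
    "\<And>z. z \<in> ball 0 R1 \<Longrightarrow> f z = h z * (\<Prod>a\<in>Z. (z - a) ^ m a)"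
    by (rule zero_factorization[OF f f0 _ R1(2), folded Z_def m_def]) (use r R1 in auto)
  have L: "L s = ln (cmod (h 0)) + (\<Sum>a\<in>Z. m a * ln (max s (cmod a)))" if s: "0 < s" "s < R1" for s
  proof -
    have I: "has_bochner_integral unif
       (\<lambda>x. ln (cmod (h (circ s x))) + (\<Sum>a\<in>Z. m a * ln (cmod (circ s x - a))))
       (ln (cmod (h 0)) + (\<Sum>a\<in>Z. m a * ln (max s (cmod a))))"
      by (intro has_bochner_integral_add has_bochner_integral_sum has_bochner_integral_mult_right
           log_circle_mean log_circle_mean_nonzero[of h R1 s] h s)
    \<comment> \<open>The logarithm of the product splits only where all factors are nonzero; zeros
      on the circle itself are allowed and cost a null set.\<close>
    have "AE x in unif. \<forall>a\<in>Z. circ s x \<noteq> a"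
      using h(1) s by (intro AE_finite_allI AE_circ_neq)
    hence ae: "AE x in unif. ln (cmod (f (circ s x))) =
        ln (cmod (h (circ s x))) + (\<Sum>a\<in>Z. m a * ln (cmod (circ s x - a)))"
    proof eventually_elim
      case (elim x)
      have c: "circ s x \<in> ball 0 R1" using s by simp
      have "ln (cmod (f (circ s x))) = ln (cmod (h (circ s x)) * (\<Prod>a\<in>Z. cmod (circ s x - a) ^ m a))"
        by (simp add: h(4)[OF c] norm_mult prod_norm [symmetric] norm_power)
      also have "\<dots> = ln (cmod (h (circ s x))) + ln (\<Prod>a\<in>Z. cmod (circ s x - a) ^ m a)"
        using h(3)[OF c] elim h(1) by (intro ln_mult_pos) (auto intro!: prod_pos)
      also have "ln (\<Prod>a\<in>Z. cmod (circ s x - a) ^ m a) = (\<Sum>a\<in>Z. m a * ln (cmod (circ s x - a)))"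
        using h(1) elim by (subst ln_prod) (auto simp: ln_realpow)
      finally show ?case .
    qed
    have meas: "(\<lambda>x. ln (cmod (f (circ s x)))) \<in> borel_measurable unif"
    proof -
      have "continuous_on {0..1} (\<lambda>x. f (circ s x))"
        by (rule continuous_on_compose2[OF holomorphic_on_imp_continuous_on[OF f]])
           (use s R1 in \<open>auto intro!: continuous_intros\<close>)
      from borel_measurable_has_bochner_integral[OF has_bochner_integral_unif_continuous[OF this]]
      have "(\<lambda>x. f (circ s x)) \<in> borel_measurable unif" .
      thus ?thesis by measurable
    qed
    show ?thesis
      unfolding L_def
      using I ae meas by (subst integral_cong_AE[OF _ _ ae]) (auto simp: has_bochner_integral_iff)
  qed
  have D: "L \<rho> - L r = (\<Sum>a\<in>Z. m a * (ln (max \<rho> (cmod a)) - ln (max r (cmod a))))"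
    using L[of \<rho>] L[of r] r R1 by (simp add: sum_subtractf algebra_simps)
  have Zc: "zero_count f {z. cmod z < t} = ennreal (\<Sum>a\<in>Z. real (m a) * (if cmod a < t then 1 else 0))"
    if "t \<le> \<rho>" for t
  proof -
    have "{z \<in> {z. cmod z < t}. f z = 0} = {a\<in>Z. cmod a < t}"
      using that R1 by (auto simp: Z_def)
    hence "zero_count f {z. cmod z < t} = (\<Sum>a | a \<in> Z \<and> cmod a < t. of_nat (m a))"
      unfolding zero_count_def m_def using h(1) by simp
    also have "\<dots> = ennreal (\<Sum>a | a \<in> Z \<and> cmod a < t. real (m a))"
      by (subst sum_ennreal [symmetric]) (auto simp: ennreal_of_nat_eq_real_of_nat)
    also have "(\<Sum>a | a \<in> Z \<and> cmod a < t. real (m a)) = (\<Sum>a\<in>Z. real (m a) * (if cmod a < t then 1 else 0))"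
      using h(1) by (intro sum.mono_neutral_cong_left) auto
    finally show ?thesis .
  qed
  have lnr: "ln (\<rho> / r) = ln \<rho> - ln r" "ln \<rho> > ln r"
    using r by (auto simp: ln_div)
  \<comment> \<open>Here \<open>f 0 \<noteq> 0\<close> is used: it keeps |a| away from 0, where
    \<open>ln\<close> has only a default value.\<close>
  have lnmax: "ln (max s (cmod a)) = max (ln s) (ln (cmod a))" "cmod a < s \<longleftrightarrow> ln (cmod a) < ln s"
    if "a \<in> Z" "0 < s" for a s
  proof -
    have "a \<noteq> 0" using that f0 by (auto simp: Z_def)
    thus "ln (max s (cmod a)) = max (ln s) (ln (cmod a))" "cmod a < s \<longleftrightarrow> ln (cmod a) < ln s"
      using that by (auto simp: max_def)
  qed
  have prod: "ennreal (ln (\<rho> / r)) * zero_count f {z. cmod z < t} =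
      ennreal ((\<Sum>a\<in>Z. real (m a) * (if cmod a < t then 1 else 0)) * ln (\<rho> / r))" if "t \<le> \<rho>" for t
    unfolding Zc[OF that] using lnr
    by (subst ennreal_mult [symmetric]) (auto simp: mult.commute intro!: sum_nonneg)
  have "(\<Sum>a\<in>Z. real (m a) * (if cmod a < r then 1 else 0)) * ln (\<rho> / r) \<le> L \<rho> - L r"
    unfolding D sum_distrib_right mult.assoc
    using r lnr by (intro sum_mono mult_left_mono) (auto simp: lnmax)
  moreover have "L \<rho> - L r \<le> (\<Sum>a\<in>Z. real (m a) * (if cmod a < \<rho> then 1 else 0)) * ln (\<rho> / r)"
    unfolding D sum_distrib_right mult.assoc
    using r lnr by (intro sum_mono mult_left_mono) (auto simp: lnmax)
  moreover have "0 \<le> L \<rho> - L r"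
    unfolding D using r by (intro sum_nonneg mult_nonneg_nonneg) auto
  ultimately show "L r \<le> L \<rho>"
    and "ennreal (ln (\<rho> / r)) * zero_count f {z. cmod z < r} \<le> ennreal (L \<rho> - L r)"
    and "ennreal (L \<rho> - L r) \<le> ennreal (ln (\<rho> / r)) * zero_count f {z. cmod z < \<rho>}"
    using r by (auto simp: prod intro!: ennreal_leI)
qed

section \<open>Logarithmic moments of Gaussian variables\<close>

lemma (in prob_space) char_distr:
  assumes [measurable]: "X \<in> borel_measurable M"
  shows "char (distr M borel X) t = (CLINT \<omega>|M. iexp (t * X \<omega>))"
  unfolding char_def by (subst integral_distr) auto

text \<open>Point masses fit the same formula with v = 0, so no partial sum has to be shown
  nondegenerate before passing to a limit.\<close>

lemma (in prob_space) char_centered_gaussian: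
  assumes X [measurable]: "X \<in> borel_measurable M" and g: "gaussian_rv M X"
    and mean: "expectation X = 0" and var: "expectation (\<lambda>\<omega>. (X \<omega>)\<^sup>2) = v"
  shows "char (distr M borel X) t = exp (- (v * t\<^sup>2) / 2)"
  using g unfolding gaussian_rv_def
proof (elim disjE exE conjE)
  fix \<mu> \<sigma> :: real
  assume \<sigma>: "0 < \<sigma>" and d: "distributed M lborel X (\<lambda>x. ennreal (normal_density \<mu> \<sigma> x))"
  have \<mu>: "\<mu> = 0"
    using normal_distributed_expectation[OF \<sigma> d] mean by simp
  have v: "v = \<sigma>\<^sup>2"
    using normal_distributed_variance[OF \<sigma> d] mean var by simp
  define Y where "Y \<omega> = X \<omega> / \<sigma>" for \<omega>
  have Y [measurable]: "Y \<in> borel_measurable M" unfolding Y_def by measurable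
  have "distributed M lborel Y std_normal_density"
    using normal_standard_normal_convert[OF \<sigma>, of X \<mu>] d \<mu> by (simp add: Y_def[abs_def])
  from distributed_distr_eq_density[OF this]
  have "distr M borel Y = std_normal_distribution"
    by (metis distr_cong sets_lborel)
  hence "char (distr M borel Y) (\<sigma> * t) = exp (- ((\<sigma> * t)\<^sup>2) / 2)"
    using char_std_normal_distribution by metis
  moreover have "char (distr M borel Y) (\<sigma> * t) = char (distr M borel X) t"
    using \<sigma> by (simp add: char_distr Y_def[abs_def])
  ultimately show ?thesis by (simp add: v power_mult_distrib)
next
  fix \<mu> :: real
  assume d: "distr M borel X = return borel \<mu>"
  have E: "expectation (\<lambda>\<omega>. h (X \<omega>)) = h \<mu>" if [measurable]: "h \<in> borel_measurable borel"
    for h :: "real \<Rightarrow> real"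
  proof -
    have "expectation (\<lambda>\<omega>. h (X \<omega>)) = (\<integral>x. h x \<partial>distr M borel X)"
      by (subst integral_distr) auto
    thus ?thesis unfolding d by (subst (asm) integral_return) auto
  qed
  have \<mu>: "\<mu> = 0" using E[of "\<lambda>x. x"] mean by simp
  have v: "v = 0" using E[of "\<lambda>x. x\<^sup>2"] var \<mu> by simp
  show ?thesis unfolding d char_def \<mu> v by (subst integral_return) auto
qed

text \<open>Almost sure convergence passes to characteristic functions by dominated convergence with
  bound 1, and Levy's uniqueness theorem recovers the law. Writing the limit as an image of the
  standard normal lets logarithmic moments be read off by scaling.\<close>

lemma (in prob_space) distr_gaussian_limit:
  assumes X: "\<And>k. X k \<in> borel_measurable M" and Y [measurable]: "Y \<in> borel_measurable M"
    and g: "\<And>k. gaussian_rv M (X k)"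
    and mean: "\<And>k. expectation (X k) = 0" and var: "\<And>k. expectation (\<lambda>\<omega>. (X k \<omega>)\<^sup>2) = v k"
    and lim: "AE \<omega> in M. (\<lambda>k. X k \<omega>) \<longlonglongrightarrow> Y \<omega>" and v: "v \<longlonglongrightarrow> \<sigma>\<^sup>2"
  shows "distr M borel Y = distr std_normal_distribution borel (\<lambda>x. \<sigma> * x)"
proof (rule Levy_uniqueness)
  note X [measurable]
  interpret N: real_distribution std_normal_distribution by (rule real_dist_normal_dist)
  show "real_distribution (distr M borel Y)"
    by (rule real_distribution_distr) measurable
  show "real_distribution (distr std_normal_distribution borel ((*) \<sigma>))"
    by (rule N.real_distribution_distr) measurable
  show "char (distr M borel Y) = char (distr std_normal_distribution borel ((*) \<sigma>))"
  proof
    fix t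
    have "(\<lambda>k. CLINT \<omega>|M. iexp (t * X k \<omega>)) \<longlonglongrightarrow> (CLINT \<omega>|M. iexp (t * Y \<omega>))"
      by (rule integral_dominated_convergence[where w="\<lambda>_. 1"])
         (use lim in \<open>auto elim!: eventually_mono intro!: tendsto_intros\<close>)
    moreover have "(CLINT \<omega>|M. iexp (t * X k \<omega>)) = exp (- (v k * t\<^sup>2) / 2)" for k
      using char_centered_gaussian[OF X g mean var] X by (simp add: char_distr)
    moreover have "(\<lambda>k. of_real (exp (- (v k * t\<^sup>2) / 2)) :: complex) \<longlonglongrightarrow> of_real (exp (- (\<sigma>\<^sup>2 * t\<^sup>2) / 2))"
      by (intro tendsto_intros v) auto
    ultimately have "(CLINT \<omega>|M. iexp (t * Y \<omega>)) = exp (- (\<sigma>\<^sup>2 * t\<^sup>2) / 2)"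
      by (simp add: LIMSEQ_unique)
    also have "\<dots> = char std_normal_distribution (\<sigma> * t)"
      by (simp add: char_std_normal_distribution power_mult_distrib)
    also have "\<dots> = char (distr std_normal_distribution borel ((*) \<sigma>)) t"
      by (subst N.char_distr) (auto simp: char_def mult_ac)
    finally show "char (distr M borel Y) t = char (distr std_normal_distribution borel ((*) \<sigma>)) t"
      by (simp add: char_distr)
  qed
qed

text \<open>Since $|e^{2\pi i x} - 1| \le 2\pi x$, this follows from the integrability of $\log|e^{2\pi i x}-1|$.\<close>

lemma integrable_unif_ln: "integrable unif ln"
proof (rule Bochner_Integration.integrable_bound)
  have L: "integrable unif (\<lambda>x. ln (cmod (circ 1 x - 1)))"
    using log_circle_mean_on[of 1 1] by (simp add: has_bochner_integral_iff)
  show "integrable unif (\<lambda>x. ln (2 * pi) - ln (cmod (circ 1 x - 1)))"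
    using L by (intro Bochner_Integration.integrable_diff) auto
  show "AE x in unif. norm (ln x) \<le> norm (ln (2 * pi) - ln (cmod (circ 1 x - 1)))"
    using AE_circ_neq[of 1 1, simplified] AE_space
  proof eventually_elim
    case (elim x)
    have "x \<noteq> 0" using elim by (auto simp: circ_def)
    hence x: "0 < x" "x \<le> 1" using elim by auto
    have "cmod (circ 1 x - 1) = 2 * \<bar>sin (2 * pi * x / 2)\<bar>"
      using dist_exp_i_1[of "2 * pi * x"] by (simp add: circ_def cis_conv_exp)
    also have "\<dots> \<le> 2 * \<bar>2 * pi * x / 2\<bar>"
      by (intro mult_left_mono abs_sin_x_le_abs_x) auto
    also have "\<dots> = 2 * pi * x" using x by simp
    finally have "ln (cmod (circ 1 x - 1)) \<le> ln (2 * pi * x)"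
      using elim x by (intro iffD2[OF ln_le_cancel_iff]) auto
    also have "\<dots> = ln (2 * pi) + ln x"
      using x by (simp add: ln_mult)
    finally show ?case using x by (simp add: abs_if)
  qed
qed (intro borel_measurable_unif, measurable)

text \<open>For |x| \<le> 1 the density is at most 1 and ln is integrable on the unit interval; for
  |x| > 1, ln |x| \<le> |x| reduces the claim to a Gaussian moment.\<close>

lemma integrable_std_normal_ln_abs: "integrable std_normal_distribution (\<lambda>x. ln \<bar>x\<bar>)"
proof -
  define f where "f x = indicator {0..1} x * ln x" for x :: real
  have f: "integrable lborel f"
    using integrable_unif_ln unfolding unif_def f_def
    by (subst (asm) integrable_restrict_space) (auto simp: )
  have f': "integrable lborel (\<lambda>x. f (- x))"
    using lborel_integrable_real_affine[OF f, of "-1" 0] by simp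
  have dle: "std_normal_density x \<le> 1" for x
  proof -
    have "std_normal_density x \<le> 1 / sqrt (2 * pi) * 1"
      unfolding std_normal_density_def by (intro mult_left_mono) auto
    also have "\<dots> \<le> 1" using pi_ge_two by (simp add: real_le_rsqrt)
    finally show ?thesis .
  qed
  have "integrable lborel (\<lambda>x. std_normal_density x * ln \<bar>x\<bar>)"
  proof (rule Bochner_Integration.integrable_bound)
    show "integrable lborel (\<lambda>x. \<bar>f x\<bar> + \<bar>f (- x)\<bar> + std_normal_density x * \<bar>x\<bar> ^ 1)"
      using f f' by (intro Bochner_Integration.integrable_add integrable_std_normal_moment_abs integrable_abs)
    show "AE x in lborel. norm (std_normal_density x * ln \<bar>x\<bar>) \<le>
        norm (\<bar>f x\<bar> + \<bar>f (- x)\<bar> + std_normal_density x * \<bar>x\<bar> ^ 1)"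
    proof (intro AE_I2)
      fix x :: real
      have nn: "0 \<le> std_normal_density x" by simp
      show "norm (std_normal_density x * ln \<bar>x\<bar>) \<le>
          norm (\<bar>f x\<bar> + \<bar>f (- x)\<bar> + std_normal_density x * \<bar>x\<bar> ^ 1)"
      proof (cases "\<bar>x\<bar> \<le> 1")
        case True
        have "\<bar>std_normal_density x * ln \<bar>x\<bar>\<bar> = std_normal_density x * \<bar>ln \<bar>x\<bar>\<bar>"
          using nn by (simp add: abs_mult)
        also have "\<dots> \<le> 1 * \<bar>ln \<bar>x\<bar>\<bar>"
          using dle by (intro mult_right_mono) auto
        also have "1 * \<bar>ln \<bar>x\<bar>\<bar> \<le> \<bar>f x\<bar> + \<bar>f (- x)\<bar>"
          using True by (cases "x < 0") (auto simp: f_def indicator_def)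
        finally have "\<bar>std_normal_density x * ln \<bar>x\<bar>\<bar> \<le> \<bar>f x\<bar> + \<bar>f (- x)\<bar>" .
        moreover have "0 \<le> std_normal_density x * \<bar>x\<bar>" by simp
        ultimately show ?thesis unfolding real_norm_def power_one_right by linarith
      next
        case False
        hence "0 \<le> ln \<bar>x\<bar>" "ln \<bar>x\<bar> \<le> \<bar>x\<bar>"
          using ln_less_self[of "\<bar>x\<bar>"] by (auto intro: less_imp_le)
        hence "std_normal_density x * ln \<bar>x\<bar> \<le> std_normal_density x * \<bar>x\<bar>"
          using nn by (intro mult_left_mono) auto
        thus ?thesis using nn \<open>0 \<le> ln \<bar>x\<bar>\<close> by (simp add: abs_mult)
      qed
    qed
  qed measurable
  thus ?thesis by (subst integrable_density) auto
qed

lemma measure_unif [simp]: "measure unif {0..1} = 1"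
  using unif.prob_space by simp

text \<open>
  Averaging over rotations recovers $\log|Z|$ from the real parts of the rotations of $Z$, so that only
  one-dimensional Gaussian laws are needed.
\<close>

lemma mean_log_abs_Re:
  assumes "Z \<noteq> 0"
  shows "has_bochner_integral unif (\<lambda>x. ln \<bar>Re (circ 1 x * Z)\<bar>) (ln (cmod Z) - ln 2)"
proof -
  \<comment> \<open>The points b and -b are the zeros of Re (w Z) on the unit circle: for |w| = 1, 2
    Re (w Z) = cnj w * Z * (w - b) * (w + b). Both linear factors have logarithmic mean 0.\<close>
  define b where "b = csqrt (- cnj Z / Z)"
  have b2: "b\<^sup>2 = - cnj Z / Z" by (simp add: b_def)
  have "cmod b ^ 2 = 1" using assms by (simp add: norm_power [symmetric] b2 norm_divide)
  hence b: "cmod b = 1" by (simp add: power2_eq_1_iff) (smt (verit) norm_ge_zero)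
  have eq: "\<bar>Re (circ 1 x * Z)\<bar> = cmod Z * cmod (circ 1 x - b) * cmod (circ 1 x - (- b)) / 2" for x
  proof -
    have cw: "circ 1 x * cnj (circ 1 x) = 1"
      by (simp add: circ_def cis_cnj cis_mult)
    have "of_real (2 * Re (circ 1 x * Z)) = circ 1 x * Z + cnj (circ 1 x) * cnj Z"
      using complex_add_cnj[of "circ 1 x * Z"] by simp
    also have "\<dots> = cnj (circ 1 x) * (Z * (circ 1 x - b) * (circ 1 x - (- b)))"
    proof -
      have "Z * (circ 1 x - b) * (circ 1 x - (- b)) = Z * ((circ 1 x)\<^sup>2 - b\<^sup>2)"
        by (simp add: power2_eq_square algebra_simps)
      also have "\<dots> = Z * (circ 1 x)\<^sup>2 + cnj Z"
        using assms by (simp add: b2 field_simps)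
      finally have "cnj (circ 1 x) * (Z * (circ 1 x - b) * (circ 1 x - (- b))) =
          cnj (circ 1 x) * (Z * (circ 1 x)\<^sup>2 + cnj Z)" by (simp only:)
      also have "\<dots> = (circ 1 x * cnj (circ 1 x)) * (circ 1 x * Z) + cnj (circ 1 x) * cnj Z"
        by (simp add: algebra_simps power2_eq_square)
      finally show ?thesis using cw by simp
    qed
    finally have "cmod (of_real (2 * Re (circ 1 x * Z))) =
        cmod (cnj (circ 1 x) * (Z * (circ 1 x - b) * (circ 1 x - (- b))))" by simp
    thus ?thesis by (simp only: norm_mult norm_of_real complex_mod_cnj norm_circ)
  qed
  have I: "has_bochner_integral unif
     (\<lambda>x. (ln (cmod Z) - ln 2) + (ln (cmod (circ 1 x - b)) + ln (cmod (circ 1 x - (- b)))))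
     ((ln (cmod Z) - ln 2) + (ln 1 + ln 1))"
    using b by (intro has_bochner_integral_add log_circle_mean_on)
      (auto simp: has_bochner_integral_iff unif.prob_space)
  have ae: "AE x in unif. (ln (cmod Z) - ln 2) + (ln (cmod (circ 1 x - b)) + ln (cmod (circ 1 x - (- b))))
      = ln \<bar>Re (circ 1 x * Z)\<bar>"
    using AE_circ_neq[of 1 b, simplified] AE_circ_neq[of 1 "- b", simplified]
  proof eventually_elim
    case (elim x)
    hence "circ 1 x - b \<noteq> 0" "circ 1 x - (- b) \<noteq> 0" by (auto simp: add_eq_0_iff)
    thus ?case unfolding eq using assms by (simp add: ln_mult ln_div)
  qed
  show ?thesis
    using I by (subst (asm) has_bochner_integral_cong_AE[OF _ _ ae]) auto
qed

text \<open>No explicit value is computed for this constant or the next two: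
  \<open>gauss_log\<close> is the same at every point and cancels between two radii, while the
  others only bound E |log |f(z)|| for Fubini.\<close>

definition gauss_log :: real where
  "gauss_log = (\<integral>x. ln \<bar>x\<bar> \<partial>std_normal_distribution)"

definition gauss_log_abs :: real where
  "gauss_log_abs = (\<integral>x. \<bar>ln \<bar>x\<bar>\<bar> \<partial>std_normal_distribution)"

definition gauss_abs :: real where
  "gauss_abs = (\<integral>x. \<bar>x\<bar> \<partial>std_normal_distribution)"

lemma std_normal_AE_neq_0: "AE x in std_normal_distribution. x \<noteq> 0"
proof -
  have "AE x::real in lborel. x \<noteq> 0" by (rule AE_lborel_singleton)
  thus ?thesis by (subst AE_density) (auto elim: eventually_mono)
qed

context prob_space begin

text \<open>Scaling by \<sigma> shifts the logarithm by the constant ln \<sigma>, off the null set x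
  = 0; this is how the variance enters the logarithmic moment.\<close>

lemma ln_abs_scaled_normal:
  assumes [measurable]: "X \<in> borel_measurable M"
    and d: "distr M borel X = distr std_normal_distribution borel (\<lambda>x. \<sigma> * x)" and \<sigma>: "0 < \<sigma>"
  shows "AE \<omega> in M. X \<omega> \<noteq> 0"
    and "has_bochner_integral M (\<lambda>\<omega>. ln \<bar>X \<omega>\<bar>) (ln \<sigma> + gauss_log)"
    and "expectation (\<lambda>\<omega>. \<bar>ln \<bar>X \<omega>\<bar>\<bar>) \<le> \<bar>ln \<sigma>\<bar> + gauss_log_abs"
    and "has_bochner_integral M (\<lambda>\<omega>. \<bar>X \<omega>\<bar>) (\<sigma> * gauss_abs)"
proof -
  interpret N: real_distribution std_normal_distribution by (rule real_dist_normal_dist)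
  have "AE x in distr M borel X. x \<noteq> 0"
    unfolding d using \<sigma> std_normal_AE_neq_0 by (subst AE_distr_iff) auto
  thus "AE \<omega> in M. X \<omega> \<noteq> 0"
    by (subst (asm) AE_distr_iff) auto
  have tr: "has_bochner_integral M (\<lambda>\<omega>. h (X \<omega>)) w"
    if "has_bochner_integral std_normal_distribution (\<lambda>x. h (\<sigma> * x)) w"
      and [measurable]: "h \<in> borel_measurable borel"
    for h :: "real \<Rightarrow> real" and w
  proof -
    have "integrable (distr M borel X) h" "integral\<^sup>L (distr M borel X) h = w"
      unfolding d using that(1)
      by (auto simp: integrable_distr_eq integral_distr has_bochner_integral_iff)
    thus ?thesis
      by (simp add: integrable_distr_eq integral_distr has_bochner_integral_iff)
  qed
  have ae: "AE x in std_normal_distribution. ln \<bar>\<sigma> * x\<bar> = ln \<sigma> + ln \<bar>x\<bar>"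
    using std_normal_AE_neq_0 by eventually_elim (use \<sigma> in \<open>simp add: abs_mult ln_mult\<close>)
  have "has_bochner_integral std_normal_distribution (\<lambda>x. ln \<sigma> + ln \<bar>x\<bar>) (ln \<sigma> + gauss_log)"
    using integrable_std_normal_ln_abs N.prob_space
    by (auto simp: has_bochner_integral_iff gauss_log_def)
  hence I: "has_bochner_integral std_normal_distribution (\<lambda>x. ln \<bar>\<sigma> * x\<bar>) (ln \<sigma> + gauss_log)"
    by (subst has_bochner_integral_cong_AE[OF _ _ ae]) auto
  thus "has_bochner_integral M (\<lambda>\<omega>. ln \<bar>X \<omega>\<bar>) (ln \<sigma> + gauss_log)"
    by (rule tr[of "\<lambda>x. ln \<bar>x\<bar>"]) auto
  have "has_bochner_integral std_normal_distribution (\<lambda>x. \<bar>ln \<bar>\<sigma> * x\<bar>\<bar>)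
      (\<integral>x. \<bar>ln \<bar>\<sigma> * x\<bar>\<bar> \<partial>std_normal_distribution)"
    using I by (auto simp: has_bochner_integral_iff)
  from tr[of "\<lambda>x. \<bar>ln \<bar>x\<bar>\<bar>", OF this]
  have "expectation (\<lambda>\<omega>. \<bar>ln \<bar>X \<omega>\<bar>\<bar>) = (\<integral>x. \<bar>ln \<bar>\<sigma> * x\<bar>\<bar> \<partial>std_normal_distribution)"
    by (auto simp: has_bochner_integral_iff)
  also have "\<dots> \<le> (\<integral>x. \<bar>ln \<sigma>\<bar> + \<bar>ln \<bar>x\<bar>\<bar> \<partial>std_normal_distribution)"
    using I ae integrable_std_normal_ln_abs
    by (intro integral_mono_AE) (auto simp: has_bochner_integral_iff elim!: eventually_mono)
  also have "\<dots> = \<bar>ln \<sigma>\<bar> + gauss_log_abs"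
    using integrable_std_normal_ln_abs N.prob_space by (simp add: gauss_log_abs_def)
  finally show "expectation (\<lambda>\<omega>. \<bar>ln \<bar>X \<omega>\<bar>\<bar>) \<le> \<bar>ln \<sigma>\<bar> + gauss_log_abs" .
  have "integrable std_normal_distribution (\<lambda>x. \<bar>x\<bar>)"
    using integrable_std_normal_distribution_moment[of 1] by simp
  hence "has_bochner_integral std_normal_distribution (\<lambda>x. \<bar>\<sigma> * x\<bar>) (\<sigma> * gauss_abs)"
    using \<sigma> by (auto simp: has_bochner_integral_iff gauss_abs_def abs_mult)
  thus "has_bochner_integral M (\<lambda>\<omega>. \<bar>X \<omega>\<bar>) (\<sigma> * gauss_abs)"
    by (rule tr[of "\<lambda>x. \<bar>x\<bar>"]) auto
qed

text \<open>Average ln |Re (w Z)| over both w and the probability space. Taking w first gives ln |Z|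
  - ln 2 for each outcome; taking the expectation first gives ln \<sigma> + \<open>gauss_log\<close>
  for every w. Knowing the law of each rotated real part replaces the joint law of Re Z and Im
  Z.\<close>

lemma ln_norm_complex_normal:
  assumes Z [measurable]: "Z \<in> borel_measurable M" and \<sigma>: "0 < \<sigma>"
    and d: "\<And>\<theta>. distr M borel (\<lambda>\<omega>. Re (cis \<theta> * Z \<omega>)) = distr std_normal_distribution borel (\<lambda>x. \<sigma> * x)"
  shows "AE \<omega> in M. Z \<omega> \<noteq> 0"
    and "has_bochner_integral M (\<lambda>\<omega>. ln (cmod (Z \<omega>))) (ln \<sigma> + gauss_log + ln 2)"
    and "expectation (\<lambda>\<omega>. \<bar>ln (cmod (Z \<omega>))\<bar>) \<le> \<bar>ln \<sigma>\<bar> + gauss_log_abs + 2 * \<sigma> * gauss_abs"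
proof -
  interpret P: pair_prob_space unif M ..
  define g where "g x \<omega> = ln \<bar>Re (circ 1 x * Z \<omega>)\<bar>" for x \<omega>
  have gm: "(\<lambda>(x, \<omega>). g x \<omega>) \<in> borel_measurable (unif \<Otimes>\<^sub>M M)"
    unfolding g_def by measurable
  have law: "distr M borel (\<lambda>\<omega>. Re (circ 1 x * Z \<omega>)) = distr std_normal_distribution borel (\<lambda>x. \<sigma> * x)" for x
    using d[of "2 * pi * x"] by (simp add: circ_def)
  have m: "(\<lambda>\<omega>. Re (circ 1 x * Z \<omega>)) \<in> borel_measurable M" for x
    by measurable
  note L = ln_abs_scaled_normal[OF m law \<sigma>]
  have m0: "(\<lambda>\<omega>. Re (Z \<omega>)) \<in> borel_measurable M" by measurable
  have m1: "(\<lambda>\<omega>. Im (Z \<omega>)) \<in> borel_measurable M" by measurable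
  have m2: "(\<lambda>\<omega>. - Im (Z \<omega>)) \<in> borel_measurable M" by measurable
  have d0: "distr M borel (\<lambda>\<omega>. Re (Z \<omega>)) = distr std_normal_distribution borel (\<lambda>x. \<sigma> * x)"
    using d[of 0] by simp
  have d2: "distr M borel (\<lambda>\<omega>. - Im (Z \<omega>)) = distr std_normal_distribution borel (\<lambda>x. \<sigma> * x)"
    using d[of "pi / 2"] by (simp add: cis_pi_half)
  note R = ln_abs_scaled_normal[OF m0 d0 \<sigma>]
  note I = ln_abs_scaled_normal(4)[OF m2 d2 \<sigma>, simplified]
  show nz: "AE \<omega> in M. Z \<omega> \<noteq> 0"
    using R(1) by eventually_elim auto
  \<comment> \<open>If |Z| \<ge> 1 then ln |Z| \<le> |Z| \<le> |Re Z| + |Im Z|; if |Z| < 1 the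
    logarithm is negative and |Re Z| \<le> |Z| bounds it from below.\<close>
  have bd: "AE \<omega> in M. \<bar>ln (cmod (Z \<omega>))\<bar> \<le> \<bar>ln \<bar>Re (Z \<omega>)\<bar>\<bar> + \<bar>Re (Z \<omega>)\<bar> + \<bar>Im (Z \<omega>)\<bar>"
    using R(1)
  proof eventually_elim
    case (elim \<omega>)
    have Zp: "cmod (Z \<omega>) > 0" using elim by auto
    show ?case
    proof (cases "cmod (Z \<omega>) \<ge> 1")
      case True
      hence "\<bar>ln (cmod (Z \<omega>))\<bar> \<le> cmod (Z \<omega>)"
        using ln_less_self[OF Zp] by simp
      also have "\<dots> \<le> \<bar>Re (Z \<omega>)\<bar> + \<bar>Im (Z \<omega>)\<bar>" by (rule cmod_le)
      finally show ?thesis by simp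
    next
      case False
      hence "\<bar>ln (cmod (Z \<omega>))\<bar> = - ln (cmod (Z \<omega>))" using Zp by simp
      also have "\<dots> \<le> - ln \<bar>Re (Z \<omega>)\<bar>"
        using elim Zp abs_Re_le_cmod[of "Z \<omega>"] by simp
      finally show ?thesis by simp
    qed
  qed
  have bI: "integrable M (\<lambda>\<omega>. \<bar>ln \<bar>Re (Z \<omega>)\<bar>\<bar> + \<bar>Re (Z \<omega>)\<bar> + \<bar>Im (Z \<omega>)\<bar>)"
    using R(2,4) I by (auto simp: has_bochner_integral_iff)
  have Zi: "integrable M (\<lambda>\<omega>. ln (cmod (Z \<omega>)))"
    by (rule Bochner_Integration.integrable_bound[OF bI]) (use bd in auto)
  have "expectation (\<lambda>\<omega>. \<bar>ln (cmod (Z \<omega>))\<bar>) \<le> expectation (\<lambda>\<omega>. \<bar>ln \<bar>Re (Z \<omega>)\<bar>\<bar> + \<bar>Re (Z \<omega>)\<bar> + \<bar>Im (Z \<omega>)\<bar>)"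
    using Zi bI bd by (intro integral_mono_AE) auto
  also have "\<dots> = expectation (\<lambda>\<omega>. \<bar>ln \<bar>Re (Z \<omega>)\<bar>\<bar>) + \<sigma> * gauss_abs + \<sigma> * gauss_abs"
    using R(2,4) I by (auto simp: has_bochner_integral_iff)
  also have "\<dots> \<le> \<bar>ln \<sigma>\<bar> + gauss_log_abs + 2 * \<sigma> * gauss_abs"
    using R(3) by simp
  finally show "expectation (\<lambda>\<omega>. \<bar>ln (cmod (Z \<omega>))\<bar>) \<le> \<bar>ln \<sigma>\<bar> + gauss_log_abs + 2 * \<sigma> * gauss_abs" .
  have gint: "integrable (unif \<Otimes>\<^sub>M M) (\<lambda>(x, \<omega>). g x \<omega>)"
  proof (rule P.Fubini_integrable[OF gm])
    \<comment> \<open>By rotation invariance the inner integral does not depend on the angle, so its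
      integrability over \<open>unif\<close> is trivial.\<close>
    have e: "(\<lambda>x. \<integral>\<omega>. norm (case (x, \<omega>) of (x, \<omega>) \<Rightarrow> g x \<omega>) \<partial>M) =
        (\<lambda>x. \<integral>y. \<bar>ln \<bar>\<sigma> * y\<bar>\<bar> \<partial>std_normal_distribution)"
    proof
      fix x
      have "(\<integral>\<omega>. norm (g x \<omega>) \<partial>M) = (\<integral>y. \<bar>ln \<bar>y\<bar>\<bar> \<partial>distr M borel (\<lambda>\<omega>. Re (circ 1 x * Z \<omega>)))"
        by (subst integral_distr) (auto simp: g_def)
      also have "\<dots> = (\<integral>y. \<bar>ln \<bar>\<sigma> * y\<bar>\<bar> \<partial>std_normal_distribution)"
        unfolding law by (subst integral_distr) auto
      finally show "(\<integral>\<omega>. norm (case (x, \<omega>) of (x, \<omega>) \<Rightarrow> g x \<omega>) \<partial>M) =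
        (\<integral>y. \<bar>ln \<bar>\<sigma> * y\<bar>\<bar> \<partial>std_normal_distribution)" by simp
    qed
    show "integrable unif (\<lambda>x. \<integral>\<omega>. norm (case (x, \<omega>) of (x, \<omega>) \<Rightarrow> g x \<omega>) \<partial>M)"
      unfolding e by simp
    show "AE x in unif. integrable M (\<lambda>\<omega>. case (x, \<omega>) of (x, \<omega>) \<Rightarrow> g x \<omega>)"
      using L(2) by (auto simp: g_def has_bochner_integral_iff)
  qed
  have "(\<integral>\<omega>. (\<integral>x. g x \<omega> \<partial>unif) \<partial>M) = (\<integral>x. (\<integral>\<omega>. g x \<omega> \<partial>M) \<partial>unif)"
    by (rule P.Fubini_integral[OF gint])
  also have "(\<lambda>x. \<integral>\<omega>. g x \<omega> \<partial>M) = (\<lambda>x. ln \<sigma> + gauss_log)"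
    using L(2) by (auto simp: g_def has_bochner_integral_iff)
  also have "(\<integral>x. ln \<sigma> + gauss_log \<partial>unif) = ln \<sigma> + gauss_log"
    using unif.prob_space by simp
  also have "(\<integral>\<omega>. (\<integral>x. g x \<omega> \<partial>unif) \<partial>M) = (\<integral>\<omega>. ln (cmod (Z \<omega>)) - ln 2 \<partial>M)"
  proof (rule integral_cong_AE)
    have [measurable]: "(\<lambda>(\<omega>, x). g x \<omega>) \<in> borel_measurable (M \<Otimes>\<^sub>M unif)"
      unfolding g_def by measurable
    show "(\<lambda>\<omega>. \<integral>x. g x \<omega> \<partial>unif) \<in> borel_measurable M" by measurable
    show "AE \<omega> in M. (\<integral>x. g x \<omega> \<partial>unif) = ln (cmod (Z \<omega>)) - ln 2"
      using nz by eventually_elim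
        (use mean_log_abs_Re in \<open>auto simp: g_def has_bochner_integral_iff\<close>)
  qed measurable
  also have "\<dots> = expectation (\<lambda>\<omega>. ln (cmod (Z \<omega>))) - ln 2"
    using Zi prob_space by simp
  finally show "has_bochner_integral M (\<lambda>\<omega>. ln (cmod (Z \<omega>))) (ln \<sigma> + gauss_log + ln 2)"
    using Zi by (simp add: has_bochner_integral_iff)
qed

end

section \<open>The covariance kernel\<close>

text \<open>The coefficient of the $m$-th noise variable in the $k$-th term of the moving average.\<close>

definition binom_row :: "nat \<Rightarrow> nat \<Rightarrow> nat \<Rightarrow> nat" where
  "binom_row n m k = (if k \<le> m then n choose (m - k) else 0)"

lemma binom_row_shift: "binom_row n (m + d) (k + d) = binom_row n m k"
  by (simp add: binom_row_def)

lemma binom_row_eq_0: "k + n < m \<Longrightarrow> binom_row n m k = 0"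
  by (simp add: binom_row_def)

lemma binom_row_above [simp]: "m < k \<Longrightarrow> binom_row n m k = 0"
  by (simp add: binom_row_def)

text \<open>Only rows l \<le> m \<le> k + n meet both columns, and all of them lie below N + n. With
  m = l + j, r = n - (l - k) and the symmetry of binomials the sum becomes Vandermonde's convolution
  of order r.\<close>

lemma sum_binom_row_prod_le:
  assumes "k \<le> l" "l < N"
  shows "(\<Sum>m<N+n. binom_row n m k * binom_row n m l) =
         (if l - k \<le> n then (2 * n) choose (n + (l - k)) else 0)"
proof (cases "l - k \<le> n")
  case False
  have "binom_row n m k * binom_row n m l = 0" for m
    using False by (cases "l \<le> m") (auto simp: binom_row_eq_0)
  thus ?thesis using False by simp
next
  case True
  define r where "r = n - (l - k)"
  have "(\<Sum>m<N+n. binom_row n m k * binom_row n m l) =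
        (\<Sum>m\<in>(\<lambda>j. l + j) ` {..r}. binom_row n m k * binom_row n m l)"
  proof (rule sum.mono_neutral_right)
    show "(\<lambda>j. l + j) ` {..r} \<subseteq> {..<N + n}"
      using assms by (auto simp: r_def)
    show "\<forall>m\<in>{..<N + n} - (\<lambda>j. l + j) ` {..r}. binom_row n m k * binom_row n m l = 0"
    proof
      fix m assume m: "m \<in> {..<N + n} - (\<lambda>j. l + j) ` {..r}"
      show "binom_row n m k * binom_row n m l = 0"
      proof (cases "l \<le> m")
        case lm: True
        have "m - l \<notin> {..r}"
          using m lm by (metis DiffD2 imageI le_add_diff_inverse)
        hence "k + n < m" using assms lm True by (auto simp: r_def)
        thus ?thesis by (simp add: binom_row_eq_0)
      qed auto
    qed
  qed auto
  also have "\<dots> = (\<Sum>j\<le>r. (n choose j) * (n choose (r - j)))"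
  proof (subst sum.reindex, simp, intro sum.cong refl)
    fix j assume j: "j \<in> {..r}"
    have "n choose (l + j - k) = n choose (n - (l + j - k))"
      using j assms True by (intro binomial_symmetric) (auto simp: r_def)
    also have "n - (l + j - k) = r - j"
      using j assms True by (auto simp: r_def)
    finally show "((\<lambda>m. binom_row n m k * binom_row n m l) \<circ> (+) l) j = (n choose j) * (n choose (r - j))"
      using assms by (simp add: binom_row_def)
  qed
  also have "\<dots> = (2 * n) choose r"
    by (subst vandermonde) (simp add: mult_2)
  also have "\<dots> = (2 * n) choose (n + (l - k))"
    using True by (subst binomial_symmetric) (auto simp: r_def)
  finally show ?thesis using True by simp
qed

lemma gamma_cov_eq_sum:
  assumes "k < N" "l < N"
  shows "gamma_cov n (int l - int k) =
    (\<Sum>m<N+n. real (binom_row n m k) * real (binom_row n m l)) / real ((2 * n) choose n)"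
proof -
  have main: "gamma_cov n (int l - int k) = real (\<Sum>m<N+n. binom_row n m k * binom_row n m l) / real ((2 * n) choose n)"
    if "k \<le> l" "l < N" for k l
  proof -
    have "nat (int n + (int l - int k)) = n + (l - k)" using that by simp
    thus ?thesis unfolding sum_binom_row_prod_le[OF that] gamma_cov_def using that by auto
  qed
  have symm: "gamma_cov n (- j) = gamma_cov n j" for j
  proof (cases "\<bar>j\<bar> \<le> int n")
    case True
    have "(2 * n) choose nat (int n + j) = (2 * n) choose (2 * n - nat (int n + j))"
      using True by (intro binomial_symmetric) auto
    also have "2 * n - nat (int n + j) = nat (int n + (- j))" using True by auto
    finally show ?thesis by (simp add: gamma_cov_def)
  qed (simp add: gamma_cov_def)
  show ?thesis
  proof (cases "k \<le> l")
    case True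
    thus ?thesis using main[of k l] assms by simp
  next
    case False
    have "gamma_cov n (int l - int k) = gamma_cov n (int k - int l)"
      using symm[of "int k - int l"] by simp
    thus ?thesis using main[of l k] assms False by (simp add: mult.commute)
  qed
qed

section \<open>The variance of a truncated series as a sum of squares, and its limit\<close>

lemma cmod_sum_square:
  fixes a :: "nat \<Rightarrow> complex"
  shows "of_real ((cmod (\<Sum>k\<in>A. a k))\<^sup>2) = (\<Sum>k\<in>A. \<Sum>l\<in>A. a k * cnj (a l))"
  unfolding complex_norm_square by (simp add: sum_product)

text \<open>This is the variance of the series truncated at \<open>N\<close>. Because the covariance
  is a Gram matrix of binomial rows, interchanging sums turns the quadratic form into one square per
  row.\<close>

lemma gamma_cov_quadratic_form:
  fixes z :: complex
  shows "(\<Sum>k<N. \<Sum>l<N. of_real (gamma_cov n (int l - int k)) * (z ^ k * cnj (z ^ l))) =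
     of_real ((\<Sum>m<N+n. (cmod (\<Sum>k<N. of_nat (binom_row n m k) * z ^ k))\<^sup>2) / real ((2 * n) choose n))"
proof -
  let ?C = "of_nat ((2 * n) choose n) :: complex"
  let ?b = "\<lambda>m k. of_nat (binom_row n m k) :: complex"
  have "(\<Sum>k<N. \<Sum>l<N. of_real (gamma_cov n (int l - int k)) * (z ^ k * cnj (z ^ l))) =
      (\<Sum>k<N. \<Sum>l<N. \<Sum>m<N+n. (?b m k * z ^ k) * cnj (?b m l * z ^ l) / ?C)"
  proof (intro sum.cong refl)
    fix k l assume "k \<in> {..<N}" "l \<in> {..<N}"
    hence "of_real (gamma_cov n (int l - int k)) = (\<Sum>m<N+n. ?b m k * ?b m l) / ?C"
      by (subst gamma_cov_eq_sum[of k N l]) auto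
    thus "of_real (gamma_cov n (int l - int k)) * (z ^ k * cnj (z ^ l)) =
       (\<Sum>m<N+n. (?b m k * z ^ k) * cnj (?b m l * z ^ l) / ?C)"
      by (simp add: sum_divide_distrib sum_distrib_left sum_distrib_right mult_ac)
  qed
  also have "\<dots> = (\<Sum>m<N+n. \<Sum>k<N. \<Sum>l<N. (?b m k * z ^ k) * cnj (?b m l * z ^ l) / ?C)"
    by (subst sum.swap[of _ "{..<N}" "{..<N+n}"], subst sum.swap[of _ "{..<N}" "{..<N+n}"]) (rule refl)
  also have "\<dots> = (\<Sum>m<N+n. of_real ((cmod (\<Sum>k<N. ?b m k * z ^ k))\<^sup>2) / ?C)"
    by (simp only: cmod_sum_square sum_divide_distrib)
  also have "\<dots> = of_real ((\<Sum>m<N+n. (cmod (\<Sum>k<N. ?b m k * z ^ k))\<^sup>2) / real ((2 * n) choose n))"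
    by (simp add: sum_divide_distrib)
  finally show ?thesis .
qed

text \<open>The rows m < n are those cut off at k = 0. A complete row gives a multiple of (1 + z)^n,
  which vanishes at -1; these incomplete ones are what keeps the kernel positive there.\<close>

definition residual :: "nat \<Rightarrow> complex \<Rightarrow> real" where
  "residual n z = (\<Sum>m<n. (cmod (\<Sum>k\<le>m. of_nat (n choose (m - k)) * z ^ k))\<^sup>2)"

definition kernel :: "nat \<Rightarrow> complex \<Rightarrow> real" where
  "kernel n z = ((cmod (1 + z)) ^ (2 * n) / (1 - (cmod z)\<^sup>2) + residual n z) / real ((2 * n) choose n)"

text \<open>The row m = 0 is the constant polynomial 1. The bound makes log K finite and later
  bounds the denominator from below near \<phi> = 0.\<close>

lemma residual_ge_1: "0 < n \<Longrightarrow> 1 \<le> residual n z"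
proof -
  assume "0 < n"
  hence "(cmod (\<Sum>k\<le>0. of_nat (n choose (0 - k)) * z ^ k))\<^sup>2 \<le> residual n z"
    unfolding residual_def by (intro member_le_sum) auto
  thus ?thesis by simp
qed

lemma kernel_pos:
  assumes "0 < n" "cmod z < 1"
  shows "0 < kernel n z"
proof -
  have "(cmod z)\<^sup>2 < 1" using assms by (simp add: abs_square_less_1)
  hence "0 \<le> (cmod (1 + z)) ^ (2 * n) / (1 - (cmod z)\<^sup>2)" by simp
  thus ?thesis using residual_ge_1[OF assms(1), of z]
    unfolding kernel_def by (intro divide_pos_pos) auto
qed

lemma sum_lessThan_add: "(\<Sum>i<a + b. f i) = (\<Sum>i<a. f i) + (\<Sum>i<b. f (a + i))"
  for f :: "nat \<Rightarrow> 'a :: comm_monoid_add"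
  by (induction b) (auto simp: add_ac)

text \<open>The last n rows are cut off by the truncation k < n + d. Shifting the index by d pulls
  out z^d, so their squares decay like |z|^(2d).\<close>

lemma binom_row_poly_tail:
  fixes z :: complex
  shows "(\<Sum>k<n + d. of_nat (binom_row n (n + d + i) k) * z ^ k) =
         z ^ d * (\<Sum>j<n. of_nat (binom_row n (n + i) j) * z ^ j)"
proof -
  have "(\<Sum>k<n + d. of_nat (binom_row n (n + d + i) k) * z ^ k) =
        (\<Sum>k<d. of_nat (binom_row n (n + d + i) k) * z ^ k) +
        (\<Sum>j<n. of_nat (binom_row n (n + d + i) (d + j)) * z ^ (d + j))"
    by (subst add.commute, rule sum_lessThan_add)
  also have "(\<Sum>k<d. of_nat (binom_row n (n + d + i) k) * z ^ k) = 0"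
    by (intro sum.neutral) (auto simp: binom_row_eq_0)
  also have "(\<Sum>j<n. of_nat (binom_row n (n + d + i) (d + j)) * z ^ (d + j)) =
     z ^ d * (\<Sum>j<n. of_nat (binom_row n (n + i) j) * z ^ j)"
    unfolding sum_distrib_left
  proof (intro sum.cong refl)
    fix j
    have "binom_row n (n + d + i) (d + j) = binom_row n (n + i) j"
      using binom_row_shift[of n "n + i" d j] by (simp add: add_ac)
    thus "of_nat (binom_row n (n + d + i) (d + j)) * z ^ (d + j) =
        z ^ d * (of_nat (binom_row n (n + i) j) * z ^ j)"
      by (simp add: power_add mult_ac)
  qed
  finally show ?thesis by simp
qed

text \<open>All n + 1 entries of this row, in columns i to i + n, lie below the truncation, so the
  binomial theorem applies.\<close>

lemma binom_row_poly_middle: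
  fixes z :: complex
  assumes "i < d"
  shows "(\<Sum>k<n + d. of_nat (binom_row n (n + i) k) * z ^ k) = z ^ i * (1 + z) ^ n"
proof -
  have "(\<Sum>k<n + d. of_nat (binom_row n (n + i) k) * z ^ k) =
        (\<Sum>k\<in>(+) i ` {..n}. of_nat (binom_row n (n + i) k) * z ^ k)"
  proof (rule sum.mono_neutral_right)
    show "\<forall>k\<in>{..<n + d} - (+) i ` {..n}. of_nat (binom_row n (n + i) k) * z ^ k = 0"
    proof
      fix k assume k: "k \<in> {..<n + d} - (+) i ` {..n}"
      show "of_nat (binom_row n (n + i) k) * z ^ k = 0"
      proof (cases "i \<le> k")
        case True
        have "k - i \<notin> {..n}" using k True by (metis DiffD2 imageI le_add_diff_inverse)
        thus ?thesis using True by simp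
      qed (simp add: binom_row_eq_0)
    qed
  qed (use assms in auto)
  also have "\<dots> = (\<Sum>j\<le>n. of_nat (n choose j) * z ^ j * z ^ i)"
  proof (subst sum.reindex, simp, intro sum.cong refl)
    fix j assume j: "j \<in> {..n}"
    have "n choose (n - j) = n choose j" using j by (simp add: binomial_symmetric [symmetric])
    thus "((\<lambda>k. of_nat (binom_row n (n + i) k) * z ^ k) \<circ> (+) i) j = of_nat (n choose j) * z ^ j * z ^ i"
      using j by (simp add: binom_row_def power_add)
  qed
  also have "\<dots> = z ^ i * (1 + z) ^ n"
    by (simp add: binomial_ring [of z 1, simplified add.commute] sum_distrib_left mult_ac)
  finally show ?thesis .
qed

lemma binom_row_poly_low:
  fixes z :: complex
  assumes "m < n"
  shows "(\<Sum>k<n + d. of_nat (binom_row n m k) * z ^ k) = (\<Sum>k\<le>m. of_nat (n choose (m - k)) * z ^ k)"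
proof -
  have "(\<Sum>k<n + d. of_nat (binom_row n m k) * z ^ k) = (\<Sum>k\<le>m. of_nat (binom_row n m k) * z ^ k)"
    using assms by (intro sum.mono_neutral_right) auto
  thus ?thesis by (simp add: binom_row_def)
qed

text \<open>The n + d + n rows form three blocks: the first is the residual, the d complete rows
  give a geometric series in |z|^2 times |1 + z|^(2n), and the last block tends to 0.\<close>

lemma quadratic_form_tendsto_kernel:
  fixes z :: complex
  assumes "cmod z < 1"
  shows "(\<lambda>d. (\<Sum>m<n + d + n. (cmod (\<Sum>k<n + d. of_nat (binom_row n m k) * z ^ k))\<^sup>2) /
      real ((2 * n) choose n)) \<longlonglongrightarrow> kernel n z"
proof -
  define E where "E = (\<Sum>i<n. (cmod (\<Sum>j<n. of_nat (binom_row n (n + i) j) * z ^ j))\<^sup>2)"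
  have z2: "(cmod z)\<^sup>2 < 1" using assms by (simp add: abs_square_less_1)
  have split: "(\<Sum>m<n + d + n. (cmod (\<Sum>k<n + d. of_nat (binom_row n m k) * z ^ k))\<^sup>2) =
      residual n z + (\<Sum>i<d. ((cmod z)\<^sup>2) ^ i) * (cmod (1 + z)) ^ (2 * n) + ((cmod z)\<^sup>2) ^ d * E" for d
  proof -
    have "(\<Sum>m<n + d + n. (cmod (\<Sum>k<n + d. of_nat (binom_row n m k) * z ^ k))\<^sup>2) =
      (\<Sum>m<n. (cmod (\<Sum>k<n + d. of_nat (binom_row n m k) * z ^ k))\<^sup>2) +
      (\<Sum>i<d. (cmod (\<Sum>k<n + d. of_nat (binom_row n (n + i) k) * z ^ k))\<^sup>2) +
      (\<Sum>i<n. (cmod (\<Sum>k<n + d. of_nat (binom_row n (n + d + i) k) * z ^ k))\<^sup>2)"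
      by (simp only: sum_lessThan_add)
    also have "(\<Sum>m<n. (cmod (\<Sum>k<n + d. of_nat (binom_row n m k) * z ^ k))\<^sup>2) = residual n z"
      unfolding residual_def by (intro sum.cong refl) (simp add: binom_row_poly_low)
    also have "(\<Sum>i<d. (cmod (\<Sum>k<n + d. of_nat (binom_row n (n + i) k) * z ^ k))\<^sup>2) =
        (\<Sum>i<d. ((cmod z)\<^sup>2) ^ i) * (cmod (1 + z)) ^ (2 * n)"
      unfolding sum_distrib_right
    proof (intro sum.cong refl)
      fix i assume i: "i \<in> {..<d}"
      have "(cmod (z ^ i * (1 + z) ^ n))\<^sup>2 = ((cmod z)\<^sup>2) ^ i * (cmod (1 + z)) ^ (2 * n)"
        by (simp add: norm_mult norm_power power_mult_distrib power_mult [symmetric] mult.commute)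
      thus "(cmod (\<Sum>k<n + d. of_nat (binom_row n (n + i) k) * z ^ k))\<^sup>2 =
          ((cmod z)\<^sup>2) ^ i * (cmod (1 + z)) ^ (2 * n)"
        using i by (simp add: binom_row_poly_middle)
    qed
    also have "(\<Sum>i<n. (cmod (\<Sum>k<n + d. of_nat (binom_row n (n + d + i) k) * z ^ k))\<^sup>2) = ((cmod z)\<^sup>2) ^ d * E"
      unfolding E_def sum_distrib_left
    proof (intro sum.cong refl)
      fix i
      let ?s = "\<Sum>j<n. of_nat (binom_row n (n + i) j) * z ^ j"
      have "(cmod (z ^ d * ?s))\<^sup>2 = ((cmod z)\<^sup>2) ^ d * (cmod ?s)\<^sup>2"
        unfolding norm_mult norm_power power_mult_distrib
        by (simp add: power_mult [symmetric] mult.commute[of d])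
      thus "(cmod (\<Sum>k<n + d. of_nat (binom_row n (n + d + i) k) * z ^ k))\<^sup>2 =
          ((cmod z)\<^sup>2) ^ d * (cmod ?s)\<^sup>2"
        by (simp only: binom_row_poly_tail)
    qed
    finally show ?thesis .
  qed
  have g: "(\<lambda>d. \<Sum>i<d. ((cmod z)\<^sup>2) ^ i) \<longlonglongrightarrow> 1 / (1 - (cmod z)\<^sup>2)"
    using geometric_sums[of "(cmod z)\<^sup>2"] z2 by (simp add: sums_def)
  have p: "(\<lambda>d. ((cmod z)\<^sup>2) ^ d) \<longlonglongrightarrow> 0"
    using z2 by (intro LIMSEQ_power_zero) auto
  have "(\<lambda>d. (residual n z + (\<Sum>i<d. ((cmod z)\<^sup>2) ^ i) * (cmod (1 + z)) ^ (2 * n) + ((cmod z)\<^sup>2) ^ d * E) /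
      real ((2 * n) choose n)) \<longlonglongrightarrow>
      (residual n z + 1 / (1 - (cmod z)\<^sup>2) * (cmod (1 + z)) ^ (2 * n) + 0 * E) / real ((2 * n) choose n)"
    by (intro tendsto_intros g p) auto
  thus ?thesis unfolding split kernel_def by (simp add: add.commute)
qed

section \<open>The Gaussian power series\<close>

locale binomial_process = prob_space M for M :: "'a measure" +
  fixes n :: nat and \<xi> :: "int \<Rightarrow> 'a \<Rightarrow> complex"
  assumes n_pos: "0 < n"
    and gaussian: "complex_gaussian_process M \<xi>"
    and circular: "circularly_symmetric M \<xi>"
    and centered: "centered M \<xi>"
    and covariance: "has_covariance M \<xi> (gamma_cov n)"
begin

lemma xi_measurable [measurable]: "\<xi> k \<in> borel_measurable M"
  using gaussian by (simp add: complex_gaussian_process_def)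

lemma xi_path_measurable: "(\<lambda>\<omega> k. \<xi> k \<omega>) \<in> measurable M (Pi\<^sub>M UNIV (\<lambda>_. borel))"
  by (rule measurable_PiM_single') auto

lemma xi_cov:
  "integrable M (\<lambda>\<omega>. \<xi> k \<omega> * cnj (\<xi> l \<omega>))"
  "expectation (\<lambda>\<omega>. \<xi> k \<omega> * cnj (\<xi> l \<omega>)) = complex_of_real (gamma_cov n (l - k))"
  using covariance by (auto simp: has_covariance_def)

text \<open>Rotation by \<theta> multiplies the product by e^(2 i \<theta>) without changing the
  law. At \<theta> = pi/2 the factor is -1, so the expectation equals its own negative.\<close>

lemma xi_pseudo_cov:
  "integrable M (\<lambda>\<omega>. \<xi> k \<omega> * \<xi> l \<omega>)"
  "expectation (\<lambda>\<omega>. \<xi> k \<omega> * \<xi> l \<omega>) = 0"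
proof -
  show I: "integrable M (\<lambda>\<omega>. \<xi> k \<omega> * \<xi> l \<omega>)"
    by (rule Bochner_Integration.integrable_bound[OF xi_cov(1)[of k l]]) (auto simp: norm_mult)
  define h where "h x = x k * x l" for x :: "int \<Rightarrow> complex"
  have h [measurable]: "h \<in> borel_measurable (Pi\<^sub>M UNIV (\<lambda>_. borel))"
    unfolding h_def by measurable
  have path [measurable]: "(\<lambda>\<omega> k. cis \<theta> * \<xi> k \<omega>) \<in> measurable M (Pi\<^sub>M UNIV (\<lambda>_. borel))" for \<theta>
    by (rule measurable_PiM_single') auto
  have "expectation (\<lambda>\<omega>. h (\<lambda>k. cis \<theta> * \<xi> k \<omega>)) = expectation (\<lambda>\<omega>. h (\<lambda>k. \<xi> k \<omega>))" for \<theta>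
  proof -
    have "expectation (\<lambda>\<omega>. h (\<lambda>k. cis \<theta> * \<xi> k \<omega>)) = integral\<^sup>L (process_law M (\<lambda>k \<omega>. cis \<theta> * \<xi> k \<omega>)) h"
      unfolding process_law_def by (subst integral_distr) auto
    also have "process_law M (\<lambda>k \<omega>. cis \<theta> * \<xi> k \<omega>) = process_law M \<xi>"
      using circular by (simp add: circularly_symmetric_def)
    also have "integral\<^sup>L \<dots> h = expectation (\<lambda>\<omega>. h (\<lambda>k. \<xi> k \<omega>))"
      unfolding process_law_def using xi_path_measurable by (subst integral_distr) auto
    finally show ?thesis .
  qed
  from this[of "pi / 2"] have "expectation (\<lambda>\<omega>. - (\<xi> k \<omega> * \<xi> l \<omega>)) = expectation (\<lambda>\<omega>. \<xi> k \<omega> * \<xi> l \<omega>)"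
    by (simp add: h_def cis_pi_half mult_ac)
  hence "- expectation (\<lambda>\<omega>. \<xi> k \<omega> * \<xi> l \<omega>) = expectation (\<lambda>\<omega>. \<xi> k \<omega> * \<xi> l \<omega>)"
    using I by (simp only: Bochner_Integration.integral_minus)
  moreover have "a = 0" if "- a = a" for a :: complex
    using that by (auto simp: complex_eq_iff)
  ultimately show "expectation (\<lambda>\<omega>. \<xi> k \<omega> * \<xi> l \<omega>) = 0" by blast
qed

section \<open>Partial sums: Gaussian law, variance and convergence\<close>

definition partial :: "nat \<Rightarrow> complex \<Rightarrow> 'a \<Rightarrow> complex" where
  "partial N z \<omega> = (\<Sum>k<N. \<xi> (int k) \<omega> * z ^ k)"

lemma partial_measurable [measurable]: "partial N z \<in> borel_measurable M"
  unfolding partial_def by measurable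

lemma gaussian_Re_partial: "gaussian_rv M (\<lambda>\<omega>. Re (c * partial N z \<omega>))"
proof -
  have "gaussian_rv M (\<lambda>\<omega>. Re (\<Sum>k\<in>int ` {..<N}. (c * z ^ nat k) * \<xi> k \<omega>))"
    using gaussian[unfolded complex_gaussian_process_def, THEN conjunct2, rule_format,
        of "int ` {..<N}" "\<lambda>k. c * z ^ nat k"] by simp
  also have "(\<lambda>\<omega>. Re (\<Sum>k\<in>int ` {..<N}. (c * z ^ nat k) * \<xi> k \<omega>)) = (\<lambda>\<omega>. Re (c * partial N z \<omega>))"
    by (subst sum.reindex) (auto simp: partial_def sum_distrib_left mult_ac fun_eq_iff)
  finally show ?thesis .
qed

lemma mean_Re_partial: "expectation (\<lambda>\<omega>. Re (c * partial N z \<omega>)) = 0"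
proof -
  have I: "integrable M (\<xi> k)" "integral\<^sup>L M (\<xi> k) = 0" for k
    using centered by (auto simp: centered_def)
  have "has_bochner_integral M (\<lambda>\<omega>. c * partial N z \<omega>) (c * (\<Sum>k<N. 0 * z ^ k))"
    unfolding partial_def
    by (intro has_bochner_integral_mult_right has_bochner_integral_sum has_bochner_integral_mult_left)
       (use I in \<open>auto simp: has_bochner_integral_iff\<close>)
  from has_bochner_integral_bounded_linear[OF bounded_linear_Re this]
  show ?thesis by (simp add: has_bochner_integral_iff)
qed

definition quad_form :: "nat \<Rightarrow> complex \<Rightarrow> real" where
  "quad_form N z = (\<Sum>m<N+n. (cmod (\<Sum>k<N. of_nat (binom_row n m k) * z ^ k))\<^sup>2) / real ((2 * n) choose n)"

text \<open>Since (Re v)^2 = |v|^2/2 + Re(v^2)/2 and the pseudo-covariance removes the second term,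
  every direction \<open>c\<close> carries half of the total variance.\<close>

lemma variance_Re_partial:
  assumes "cmod c = 1"
  shows "expectation (\<lambda>\<omega>. (Re (c * partial N z \<omega>))\<^sup>2) = quad_form N z / 2"
proof -
  have "has_bochner_integral M (\<lambda>\<omega>. \<Sum>k<N. \<Sum>l<N. (\<xi> (int k) \<omega> * cnj (\<xi> (int l) \<omega>)) * (z ^ k * cnj (z ^ l)))
      (\<Sum>k<N. \<Sum>l<N. of_real (gamma_cov n (int l - int k)) * (z ^ k * cnj (z ^ l)))"
    by (intro has_bochner_integral_sum has_bochner_integral_mult_left)
       (auto simp: has_bochner_integral_iff xi_cov)
  also have "(\<lambda>\<omega>. \<Sum>k<N. \<Sum>l<N. (\<xi> (int k) \<omega> * cnj (\<xi> (int l) \<omega>)) * (z ^ k * cnj (z ^ l))) =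
      (\<lambda>\<omega>. of_real ((cmod (partial N z \<omega>))\<^sup>2))"
    unfolding partial_def cmod_sum_square by (simp add: mult_ac)
  finally have "has_bochner_integral M (\<lambda>\<omega>. complex_of_real ((cmod (partial N z \<omega>))\<^sup>2)) (of_real (quad_form N z))"
    unfolding gamma_cov_quadratic_form quad_form_def .
  from has_bochner_integral_bounded_linear[OF bounded_linear_Re this]
  have A: "has_bochner_integral M (\<lambda>\<omega>. (cmod (partial N z \<omega>))\<^sup>2) (quad_form N z)"
    by (simp del: of_real_power)
  have "has_bochner_integral M (\<lambda>\<omega>. \<Sum>k<N. \<Sum>l<N. (\<xi> (int k) \<omega> * \<xi> (int l) \<omega>) * (z ^ k * z ^ l))
      (\<Sum>k<N. \<Sum>l<N. 0 * (z ^ k * z ^ l))"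
    by (intro has_bochner_integral_sum has_bochner_integral_mult_left)
       (auto simp: has_bochner_integral_iff xi_pseudo_cov)
  also have "(\<lambda>\<omega>. \<Sum>k<N. \<Sum>l<N. (\<xi> (int k) \<omega> * \<xi> (int l) \<omega>) * (z ^ k * z ^ l)) = (\<lambda>\<omega>. (partial N z \<omega>)\<^sup>2)"
    unfolding partial_def power2_eq_square sum_product by (simp add: mult_ac)
  finally have "has_bochner_integral M (\<lambda>\<omega>. (partial N z \<omega>)\<^sup>2) 0" by simp
  from has_bochner_integral_bounded_linear[OF bounded_linear_Re has_bochner_integral_mult_right[of "c\<^sup>2", OF this]]
  have B: "has_bochner_integral M (\<lambda>\<omega>. Re (c\<^sup>2 * (partial N z \<omega>)\<^sup>2)) 0"
    by simp
  have eq: "(Re (c * w))\<^sup>2 = (cmod w)\<^sup>2 / 2 + Re (c\<^sup>2 * w\<^sup>2) / 2" for w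
  proof -
    have "(cmod w)\<^sup>2 = (cmod (c * w))\<^sup>2" using assms by (simp add: norm_mult)
    moreover have "c\<^sup>2 * w\<^sup>2 = (c * w)\<^sup>2" by (simp add: power_mult_distrib)
    moreover have "(Re v)\<^sup>2 = (cmod v)\<^sup>2 / 2 + Re (v\<^sup>2) / 2" for v
      unfolding cmod_power2 by (simp add: power2_eq_square field_simps)
    ultimately show ?thesis by metis
  qed
  have "has_bochner_integral M (\<lambda>\<omega>. (Re (c * partial N z \<omega>))\<^sup>2) (quad_form N z / 2 + 0 / 2)"
    unfolding eq by (intro has_bochner_integral_add has_bochner_integral_divide A B)
  thus ?thesis by (simp add: has_bochner_integral_iff)
qed

lemma quad_form_tendsto: "cmod z < 1 \<Longrightarrow> (\<lambda>d. quad_form (n + d) z) \<longlonglongrightarrow> kernel n z"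
  unfolding quad_form_def by (rule quadratic_form_tendsto_kernel)

text \<open>The normalization gives second moment 1, and x \<le> 1 + x^2 turns it into a first
  moment bound; what counts is uniformity in k, for the radius of convergence.\<close>

lemma xi_norm_integrable: "integrable M (\<lambda>\<omega>. cmod (\<xi> k \<omega>))" "expectation (\<lambda>\<omega>. cmod (\<xi> k \<omega>)) \<le> 2"
proof -
  show I: "integrable M (\<lambda>\<omega>. cmod (\<xi> k \<omega>))"
    using centered by (auto simp: centered_def)
  have S: "has_bochner_integral M (\<lambda>\<omega>. \<xi> k \<omega> * cnj (\<xi> k \<omega>)) 1"
    using n_pos by (simp add: has_bochner_integral_iff xi_cov gamma_cov_def)
  have "has_bochner_integral M (\<lambda>\<omega>. Re (\<xi> k \<omega> * cnj (\<xi> k \<omega>))) 1"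
    using has_bochner_integral_bounded_linear[OF bounded_linear_Re S] by simp
  hence S: "has_bochner_integral M (\<lambda>\<omega>. (cmod (\<xi> k \<omega>))\<^sup>2) 1"
    by (simp add: complex_norm_square [symmetric] del: of_real_power)
  have "expectation (\<lambda>\<omega>. cmod (\<xi> k \<omega>)) \<le> expectation (\<lambda>\<omega>. 1 + (cmod (\<xi> k \<omega>))\<^sup>2)"
  proof (intro integral_mono I)
    show "integrable M (\<lambda>\<omega>. 1 + (cmod (\<xi> k \<omega>))\<^sup>2)"
      using S by (auto simp: has_bochner_integral_iff)
    fix \<omega> show "cmod (\<xi> k \<omega>) \<le> 1 + (cmod (\<xi> k \<omega>))\<^sup>2"
      using sum_power2_ge_zero[of "cmod (\<xi> k \<omega>) - 1" 0]
      by (simp add: power2_eq_square algebra_simps) (smt (verit) mult_nonneg_nonneg norm_ge_zero)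
  qed
  also have "\<dots> = 2"
    using S by (subst Bochner_Integration.integral_add) (auto simp: has_bochner_integral_iff prob_space)
  finally show "expectation (\<lambda>\<omega>. cmod (\<xi> k \<omega>)) \<le> 2" .
qed

text \<open>A first moment bound uniform in k makes the expectation of the whole series finite, so
  the series is finite almost surely.\<close>

lemma AE_summable_radius:
  assumes "0 \<le> s" "s < 1"
  shows "AE \<omega> in M. summable (\<lambda>k. cmod (\<xi> (int k) \<omega>) * s ^ k)"
proof -
  have "(\<integral>\<^sup>+\<omega>. (\<Sum>k. ennreal (cmod (\<xi> (int k) \<omega>) * s ^ k)) \<partial>M) =
        (\<Sum>k. \<integral>\<^sup>+\<omega>. ennreal (cmod (\<xi> (int k) \<omega>) * s ^ k) \<partial>M)"
    by (intro nn_integral_suminf) measurable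
  also have "\<dots> \<le> (\<Sum>k. ennreal (2 * s ^ k))"
  proof (intro suminf_le)
    fix k
    have "(\<integral>\<^sup>+\<omega>. ennreal (cmod (\<xi> (int k) \<omega>) * s ^ k) \<partial>M) = ennreal (expectation (\<lambda>\<omega>. cmod (\<xi> (int k) \<omega>) * s ^ k))"
      using xi_norm_integrable assms by (intro nn_integral_eq_integral) auto
    also have "expectation (\<lambda>\<omega>. cmod (\<xi> (int k) \<omega>) * s ^ k) = expectation (\<lambda>\<omega>. cmod (\<xi> (int k) \<omega>)) * s ^ k"
      by simp
    also have "\<dots> \<le> 2 * s ^ k"
      using xi_norm_integrable(2) assms by (intro mult_right_mono) auto
    finally show "(\<integral>\<^sup>+\<omega>. ennreal (cmod (\<xi> (int k) \<omega>) * s ^ k) \<partial>M) \<le> ennreal (2 * s ^ k)"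
      by (simp add: ennreal_leI)
  qed auto
  also have "\<dots> = ennreal (\<Sum>k. 2 * s ^ k)"
    using assms by (intro suminf_ennreal2) (auto intro!: summable_mult summable_geometric)
  also have "\<dots> < \<infinity>" by simp
  finally have "AE \<omega> in M. (\<Sum>k. ennreal (cmod (\<xi> (int k) \<omega>) * s ^ k)) \<noteq> \<infinity>"
    by (intro nn_integral_PInf_AE) auto
  thus ?thesis
  proof eventually_elim
    case (elim \<omega>)
    thus ?case using assms by (intro summable_suminf_not_top) auto
  qed
qed

text \<open>One null set has to serve all z at once. Countably many radii tending to 1 suffice,
  since convergence at a radius gives it at every smaller modulus.\<close>

lemma AE_sums:
  "AE \<omega> in M. \<forall>z. cmod z < 1 \<longrightarrow> (\<lambda>k. \<xi> (int k) \<omega> * z ^ k) sums random_series \<xi> \<omega> z"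
proof -
  define s where "s j = 1 - 1 / real (j + 2)" for j :: nat
  have s: "0 \<le> s j" "s j < 1" for j by (auto simp: s_def field_simps)
  have "AE \<omega> in M. \<forall>j. summable (\<lambda>k. cmod (\<xi> (int k) \<omega>) * s j ^ k)"
    using s by (simp add: AE_all_countable AE_summable_radius)
  thus ?thesis
  proof eventually_elim
    case (elim \<omega>)
    show ?case
    proof (intro allI impI)
      fix z :: complex assume z: "cmod z < 1"
      have "s \<longlonglongrightarrow> 1" unfolding s_def by real_asymp
      hence "eventually (\<lambda>j. cmod z < s j) sequentially"
        using z by (rule order_tendstoD)
      then obtain j where j: "cmod z < s j"
        using eventually_happens' sequentially_bot by blast
      have "summable (\<lambda>k. \<xi> (int k) \<omega> * z ^ k)"
      proof (rule summable_comparison_test'[of "\<lambda>k. cmod (\<xi> (int k) \<omega>) * s j ^ k" 0])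
        show "summable (\<lambda>k. cmod (\<xi> (int k) \<omega>) * s j ^ k)" using elim by blast
        show "norm (\<xi> (int k) \<omega> * z ^ k) \<le> cmod (\<xi> (int k) \<omega>) * s j ^ k" for k
          using j by (auto simp: norm_mult norm_power intro!: mult_left_mono power_mono)
      qed
      thus "(\<lambda>k. \<xi> (int k) \<omega> * z ^ k) sums random_series \<xi> \<omega> z"
        unfolding random_series_def by (rule summable_sums)
    qed
  qed
qed

lemma AE_holomorphic: "AE \<omega> in M. random_series \<xi> \<omega> holomorphic_on ball 0 1"
  using AE_sums
proof eventually_elim
  case (elim \<omega>)
  show ?case
    by (rule power_series_holomorphic[where a="\<lambda>k. \<xi> (int k) \<omega>"]) (use elim in auto)
qed

lemma random_series_measurable [measurable]: "(\<lambda>\<omega>. random_series \<xi> \<omega> z) \<in> borel_measurable M"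
  unfolding random_series_def by measurable

text \<open>Truncations at n + d are Gaussian in every direction with variance
  \<open>quad_form (n + d) z / 2\<close>, and that length is the one for which the limit of the
  quadratic form was computed.\<close>

lemma random_series_law:
  assumes z: "cmod z < 1"
  shows "distr M borel (\<lambda>\<omega>. Re (cis \<theta> * random_series \<xi> \<omega> z)) =
         distr std_normal_distribution borel (\<lambda>x. sqrt (kernel n z / 2) * x)"
proof (rule distr_gaussian_limit[where X="\<lambda>d \<omega>. Re (cis \<theta> * partial (n + d) z \<omega>)"
      and v="\<lambda>d. quad_form (n + d) z / 2"])
  show "AE \<omega> in M. (\<lambda>d. Re (cis \<theta> * partial (n + d) z \<omega>)) \<longlonglongrightarrow> Re (cis \<theta> * random_series \<xi> \<omega> z)"
    using AE_sums
  proof eventually_elim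
    case (elim \<omega>)
    hence "(\<lambda>N. partial N z \<omega>) \<longlonglongrightarrow> random_series \<xi> \<omega> z"
      using z by (auto simp: sums_def partial_def)
    hence "(\<lambda>d. partial (n + d) z \<omega>) \<longlonglongrightarrow> random_series \<xi> \<omega> z"
      by (subst add.commute) (rule LIMSEQ_ignore_initial_segment)
    thus ?case by (intro tendsto_intros)
  qed
  have "0 \<le> kernel n z / 2" using kernel_pos[OF n_pos z] by simp
  thus "(\<lambda>d. quad_form (n + d) z / 2) \<longlonglongrightarrow> (sqrt (kernel n z / 2))\<^sup>2"
    using tendsto_divide[OF quad_form_tendsto[OF z] tendsto_const[of 2]] by simp
  show "(\<lambda>\<omega>. Re (cis \<theta> * partial (n + d) z \<omega>)) \<in> borel_measurable M" for d by measurable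
  show "(\<lambda>\<omega>. Re (cis \<theta> * random_series \<xi> \<omega> z)) \<in> borel_measurable M" by measurable
  show "gaussian_rv M (\<lambda>\<omega>. Re (cis \<theta> * partial (n + d) z \<omega>))" for d
    by (rule gaussian_Re_partial)
  show "expectation (\<lambda>\<omega>. Re (cis \<theta> * partial (n + d) z \<omega>)) = 0" for d
    by (rule mean_Re_partial)
  show "expectation (\<lambda>\<omega>. (Re (cis \<theta> * partial (n + d) z \<omega>))\<^sup>2) = quad_form (n + d) z / 2" for d
    by (rule variance_Re_partial) simp
qed

text \<open>The summand ln 2 comes from averaging |Re| over rotations, and - ln 2 / 2 from the
  variance K/2 of a single real direction.\<close>

definition log_const :: real where
  "log_const = gauss_log + ln 2 - ln 2 / 2"

lemma ln_norm_random_series: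
  assumes z: "cmod z < 1"
  shows "AE \<omega> in M. random_series \<xi> \<omega> z \<noteq> 0"
    and "has_bochner_integral M (\<lambda>\<omega>. ln (cmod (random_series \<xi> \<omega> z))) (ln (kernel n z) / 2 + log_const)"
    and "expectation (\<lambda>\<omega>. \<bar>ln (cmod (random_series \<xi> \<omega> z))\<bar>) \<le>
           \<bar>ln (sqrt (kernel n z / 2))\<bar> + gauss_log_abs + 2 * sqrt (kernel n z / 2) * gauss_abs"
proof -
  have K: "0 < kernel n z" by (rule kernel_pos[OF n_pos z])
  hence s: "0 < sqrt (kernel n z / 2)" by simp
  have "ln (sqrt (kernel n z / 2)) + gauss_log + ln 2 = ln (kernel n z) / 2 + log_const"
    using K by (simp add: ln_sqrt ln_div log_const_def field_simps)
  with ln_norm_complex_normal[OF random_series_measurable s random_series_law[OF z]]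
  show "AE \<omega> in M. random_series \<xi> \<omega> z \<noteq> 0"
    and "has_bochner_integral M (\<lambda>\<omega>. ln (cmod (random_series \<xi> \<omega> z))) (ln (kernel n z) / 2 + log_const)"
    and "expectation (\<lambda>\<omega>. \<bar>ln (cmod (random_series \<xi> \<omega> z))\<bar>) \<le>
           \<bar>ln (sqrt (kernel n z / 2))\<bar> + gauss_log_abs + 2 * sqrt (kernel n z / 2) * gauss_abs"
    by simp_all
qed

section \<open>Expected circular means and the sandwich for the expected zero count\<close>

lemma continuous_kernel_circ:
  assumes "0 < r" "r < 1"
  shows "continuous_on A (\<lambda>x. kernel n (circ r x))"
proof -
  have "r\<^sup>2 < 1" using assms by (simp add: abs_square_less_1)
  thus ?thesis
    unfolding kernel_def residual_def using assms by (intro continuous_intros) auto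
qed

text \<open>A gauge integral rather than one over \<open>unif\<close>, because the Leibniz rule will
  differentiate it; for continuous integrands the two agree.\<close>

definition H :: "real \<Rightarrow> real" where
  "H r = integral {0..1} (\<lambda>x. ln (kernel n (circ r x)) / 2)"

lemma expectation_log_mean:
  assumes r: "0 < r" "r < 1"
  shows "has_bochner_integral M (\<lambda>\<omega>. \<integral>x. ln (cmod (random_series \<xi> \<omega> (circ r x))) \<partial>unif) (H r + log_const)"
proof -
  interpret P: pair_prob_space unif M ..
  define g where "g x \<omega> = ln (cmod (random_series \<xi> \<omega> (circ r x)))" for x \<omega>
  have gm: "(\<lambda>(x, \<omega>). g x \<omega>) \<in> borel_measurable (unif \<Otimes>\<^sub>M M)"
    unfolding g_def random_series_def by measurable
  have gm': "(\<lambda>(\<omega>, x). g x \<omega>) \<in> borel_measurable (M \<Otimes>\<^sub>M unif)"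
    unfolding g_def random_series_def by measurable
  have c: "cmod (circ r x) < 1" for x using r by simp
  note L = ln_norm_random_series[OF c]
  have K: "kernel n (circ r x) > 0" for x by (rule kernel_pos[OF n_pos c])
  have contK: "continuous_on {0..1} (\<lambda>x. kernel n (circ r x))"
    by (rule continuous_kernel_circ[OF r])
  \<comment> \<open>The bound on E |log |f(z)|| is continuous along the circle because the kernel is
    positive there; this supplies the integrability needed for Fubini.\<close>
  define B where "B x = \<bar>ln (sqrt (kernel n (circ r x) / 2))\<bar> + gauss_log_abs + 2 * sqrt (kernel n (circ r x) / 2) * gauss_abs" for x
  have "continuous_on {0..1} B"
    unfolding B_def using K
    by (intro continuous_intros contK) (auto simp: less_imp_neq [symmetric])
  hence B: "integrable unif B"
    using has_bochner_integral_unif_continuous by (auto simp: has_bochner_integral_iff)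
  have gint: "integrable (unif \<Otimes>\<^sub>M M) (\<lambda>(x, \<omega>). g x \<omega>)"
  proof (rule P.Fubini_integrable[OF gm])
    show "integrable unif (\<lambda>x. \<integral>\<omega>. norm (case (x, \<omega>) of (x, \<omega>) \<Rightarrow> g x \<omega>) \<partial>M)"
    proof (rule Bochner_Integration.integrable_bound[OF B])
      show "(\<lambda>x. \<integral>\<omega>. norm (case (x, \<omega>) of (x, \<omega>) \<Rightarrow> g x \<omega>) \<partial>M) \<in> borel_measurable unif"
        using gm by measurable
      show "AE x in unif. norm (\<integral>\<omega>. norm (case (x, \<omega>) of (x, \<omega>) \<Rightarrow> g x \<omega>) \<partial>M) \<le> norm (B x)"
      proof (intro AE_I2)
        fix x
        have "0 \<le> expectation (\<lambda>\<omega>. \<bar>g x \<omega>\<bar>)" by simp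
        moreover have "expectation (\<lambda>\<omega>. \<bar>g x \<omega>\<bar>) \<le> B x" using L(3)[of x] by (simp add: g_def B_def)
        ultimately show "norm (\<integral>\<omega>. norm (case (x, \<omega>) of (x, \<omega>) \<Rightarrow> g x \<omega>) \<partial>M) \<le> norm (B x)"
          by simp
      qed
    qed
    show "AE x in unif. integrable M (\<lambda>\<omega>. case (x, \<omega>) of (x, \<omega>) \<Rightarrow> g x \<omega>)"
      using L(2) by (auto simp: g_def has_bochner_integral_iff)
  qed
  have "(\<integral>\<omega>. (\<integral>x. g x \<omega> \<partial>unif) \<partial>M) = (\<integral>x. (\<integral>\<omega>. g x \<omega> \<partial>M) \<partial>unif)"
    by (rule P.Fubini_integral[OF gint])
  also have "(\<lambda>x. \<integral>\<omega>. g x \<omega> \<partial>M) = (\<lambda>x. ln (kernel n (circ r x)) / 2 + log_const)"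
    using L(2) by (auto simp: g_def has_bochner_integral_iff)
  also have "(\<integral>x. ln (kernel n (circ r x)) / 2 + log_const \<partial>unif) = H r + log_const"
  proof -
    have "continuous_on {0..1} (\<lambda>x. ln (kernel n (circ r x)) / 2)"
      using K by (intro continuous_intros contK) (auto simp: less_imp_neq [symmetric])
    hence "has_bochner_integral unif (\<lambda>x. ln (kernel n (circ r x)) / 2) (H r)"
      unfolding H_def by (rule has_bochner_integral_unif_continuous)
    thus ?thesis by (auto simp: has_bochner_integral_iff)
  qed
  finally have "(\<integral>\<omega>. (\<integral>x. g x \<omega> \<partial>unif) \<partial>M) = H r + log_const" .
  moreover have "integrable M (\<lambda>\<omega>. \<integral>x. g x \<omega> \<partial>unif)"
    using P.integrable_snd[OF gint] .
  ultimately show ?thesis by (simp add: has_bochner_integral_iff g_def)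
qed

text \<open>
  The zero count is not known to be measurable; both bounds only use monotonicity of the
  nonnegative integral against measurable functions.
\<close>

lemma expected_zeros_bounds:
  assumes r: "0 < r" "r < \<rho>" "\<rho> < 1"
  shows "H r \<le> H \<rho>"
    and "expected_zeros M \<xi> r \<le> ennreal ((H \<rho> - H r) / ln (\<rho> / r))"
    and "ennreal ((H \<rho> - H r) / ln (\<rho> / r)) \<le> expected_zeros M \<xi> \<rho>"
proof -
  define L where "L s \<omega> = (\<integral>x. ln (cmod (random_series \<xi> \<omega> (circ s x))) \<partial>unif)" for s \<omega>
  have E: "has_bochner_integral M (L s) (H s + log_const)" if "0 < s" "s < 1" for s
    using expectation_log_mean[OF that] by (simp add: L_def[abs_def])
  define c where "c = ln (\<rho> / r)"
  have c: "c > 0" using r by (simp add: c_def)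
  \<comment> \<open>Jensen's bounds require a nonzero value at the centre, which holds almost surely
    as f(0) is a nondegenerate Gaussian.\<close>
  have z0: "AE \<omega> in M. random_series \<xi> \<omega> 0 \<noteq> 0"
    by (rule ln_norm_random_series) simp
  have J: "AE \<omega> in M. L r \<omega> \<le> L \<rho> \<omega> \<and>
      zero_count (random_series \<xi> \<omega>) {z. cmod z < r} \<le> ennreal ((L \<rho> \<omega> - L r \<omega>) / c) \<and>
      ennreal ((L \<rho> \<omega> - L r \<omega>) / c) \<le> zero_count (random_series \<xi> \<omega>) {z. cmod z < \<rho>}"
    using AE_holomorphic z0
  proof eventually_elim
    case (elim \<omega>)
    note B = jensen_bounds[OF elim r, folded L_def c_def]
    have dv: "ennreal (d / c) = ennreal (1 / c) * ennreal d" if "0 \<le> d" for d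
      using that c by (subst ennreal_mult [symmetric]) auto
    have cc: "ennreal (1 / c) * (ennreal c * y) = y" for y
      using c by (subst mult.assoc [symmetric], subst ennreal_mult [symmetric]) auto
    have "ennreal (1 / c) * (ennreal c * zero_count (random_series \<xi> \<omega>) {z. cmod z < r})
        \<le> ennreal (1 / c) * ennreal (L \<rho> \<omega> - L r \<omega>)"
      by (intro mult_left_mono B) auto
    moreover have "ennreal (1 / c) * ennreal (L \<rho> \<omega> - L r \<omega>) \<le>
        ennreal (1 / c) * (ennreal c * zero_count (random_series \<xi> \<omega>) {z. cmod z < \<rho>})"
      by (intro mult_left_mono B) auto
    moreover have "ennreal ((L \<rho> \<omega> - L r \<omega>) / c) = ennreal (1 / c) * ennreal (L \<rho> \<omega> - L r \<omega>)"
      using B(1) by (intro dv) simp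
    ultimately show ?case using B(1) by (simp only: cc simp_thms)
  qed
  have "integral\<^sup>L M (L r) \<le> integral\<^sup>L M (L \<rho>)"
    using E[of r] E[of \<rho>] r J by (intro integral_mono_AE) (auto simp: has_bochner_integral_iff elim: eventually_mono)
  thus "H r \<le> H \<rho>"
    using E[of r] E[of \<rho>] r by (auto simp: has_bochner_integral_iff)
  have int: "(\<integral>\<^sup>+\<omega>. ennreal ((L \<rho> \<omega> - L r \<omega>) / c) \<partial>M) = ennreal ((H \<rho> - H r) / c)"
  proof -
    have *: "has_bochner_integral M (\<lambda>\<omega>. (L \<rho> \<omega> - L r \<omega>) / c) (((H \<rho> + log_const) - (H r + log_const)) / c)"
      using r by (intro has_bochner_integral_divide has_bochner_integral_diff E) auto
    have "(\<integral>\<^sup>+\<omega>. ennreal ((L \<rho> \<omega> - L r \<omega>) / c) \<partial>M) = ennreal (\<integral>\<omega>. (L \<rho> \<omega> - L r \<omega>) / c \<partial>M)"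
      using * J c by (intro nn_integral_eq_integral) (auto simp: has_bochner_integral_iff elim!: eventually_mono)
    thus ?thesis using * by (simp only: has_bochner_integral_iff add_diff_cancel_right)
  qed
  have "expected_zeros M \<xi> r \<le> (\<integral>\<^sup>+\<omega>. ennreal ((L \<rho> \<omega> - L r \<omega>) / c) \<partial>M)"
    unfolding expected_zeros_def using J by (intro nn_integral_mono_AE) (auto elim: eventually_mono)
  thus "expected_zeros M \<xi> r \<le> ennreal ((H \<rho> - H r) / ln (\<rho> / r))"
    unfolding int by (simp add: c_def)
  have "(\<integral>\<^sup>+\<omega>. ennreal ((L \<rho> \<omega> - L r \<omega>) / c) \<partial>M) \<le> expected_zeros M \<xi> \<rho>"
    unfolding expected_zeros_def using J by (intro nn_integral_mono_AE) (auto elim: eventually_mono)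
  thus "ennreal ((H \<rho> - H r) / ln (\<rho> / r)) \<le> expected_zeros M \<xi> \<rho>"
    unfolding int by (simp add: c_def)
qed

end

section \<open>Model integrals\<close>

lemma Gamma_reflection_real: "Gamma x * Gamma (1 - x) = pi / sin (pi * x)" for x :: real
proof -
  have "complex_of_real (Gamma x * Gamma (1 - x)) = complex_of_real (pi / sin (pi * x))"
    using Gamma_reflection_complex[of "of_real x"] sin_of_real[of "pi * x", where ?'a = complex]
    by (simp add: Gamma_complex_of_real [symmetric])
  thus ?thesis by (simp only: of_real_eq_iff)
qed

text \<open>The substitution s = u^(2n) / (u^(2n) + \<epsilon>) maps the half-line onto (0,1) and
  turns the integrand into a multiple of s^(a-1) (1-s)^(-a). The value Beta(a, 1-a) is pi / sin(pi
  a) by the reflection formula.\<close>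

lemma integral_inverse_power_plus:
  fixes \<epsilon> :: real
  assumes n: "0 < n" and e: "0 < \<epsilon>"
  defines "a \<equiv> 1 / (2 * real n)"
  shows "((\<lambda>u. 1 / (u ^ (2 * n) + \<epsilon>)) has_integral (\<epsilon> powr (a - 1) * a * pi / sin (pi * a))) {0<..}"
proof -
  have a: "0 < a" "a < 1" using n by (auto simp: a_def field_simps)
  define W where "W u = u ^ (2 * n) + \<epsilon>" for u :: real
  have W: "W u > 0" for u using e by (auto simp: W_def intro!: add_nonneg_pos)
  define g where "g u = u ^ (2 * n) / W u" for u
  define g' where "g' u = 2 * n * u ^ (2 * n - 1) * \<epsilon> / (W u)\<^sup>2" for u :: real
  define f where "f s = s powr (a - 1) * (1 - s) powr (- a)" for s :: real
  have der: "(g has_field_derivative g' u) (at u within {0<..})" for u :: real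
  proof -
    have "(g has_field_derivative
        ((real (2 * n) * u ^ (2 * n - 1)) * W u - u ^ (2 * n) * (real (2 * n) * u ^ (2 * n - 1))) / (W u * W u)) (at u within {0<..})"
      unfolding g_def W_def using W[of u]
      by (auto intro!: derivative_eq_intros simp: W_def)
    also have "((real (2 * n) * u ^ (2 * n - 1)) * W u - u ^ (2 * n) * (real (2 * n) * u ^ (2 * n - 1))) / (W u * W u) = g' u"
      by (simp add: g'_def W_def power2_eq_square algebra_simps)
    finally show ?thesis .
  qed
  have inj: "inj_on g {0<..}"
  proof
    fix u v :: real assume uv: "u \<in> {0<..}" "v \<in> {0<..}" and eq: "g u = g v"
    hence "u ^ (2 * n) * W v = v ^ (2 * n) * W u"
      using W[of u] W[of v] by (simp add: g_def field_simps)
    hence "u ^ (2 * n) = v ^ (2 * n)" using e by (simp add: W_def algebra_simps)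
    thus "u = v" using uv n by (auto intro: power_eq_imp_eq_base)
  qed
  have img: "g ` {0<..} = {0<..<1}"
  proof (intro equalityI subsetI)
    fix s assume "s \<in> g ` {0<..}"
    then obtain u where u: "u > 0" "s = g u" by auto
    have "0 < g u" unfolding g_def using W[of u] u(1) by (intro divide_pos_pos) auto
    moreover have "g u < 1"
      unfolding g_def using W[of u] e by (subst divide_less_eq_1_pos) (auto simp: W_def)
    ultimately show "s \<in> {0<..<1}" using u(2) by simp
  next
    fix s :: real assume s: "s \<in> {0<..<1}"
    define q where "q = \<epsilon> * s / (1 - s)"
    define u where "u = q powr a"
    have p: "q > 0" using s e by (auto simp: q_def)
    have "u ^ (2 * n) = u powr (real (2 * n))"
      using p by (subst powr_realpow) (auto simp: u_def)
    also have "\<dots> = q"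
      using p n by (simp add: u_def powr_powr a_def)
    finally have *: "u ^ (2 * n) = q" .
    have "g u = s"
      unfolding g_def W_def * q_def using s e by (simp add: field_simps)
    moreover have "u > 0" using p by (simp add: u_def)
    ultimately show "s \<in> g ` {0<..}" by auto
  qed
  have B: "(f has_integral Beta a (1 - a)) {0..1}"
    using has_integral_Beta_real[of a "1 - a"] a by (simp add: f_def[abs_def])
  have nn: "f s \<ge> 0" for s by (simp add: f_def)
  have B': "(f has_integral Beta a (1 - a)) {0<..<1}"
    using B by (simp add: has_integral_Icc_iff_Ioo)
  have abs: "f absolutely_integrable_on {0<..<1}"
    using B' nn by (intro nonnegative_absolutely_integrable_1) auto
  have "(\<lambda>u. \<bar>g' u\<bar> * f (g u)) absolutely_integrable_on {0<..} \<and>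
      integral {0<..} (\<lambda>u. \<bar>g' u\<bar> * f (g u)) = Beta a (1 - a)"
    using has_absolute_integral_change_of_variables_1'[of "{0<..}" g g' f "Beta a (1 - a)"] der inj abs B'
    by (auto simp: img integral_unique)
  hence I: "((\<lambda>u. \<bar>g' u\<bar> * f (g u)) has_integral Beta a (1 - a)) {0<..}"
    using set_lebesgue_integral_eq_integral(1) by (metis has_integral_integral)
  have "\<bar>g' u\<bar> * f (g u) = (2 * n * \<epsilon> powr (1 - a)) * (1 / (u ^ (2 * n) + \<epsilon>))" if u: "u \<in> {0<..}" for u
  proof -
    have u0: "u > 0" using u by simp
    have g1: "1 - g u = \<epsilon> / W u" using W[of u] by (simp add: g_def W_def field_simps)
    have "(u ^ (2 * n)) powr (a - 1) = u powr (1 - 2 * real n)"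
    proof -
      have "(u ^ (2 * n)) powr (a - 1) = (u powr (real (2 * n))) powr (a - 1)"
        using u0 by (subst powr_realpow) auto
      also have "\<dots> = u powr (1 - 2 * real n)"
      proof -
        have "real (2 * n) * (a - 1) = 1 - 2 * real n" using n by (simp add: a_def field_simps)
        thus ?thesis by (simp only: powr_powr)
      qed
      finally show ?thesis .
    qed
    moreover have "u powr (1 - 2 * real n) = 1 / u ^ (2 * n - 1)"
    proof -
      have "u powr (1 - 2 * real n) = u powr (- real (2 * n - 1))"
        using n by (simp add: of_nat_diff)
      also have "\<dots> = 1 / u ^ (2 * n - 1)"
        using u0 by (simp only: powr_minus_divide powr_realpow)
      finally show ?thesis .
    qed
    ultimately have up: "(u ^ (2 * n)) powr (a - 1) = 1 / u ^ (2 * n - 1)" by simp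
    have WW: "W u powr (a - 1) * W u powr (- a) = 1 / W u"
    proof -
      have "W u powr (a - 1) * W u powr (- a) = W u powr ((a - 1) + (- a))"
        by (simp only: powr_add)
      also have "(a - 1) + (- a) = - 1" by simp
      finally show ?thesis using W[of u] by (simp add: powr_minus_divide)
    qed
    have "f (g u) = (u ^ (2 * n)) powr (a - 1) / W u powr (a - 1) * (\<epsilon> powr (- a) / W u powr (- a))"
      unfolding f_def g1 unfolding g_def using u0 W[of u] e by (simp add: powr_divide)
    also have "\<dots> = 1 / u ^ (2 * n - 1) * \<epsilon> powr (- a) / (W u powr (a - 1) * W u powr (- a))"
      unfolding up by simp
    finally have fg: "f (g u) = 1 / u ^ (2 * n - 1) * W u * \<epsilon> powr (- a)"
      unfolding WW by simp
    have ep: "\<epsilon> powr (1 - a) = \<epsilon> * \<epsilon> powr (- a)"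
      using e by (simp add: powr_diff powr_minus divide_inverse)
    have "\<bar>g' u\<bar> = g' u" using u0 e by (simp add: g'_def)
    thus ?thesis
      unfolding fg ep g'_def W_def [symmetric] using u0 W[of u]
      by (simp add: field_simps power2_eq_square)
  qed
  with I have "((\<lambda>u. (2 * n * \<epsilon> powr (1 - a)) * (1 / (u ^ (2 * n) + \<epsilon>))) has_integral Beta a (1 - a)) {0<..}"
    by (rule has_integral_eq[rotated])
  from has_integral_mult_right[OF this, of "1 / (2 * n * \<epsilon> powr (1 - a))"]
  have "((\<lambda>u. 1 / (u ^ (2 * n) + \<epsilon>)) has_integral Beta a (1 - a) / (2 * n * \<epsilon> powr (1 - a))) {0<..}"
    using n e by simp
  also have "Beta a (1 - a) = pi / sin (pi * a)"
    using Gamma_reflection_real[of a] by (simp add: Beta_def)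
  also have "pi / sin (pi * a) / (2 * n * \<epsilon> powr (1 - a)) = \<epsilon> powr (a - 1) * a * pi / sin (pi * a)"
    using e by (simp add: a_def powr_diff field_simps)
  finally show ?thesis .
qed

lemma integral_symmetric_real:
  fixes f :: "real \<Rightarrow> real"
  assumes c: "continuous_on {-b..b} f" and b: "0 \<le> b" and even: "\<And>x. f (- x) = f x"
  shows "integral {-b..b} f = 2 * integral {0..b} f"
proof -
  have i: "f integrable_on {-b..b}" using c by (rule integrable_continuous_real)
  have "integral {-b..0} f + integral {0..b} f = integral {-b..b} f"
    using b by (intro Henstock_Kurzweil_Integration.integral_combine i) auto
  moreover have "integral {-b..0} f = integral {0..b} f"
    using Henstock_Kurzweil_Integration.integral_reflect_real[of b 0 f] even by simp
  ultimately show ?thesis by simp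
qed

text \<open>Each of the two discarded tails is at most the integral of u^(-2) beyond pi, that is
  1/pi \<le> 1/2, uniformly in \<epsilon>.\<close>

lemma integral_inverse_power_plus_bounds:
  fixes \<epsilon> :: real
  assumes n: "0 < n" and e: "0 < \<epsilon>"
  defines "a \<equiv> 1 / (2 * real n)"
  shows "\<bar>integral {-pi..pi} (\<lambda>u. 1 / (u ^ (2 * n) + \<epsilon>)) - 2 * \<epsilon> powr (a - 1) * a * pi / sin (pi * a)\<bar> \<le> 1"
proof -
  define F where "F u = 1 / (u ^ (2 * n) + \<epsilon>)" for u :: real
  have pos: "u ^ (2 * n) + \<epsilon> > 0" for u :: real
    using e by (auto intro!: add_nonneg_pos)
  have cont: "continuous_on A F" for A
    unfolding F_def using pos by (intro continuous_intros) (auto simp: less_imp_neq [symmetric])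
  define V where "V = \<epsilon> powr (a - 1) * a * pi / sin (pi * a)"
  have full: "(F has_integral V) {0<..}"
    unfolding F_def V_def a_def by (rule integral_inverse_power_plus[OF n e])
  have seg: "(F has_integral integral {0..pi} F) {0..pi}"
    using cont by (intro integrable_integral integrable_continuous_real)
  have tail_bd: "((\<lambda>u. u powr (-2)) has_integral 1 / pi) {pi..}"
  proof -
    have "pi powr (-1) = 1 / pi" by (simp add: powr_minus divide_inverse)
    thus ?thesis using has_integral_powr_to_inf[of "-2" pi] by simp
  qed
  have "(F has_integral (V - integral {0..pi} F)) ({0<..} - {0..pi})"
    by (rule has_integral_setdiff[OF full seg]) (auto intro: negligible_subset[of "{0}"])
  moreover have "{0<..} - {0..pi} = {pi<..}" by (auto intro: order.strict_trans[OF pi_gt_zero])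
  ultimately have tail: "(F has_integral (V - integral {0..pi} F)) {pi<..}" by simp
  have tail': "((\<lambda>u. u powr (-2)) has_integral 1 / pi) {pi<..}"
    by (rule iffD1[OF has_integral_spike_set_eq tail_bd]) (auto intro: negligible_subset[of "{pi}"])
  have "0 \<le> V - integral {0..pi} F"
    using tail by (rule has_integral_nonneg) (use pos in \<open>auto simp: F_def less_imp_le\<close>)
  moreover have "V - integral {0..pi} F \<le> 1 / pi"
  proof (rule has_integral_le[OF tail tail'])
    fix u :: real assume "u \<in> {pi<..}"
    hence u: "u > 1" using pi_gt3 by simp
    have "u ^ 2 \<le> u ^ (2 * n)" using u n by (intro power_increasing) auto
    hence "u ^ 2 \<le> u ^ (2 * n) + \<epsilon>" using e by simp
    hence "F u \<le> 1 / u ^ 2" unfolding F_def using u by (intro divide_left_mono) (auto intro!: mult_pos_pos pos)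
    also have "\<dots> = u powr (-2)" using u by (simp add: powr_minus powr_numeral divide_inverse)
    finally show "F u \<le> u powr (-2)" .
  qed
  moreover have "1 / pi \<le> 1 / 2" using pi_ge_two by (intro divide_left_mono) auto
  moreover have "integral {-pi..pi} F = 2 * integral {0..pi} F"
    using cont by (intro integral_symmetric_real) (auto simp: F_def)
  moreover have "2 * \<epsilon> powr (a - 1) * a * pi / sin (pi * a) = 2 * V"
    by (simp add: V_def)
  ultimately show ?thesis
    unfolding F_def [symmetric] by linarith
qed

text \<open>This lets bounded contributions, such as the tails of the model integral, be absorbed
  into the error term.\<close>

lemma error_scale_ge_1:
  assumes "0 < n" "0 < t" "t < 1"
  shows "1 \<le> error_scale n t"
proof (cases "n = 1")
  case False
  hence "t powr 0 \<le> t powr (- ((2 * real n - 3) / (2 * real n)))"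
    using assms by (intro powr_mono') auto
  thus ?thesis using False assms by (simp add: error_scale_def)
qed (simp add: error_scale_def)

text \<open>At the natural scale a = t^(1/(2n)) the integrand is at most 2 a^(4-2n) / (u^2 + a^2)
  plus 1 when n \<ge> 2. The arctangent integral contributes another factor of order 1/a, giving
  a^(3-2n). For n = 1 the integrand is identically 1.\<close>

lemma integral_error_bound:
  fixes t :: real
  assumes n: "0 < n" and t: "0 < t" "t < 1"
  shows "integral {-pi..pi} (\<lambda>u. (u\<^sup>2 + t) / (u ^ (2 * n) + t)) \<le> 4 * pi * error_scale n t"
proof (cases "n = 1")
  case True
  have "u\<^sup>2 + t > 0" for u using t by (auto intro!: add_nonneg_pos)
  hence "(u\<^sup>2 + t) / (u ^ (2 * n) + t) = 1" for u
    using True by (auto simp: less_imp_neq [symmetric])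
  thus ?thesis using True by (simp add: error_scale_def)
next
  case False
  hence n2: "n \<ge> 2" using n by simp
  define a where "a = t powr (1 / (2 * real n))"
  have a: "0 < a" "a \<le> 1" using t by (auto simp: a_def powr_le1)
  have apow: "a ^ (2 * n) = t"
    using t n by (simp add: a_def powr_realpow [symmetric] powr_powr)
  have pos: "u ^ (2 * n) + t > 0" for u :: real
    using t by (auto intro!: add_nonneg_pos)
  have pos2: "u\<^sup>2 + a\<^sup>2 > 0" for u :: real
    using a by (auto intro!: add_nonneg_pos)
  define c where "c = 1 / a ^ (2 * n - 4)"
  have c: "c > 0" using a by (simp add: c_def)
  have key: "(u\<^sup>2 + t) / (u ^ (2 * n) + t) \<le> 2 * c * (1 / (u\<^sup>2 + a\<^sup>2)) + 1" for u :: real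
  proof -
    \<comment> \<open>The left side is homogeneous of degree 2n in (u, a): replace the smaller of
      |u| and a by the larger, and recall a^(2n) = t.\<close>
    have "u\<^sup>2 * (u\<^sup>2 + a\<^sup>2) * a ^ (2 * n - 4) \<le> 2 * (u ^ (2 * n) + t)"
    proof -
      have split: "x ^ (2 * n) = x\<^sup>2 * x\<^sup>2 * x ^ (2 * n - 4)" for x :: real
        using n2 by (simp add: power_add [symmetric])
      show ?thesis
      proof (cases "\<bar>u\<bar> \<le> a")
        case True
        hence u2: "u\<^sup>2 \<le> a\<^sup>2" using power_mono[of "\<bar>u\<bar>" a 2] by simp
        have "u\<^sup>2 * (u\<^sup>2 + a\<^sup>2) * a ^ (2 * n - 4) \<le> a\<^sup>2 * (a\<^sup>2 + a\<^sup>2) * a ^ (2 * n - 4)"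
          using u2 a by (intro mult_right_mono mult_mono add_right_mono) auto
        also have "\<dots> = 2 * t" using split[of a] apow by (simp add: algebra_simps)
        also have "\<dots> \<le> 2 * (u ^ (2 * n) + t)" by simp
        finally show ?thesis .
      next
        case False
        hence u2: "a\<^sup>2 \<le> u\<^sup>2" using power_mono[of a "\<bar>u\<bar>" 2] a by simp
        have "a ^ (2 * n - 4) \<le> \<bar>u\<bar> ^ (2 * n - 4)" using False a by (intro power_mono) auto
        also have "\<dots> = u ^ (2 * n - 4)" by (simp add: power_even_abs)
        finally have "u\<^sup>2 * (u\<^sup>2 + a\<^sup>2) * a ^ (2 * n - 4) \<le> u\<^sup>2 * (u\<^sup>2 + u\<^sup>2) * u ^ (2 * n - 4)"
          using u2 a by (intro mult_mono) auto
        also have "\<dots> = 2 * u ^ (2 * n)" using split[of u] by (simp add: algebra_simps)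
        also have "\<dots> \<le> 2 * (u ^ (2 * n) + t)" using t by simp
        finally show ?thesis .
      qed
    qed
    note bd = this
    have "u\<^sup>2 / (u ^ (2 * n) + t) \<le> 2 * c * (1 / (u\<^sup>2 + a\<^sup>2))"
    proof -
      have "x / w \<le> 2 * (1 / q) * (1 / s)" if "x * s * q \<le> 2 * w" "w > 0" "s > 0" "q > 0"
        for x w s q :: real
        using that by (simp add: field_simps)
      from this[OF bd] show ?thesis unfolding c_def using pos[of u] pos2[of u] a by simp
    qed
    moreover have "t / (u ^ (2 * n) + t) \<le> 1" using pos[of u] by simp
    ultimately show ?thesis by (simp add: add_divide_distrib)
  qed
  have at: "((\<lambda>u. 1 / (u\<^sup>2 + a\<^sup>2)) has_integral (arctan (pi / a) / a - arctan (- pi / a) / a)) {-pi..pi}"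
  proof (rule fundamental_theorem_of_calculus)
    fix u
    have "((\<lambda>u. arctan (u / a) / a) has_real_derivative 1 / (u\<^sup>2 + a\<^sup>2)) (at u within {-pi..pi})"
    proof -
      have "1 + (u / a)\<^sup>2 = (u\<^sup>2 + a\<^sup>2) / a\<^sup>2"
        using a by (simp add: power_divide add_divide_distrib)
      hence eq: "1 / (u\<^sup>2 + a\<^sup>2) = inverse (1 + (u / a)\<^sup>2) * (1 / a) / a"
        using a by (simp add: power2_eq_square)
      show ?thesis unfolding eq using a by (auto intro!: derivative_eq_intros)
    qed
    thus "((\<lambda>u. arctan (u / a) / a) has_vector_derivative 1 / (u\<^sup>2 + a\<^sup>2)) (at u within {-pi..pi})"
      by (simp add: has_real_derivative_iff_has_vector_derivative)
  qed simp
  have C: "((\<lambda>x. 1::real) has_integral (pi - (- pi)) *\<^sub>R 1) {-pi..pi}"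
    using has_integral_const_real[of "1::real" "- pi" pi] by simp
  have R: "((\<lambda>u. 2 * c * (1 / (u\<^sup>2 + a\<^sup>2)) + 1) has_integral
      (2 * c * (arctan (pi / a) / a - arctan (- pi / a) / a) + (pi - (- pi)) *\<^sub>R 1)) {-pi..pi}"
    by (intro has_integral_add has_integral_mult_right at C)
  have L: "((\<lambda>u. (u\<^sup>2 + t) / (u ^ (2 * n) + t)) has_integral
      integral {-pi..pi} (\<lambda>u. (u\<^sup>2 + t) / (u ^ (2 * n) + t))) {-pi..pi}"
    using pos by (intro integrable_integral integrable_continuous_real continuous_intros)
      (auto simp: less_imp_neq [symmetric])
  have "integral {-pi..pi} (\<lambda>u. (u\<^sup>2 + t) / (u ^ (2 * n) + t)) \<le>
      2 * c * (arctan (pi / a) / a - arctan (- pi / a) / a) + (pi - (- pi)) *\<^sub>R 1"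
    using key by (intro has_integral_le[OF L R]) auto
  also have "\<dots> \<le> 2 * c * (pi / a) + 2 * pi"
  proof -
    have "arctan (pi / a) - arctan (- pi / a) \<le> pi"
      using arctan_ubound[of "pi / a"] arctan_lbound[of "- pi / a"] by simp
    hence "arctan (pi / a) / a - arctan (- pi / a) / a \<le> pi / a"
      using a by (simp add: diff_divide_distrib [symmetric] divide_right_mono)
    hence "2 * c * (arctan (pi / a) / a - arctan (- pi / a) / a) \<le> 2 * c * (pi / a)"
      using c by (intro mult_left_mono) auto
    thus ?thesis by simp
  qed
  moreover have ca: "c / a = error_scale n t"
  proof -
    have "c / a = 1 / a ^ (2 * n - 3)"
    proof -
      have "2 * n - 3 = Suc (2 * n - 4)" using n2 by simp
      thus ?thesis by (simp add: c_def)
    qed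
    also have "a ^ (2 * n - 3) = a powr (real (2 * n - 3))"
      using a by (simp add: powr_realpow)
    also have "\<dots> = t powr ((2 * real n - 3) / (2 * real n))"
      using n2 by (simp add: a_def powr_powr of_nat_diff)
    also have "1 / \<dots> = error_scale n t"
      using False by (simp add: error_scale_def powr_minus_divide)
    finally show ?thesis .
  qed
  moreover have ge1: "1 \<le> error_scale n t" by (rule error_scale_ge_1[OF n t])
  moreover have "2 * c * (pi / a) = 2 * pi * error_scale n t"
    unfolding ca [symmetric] by simp
  moreover have "2 * pi * 1 \<le> 2 * pi * error_scale n t"
    using ge1 by (intro mult_left_mono) auto
  ultimately show ?thesis by linarith
qed

section \<open>The kernel in polar form\<close>

text \<open>The sign comes from expanding the residual at -r e^(i \<phi>). Multiplying out its
  squares into a trigonometric sum makes both the r-derivative and the estimates termwise.\<close>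

definition res_coeff :: "nat \<Rightarrow> nat \<Rightarrow> nat \<Rightarrow> nat \<Rightarrow> real" where
  "res_coeff n m k l = (-1) ^ (k + l) * real (n choose (m - k)) * real (n choose (m - l))"

definition res_polar :: "nat \<Rightarrow> real \<Rightarrow> real \<Rightarrow> real" where
  "res_polar n r \<phi> = (\<Sum>m<n. \<Sum>k\<le>m. \<Sum>l\<le>m.
     res_coeff n m k l * (r ^ (k + l) * cos ((real k - real l) * \<phi>)))"

text \<open>For k = l = 0 the exponent k + l - 1 is truncated to 0, which is harmless beside the
  factor k + l.\<close>

definition res_polar_deriv :: "nat \<Rightarrow> real \<Rightarrow> real \<Rightarrow> real" where
  "res_polar_deriv n r \<phi> = (\<Sum>m<n. \<Sum>k\<le>m. \<Sum>l\<le>m.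
     res_coeff n m k l * (real (k + l) * r ^ (k + l - 1) * cos ((real k - real l) * \<phi>)))"

lemma residual_polar: "residual n (- (of_real r * cis \<phi>)) = res_polar n r \<phi>"
  unfolding residual_def res_polar_def
proof (intro sum.cong refl)
  fix m
  define a where "a k = of_nat (n choose (m - k)) * (- (of_real r * cis \<phi>)) ^ k" for k
  have a: "a k = of_real ((-1) ^ k * real (n choose (m - k)) * r ^ k) * cis (real k * \<phi>)" for k
  proof -
    have "(- (of_real r * cis \<phi>)) ^ k = of_real ((-1) ^ k * r ^ k) * cis (real k * \<phi>)"
      by (subst power_minus) (simp add: power_mult_distrib Complex.DeMoivre)
    thus ?thesis by (simp add: a_def)
  qed
  have prod: "a k * cnj (a l) =
      of_real (res_coeff n m k l * r ^ (k + l)) * cis ((real k - real l) * \<phi>)" for k l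
  proof -
    have "cis (real k * \<phi>) * cnj (cis (real l * \<phi>)) = cis ((real k - real l) * \<phi>)"
      by (simp add: cis_cnj cis_mult algebra_simps)
    moreover have "a k * cnj (a l) =
        of_real (((-1) ^ k * real (n choose (m - k)) * r ^ k) * ((-1) ^ l * real (n choose (m - l)) * r ^ l)) *
        (cis (real k * \<phi>) * cnj (cis (real l * \<phi>)))"
      unfolding a by (simp add: mult_ac)
    ultimately show ?thesis
      by (simp add: res_coeff_def power_add mult_ac)
  qed
  have "(cmod (\<Sum>k\<le>m. a k))\<^sup>2 = Re (\<Sum>k\<le>m. \<Sum>l\<le>m. a k * cnj (a l))"
    unfolding cmod_sum_square [symmetric] by (simp del: of_real_power)
  also have "\<dots> = (\<Sum>k\<le>m. \<Sum>l\<le>m. res_coeff n m k l * (r ^ (k + l) * cos ((real k - real l) * \<phi>)))"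
    by (simp only: prod Re_sum) (simp add: mult_ac)
  finally show "(cmod (\<Sum>k\<le>m. of_nat (n choose (m - k)) * (- (of_real r * cis \<phi>)) ^ k))\<^sup>2 =
      (\<Sum>k\<le>m. \<Sum>l\<le>m. res_coeff n m k l * (r ^ (k + l) * cos ((real k - real l) * \<phi>)))"
    unfolding a_def .
qed

text \<open>Comparing coefficients of x^m in (1 + x)^(p+1) / (1 + x) = (1 + x)^p; in the induction
  this is Pascal's rule.\<close>

lemma alternating_binomial_sum:
  "(\<Sum>k\<le>m. (-1) ^ k * real (Suc p choose (m - k))) = real (p choose m)"
proof (induction m)
  case (Suc m)
  have "(\<Sum>k\<le>Suc m. (-1) ^ k * real (Suc p choose (Suc m - k))) =
        real (Suc p choose Suc m) + (\<Sum>k\<le>m. (-1) ^ Suc k * real (Suc p choose (m - k)))"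
    by (subst sum.atMost_Suc_shift) simp
  also have "(\<Sum>k\<le>m. (-1) ^ Suc k * real (Suc p choose (m - k))) = - real (p choose m)"
    unfolding Suc.IH [symmetric] by (simp add: sum_negf [symmetric])
  finally show ?case by simp
qed simp

lemma res_polar_1_0:
  assumes "0 < n"
  shows "res_polar n 1 0 = real ((2 * (n - 1)) choose (n - 1))"
proof -
  obtain p where p: "n = Suc p" using assms by (cases n) auto
  have "res_polar n 1 0 = (\<Sum>m<n. (\<Sum>k\<le>m. (-1) ^ k * real (n choose (m - k)))\<^sup>2)"
    unfolding res_polar_def res_coeff_def power2_eq_square sum_product
    by (simp add: power_add mult_ac)
  also have "\<dots> = (\<Sum>m\<le>p. real ((p choose m)\<^sup>2))"
    unfolding p alternating_binomial_sum lessThan_Suc_atMost by simp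
  also have "\<dots> = real (\<Sum>m\<le>p. (p choose m)\<^sup>2)" by simp
  also have "\<dots> = real ((2 * p) choose p)" by (simp only: choose_square_sum)
  finally show ?thesis by (simp add: p)
qed

lemma res_polar_ge_1: "0 < n \<Longrightarrow> 1 \<le> res_polar n r \<phi>"
  using residual_ge_1[of n] by (simp add: residual_polar [symmetric])

lemma abs_triple_sum_le:
  fixes f :: "nat \<Rightarrow> nat \<Rightarrow> nat \<Rightarrow> real"
  assumes "\<And>m k l. m < n \<Longrightarrow> k \<le> m \<Longrightarrow> l \<le> m \<Longrightarrow> \<bar>f m k l\<bar> \<le> g m k l * c"
  shows "\<bar>\<Sum>m<n. \<Sum>k\<le>m. \<Sum>l\<le>m. f m k l\<bar> \<le> (\<Sum>m<n. \<Sum>k\<le>m. \<Sum>l\<le>m. g m k l) * c"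
  unfolding sum_distrib_right
  by (intro order_trans[OF sum_abs] sum_mono) (use assms in auto)

lemma one_minus_cos_bounds:
  fixes x :: real
  shows "0 \<le> 1 - cos x" "1 - cos x \<le> x\<^sup>2 / 2"
proof -
  have c: "1 - cos x = 2 * (sin (x / 2))\<^sup>2"
    using cos_double_sin[of "x / 2"] by simp
  have "\<bar>sin (x / 2)\<bar> \<le> \<bar>x / 2\<bar>" by (rule abs_sin_x_le_abs_x)
  hence "(sin (x / 2))\<^sup>2 \<le> (x / 2)\<^sup>2" by (metis abs_le_square_iff)
  thus "0 \<le> 1 - cos x" "1 - cos x \<le> x\<^sup>2 / 2"
    unfolding c by (auto simp: power_divide)
qed

text \<open>Bernoulli's inequality controls the loss in r^a, and 1 - cos y \<le> y^2/2 the loss in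
  the other factor.\<close>

lemma power_mult_cos_near_1:
  assumes "0 \<le> r" "r \<le> 1"
  shows "\<bar>r ^ a * cos y - 1\<bar> \<le> real a * (1 - r) + y\<^sup>2 / 2"
proof -
  have "1 + real a * (r - 1) \<le> (1 + (r - 1)) ^ a"
    using assms by (intro Bernoulli_inequality) auto
  hence 1: "1 - r ^ a \<le> real a * (1 - r)" by (simp add: algebra_simps)
  have 2: "0 \<le> r ^ a" "r ^ a \<le> 1" using assms by (auto simp: power_le_one)
  have "r ^ a * cos y - 1 = - ((1 - r ^ a) + r ^ a * (1 - cos y))" by (simp add: algebra_simps)
  moreover have "0 \<le> r ^ a * (1 - cos y)"
    using 2 one_minus_cos_bounds(1)[of y] by (intro mult_nonneg_nonneg) auto
  moreover have "r ^ a * (1 - cos y) \<le> 1 * (y\<^sup>2 / 2)"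
    using 2 one_minus_cos_bounds[of y] by (intro mult_mono) auto
  ultimately show ?thesis using 1 2 unfolding abs_le_iff by (intro conjI; linarith)
qed

text \<open>Cosines are even, so there is no term linear in \<phi>. This is the source of the
  relative error \<phi>^2 + t instead of |\<phi>| + t.\<close>

lemma res_polar_bounds:
  obtains B where "0 \<le> B"
    "\<And>r \<phi>. 0 \<le> r \<Longrightarrow> r \<le> 1 \<Longrightarrow> \<bar>res_polar n r \<phi> - res_polar n 1 0\<bar> \<le> B * (1 - r + \<phi>\<^sup>2)"
    "\<And>r \<phi>. 0 \<le> r \<Longrightarrow> r \<le> 1 \<Longrightarrow> \<bar>res_polar_deriv n r \<phi>\<bar> \<le> B"
proof
  \<comment> \<open>Here 2n bounds k + l, the rate of change in r, and n^2 bounds (k - l)^2 from the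
    cosine; one sum serves both estimates.\<close>
  define q where "q m k l = \<bar>res_coeff n m k l\<bar> * (2 * real n + (real n)\<^sup>2)" for m k l
  define B where "B = (\<Sum>m<n. \<Sum>k\<le>m. \<Sum>l\<le>m. q m k l)"
  show "0 \<le> B" unfolding B_def q_def by (intro sum_nonneg) auto
  fix r \<phi> :: real assume r: "0 \<le> r" "r \<le> 1"
  show "\<bar>res_polar n r \<phi> - res_polar n 1 0\<bar> \<le> B * (1 - r + \<phi>\<^sup>2)"
  proof -
    have "res_polar n r \<phi> - res_polar n 1 0 = (\<Sum>m<n. \<Sum>k\<le>m. \<Sum>l\<le>m.
        res_coeff n m k l * (r ^ (k + l) * cos ((real k - real l) * \<phi>) - 1))"
      by (simp add: res_polar_def sum_subtractf [symmetric] right_diff_distrib)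
    also have "\<bar>\<dots>\<bar> \<le> B * (1 - r + \<phi>\<^sup>2)"
      unfolding B_def
    proof (rule abs_triple_sum_le)
      fix m k l assume *: "m < n" "k \<le> m" "l \<le> m"
      have "\<bar>r ^ (k + l) * cos ((real k - real l) * \<phi>) - 1\<bar> \<le>
          real (k + l) * (1 - r) + ((real k - real l) * \<phi>)\<^sup>2 / 2"
        by (rule power_mult_cos_near_1[OF r])
      also have "\<dots> \<le> (2 * real n + (real n)\<^sup>2) * (1 - r) + (2 * real n + (real n)\<^sup>2) * \<phi>\<^sup>2"
      proof (intro add_mono mult_right_mono)
        show "real (k + l) \<le> 2 * real n + (real n)\<^sup>2" using * by (auto intro: add_increasing2)
        have "\<bar>real k - real l\<bar> \<le> real n" using * by auto
        hence "(real k - real l)\<^sup>2 \<le> (real n)\<^sup>2" by (metis abs_le_square_iff abs_of_nat)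
        hence "(real k - real l)\<^sup>2 * \<phi>\<^sup>2 \<le> (real n)\<^sup>2 * \<phi>\<^sup>2"
          by (intro mult_right_mono) auto
        moreover have "0 \<le> real n * \<phi>\<^sup>2" "0 \<le> (real k - real l)\<^sup>2 * \<phi>\<^sup>2" by simp_all
        ultimately show "((real k - real l) * \<phi>)\<^sup>2 / 2 \<le> (2 * real n + (real n)\<^sup>2) * \<phi>\<^sup>2"
          unfolding power_mult_distrib distrib_right by linarith
      qed (use r in auto)
      finally have "\<bar>res_coeff n m k l\<bar> * \<bar>r ^ (k + l) * cos ((real k - real l) * \<phi>) - 1\<bar> \<le>
          \<bar>res_coeff n m k l\<bar> * ((2 * real n + (real n)\<^sup>2) * (1 - r + \<phi>\<^sup>2))"
        by (intro mult_left_mono) (auto simp: distrib_left)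
      thus "\<bar>res_coeff n m k l * (r ^ (k + l) * cos ((real k - real l) * \<phi>) - 1)\<bar> \<le> q m k l * (1 - r + \<phi>\<^sup>2)"
        by (simp add: abs_mult q_def mult.assoc)
    qed
    finally show ?thesis .
  qed
  have "\<bar>res_polar_deriv n r \<phi>\<bar> \<le> B * 1"
    unfolding B_def res_polar_deriv_def
  proof (rule abs_triple_sum_le)
    fix m k l assume *: "m < n" "k \<le> m" "l \<le> m"
    have "\<bar>r ^ (k + l - 1) * cos ((real k - real l) * \<phi>)\<bar> \<le> 1 * 1"
      unfolding abs_mult using r by (intro mult_mono) (auto simp: power_le_one)
    hence "real (k + l) * \<bar>r ^ (k + l - 1) * cos ((real k - real l) * \<phi>)\<bar> \<le> (2 * real n + (real n)\<^sup>2) * 1"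
      using * by (intro mult_mono) (auto intro: add_increasing2)
    hence "\<bar>res_coeff n m k l\<bar> * (real (k + l) * \<bar>r ^ (k + l - 1) * cos ((real k - real l) * \<phi>)\<bar>) \<le>
        \<bar>res_coeff n m k l\<bar> * ((2 * real n + (real n)\<^sup>2) * 1)"
      by (intro mult_left_mono) auto
    thus "\<bar>res_coeff n m k l * (real (k + l) * r ^ (k + l - 1) * cos ((real k - real l) * \<phi>))\<bar> \<le> q m k l * 1"
      by (simp add: abs_mult q_def mult_ac)
  qed
  thus "\<bar>res_polar_deriv n r \<phi>\<bar> \<le> B" by simp
qed

text \<open>
  The numerator of the kernel at $-r e^{i\phi}$; the shift by $\pi$ moves the zero at $-1$ to $\phi = 0$.
\<close>

definition kernel_num :: "nat \<Rightarrow> real \<Rightarrow> real \<Rightarrow> real" where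
  "kernel_num n r \<phi> = (1 - 2 * r * cos \<phi> + r\<^sup>2) ^ n + (1 - r\<^sup>2) * res_polar n r \<phi>"

definition kernel_num_deriv :: "nat \<Rightarrow> real \<Rightarrow> real \<Rightarrow> real" where
  "kernel_num_deriv n r \<phi> = real n * (1 - 2 * r * cos \<phi> + r\<^sup>2) ^ (n - 1) * (2 * r - 2 * cos \<phi>)
     - 2 * r * res_polar n r \<phi> + (1 - r\<^sup>2) * res_polar_deriv n r \<phi>"

lemma kernel_circ:
  assumes "0 < r" "r < 1"
  shows "kernel n (circ r x) = kernel_num n r (2 * pi * x - pi) / ((1 - r\<^sup>2) * real ((2 * n) choose n))"
proof -
  define \<phi> where "\<phi> = 2 * pi * x - pi"
  have c: "circ r x = - (of_real r * cis \<phi>)"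
    by (simp add: circ_def \<phi>_def cis_divide [symmetric])
  have r2: "1 - r\<^sup>2 \<noteq> 0" using assms by (simp add: power2_eq_1_iff)
  have "(1 - r * v)\<^sup>2 + (r * w)\<^sup>2 = 1 - 2 * r * v + r\<^sup>2 * (w\<^sup>2 + v\<^sup>2)" for v w :: real
    by (simp add: power2_eq_square algebra_simps)
  hence "(cmod (1 + circ r x))\<^sup>2 = 1 - 2 * r * cos \<phi> + r\<^sup>2"
    unfolding c cmod_power2 by (simp add: sin_squared_eq)
  hence "cmod (1 + circ r x) ^ (2 * n) = (1 - 2 * r * cos \<phi> + r\<^sup>2) ^ n"
    by (simp add: power_mult)
  moreover have "residual n (circ r x) = res_polar n r \<phi>"
    unfolding c by (rule residual_polar)
  ultimately have "kernel n (circ r x) = ((1 - 2 * r * cos \<phi> + r\<^sup>2) ^ n / (1 - r\<^sup>2) + res_polar n r \<phi>) / real ((2 * n) choose n)"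
    by (simp add: kernel_def)
  thus ?thesis
    unfolding \<phi>_def [symmetric] kernel_num_def using r2 by (simp add: field_simps)
qed

lemma res_polar_has_derivative:
  "((\<lambda>r. res_polar n r \<phi>) has_real_derivative res_polar_deriv n r \<phi>) (at r within S)"
  unfolding res_polar_def res_polar_deriv_def
  by (intro DERIV_sum) (auto intro!: derivative_eq_intros)

lemma kernel_num_has_derivative:
  "((\<lambda>r. kernel_num n r \<phi>) has_real_derivative kernel_num_deriv n r \<phi>) (at r within S)"
proof -
  have "((\<lambda>r. (1 - 2 * r * cos \<phi> + r\<^sup>2) ^ n) has_real_derivative
      real n * (1 - 2 * r * cos \<phi> + r\<^sup>2) ^ (n - 1) * (2 * r - 2 * cos \<phi>)) (at r within S)"
    by (auto intro!: derivative_eq_intros)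
  moreover have "((\<lambda>r. (1 - r\<^sup>2) * res_polar n r \<phi>) has_real_derivative
      (- 2 * r) * res_polar n r \<phi> + res_polar_deriv n r \<phi> * (1 - r\<^sup>2)) (at r within S)"
    by (intro DERIV_mult res_polar_has_derivative) (auto intro!: derivative_eq_intros)
  ultimately show ?thesis
    unfolding kernel_num_def
    by (rule DERIV_cong[OF DERIV_add]) (simp add: kernel_num_deriv_def algebra_simps)
qed

lemma kernel_num_pos:
  assumes "0 < n" "0 < r" "r < 1"
  shows "0 < kernel_num n r \<phi>"
proof -
  have "0 \<le> (1 - r)\<^sup>2 + 2 * r * (1 - cos \<phi>)"
    using assms one_minus_cos_bounds(1)[of \<phi>] by (intro add_nonneg_nonneg mult_nonneg_nonneg) auto
  hence "0 \<le> 1 - 2 * r * cos \<phi> + r\<^sup>2" by (simp add: power2_eq_square algebra_simps)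
  moreover have "0 < (1 - r\<^sup>2) * res_polar n r \<phi>"
    using res_polar_ge_1[OF assms(1), of r \<phi>] assms by (intro mult_pos_pos) (auto simp: abs_square_less_1)
  ultimately show ?thesis unfolding kernel_num_def by (intro add_nonneg_pos) auto
qed

section \<open>Comparison near the singular point\<close>

lemma abs_sin_minus_self_le: "\<bar>sin u - u\<bar> \<le> \<bar>u\<bar> ^ 3 / 6" for u :: real
proof -
  have "(\<Sum>m<3. sin_coeff m * u ^ m) = u"
    by (simp add: sin_coeff_def eval_nat_numeral)
  thus ?thesis using Maclaurin_sin_bound[of u 3] by (simp add: fact_numeral)
qed

lemma two_minus_two_cos: "2 * (1 - cos x) = 4 * (sin (x / 2))\<^sup>2" for x :: real
  using cos_double_sin[of "x / 2"] by simp

text \<open>For u = |x/2| \<le> 2 the cubic error u^3/6 is at most 2u/3, so sin u \<ge> u/3. The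
  constant is rough, but it holds on the whole circle.\<close>

lemma two_minus_two_cos_lower:
  fixes x :: real
  assumes "\<bar>x\<bar> \<le> pi"
  shows "x\<^sup>2 / 9 \<le> 2 * (1 - cos x)"
proof -
  define u where "u = \<bar>x / 2\<bar>"
  have u: "0 \<le> u" "u \<le> 2" using assms pi_less_4 by (auto simp: u_def)
  have "u ^ 3 = u * u\<^sup>2" by (simp add: power2_eq_square power3_eq_cube)
  also have "\<dots> \<le> u * 2\<^sup>2" using u by (intro mult_left_mono power_mono) auto
  finally have "u ^ 3 \<le> u * 4" by simp
  moreover have "\<bar>sin u - u\<bar> \<le> u ^ 3 / 6"
    using abs_sin_minus_self_le[of u] u by simp
  ultimately have "u / 3 \<le> sin u" unfolding abs_le_iff by linarith
  hence "(u / 3)\<^sup>2 \<le> (sin u)\<^sup>2" using u by (intro power_mono) auto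
  moreover have "(sin u)\<^sup>2 = (sin (x / 2))\<^sup>2" by (auto simp: u_def abs_if)
  moreover have "u\<^sup>2 = x\<^sup>2 / 4" by (simp add: u_def power_divide)
  ultimately show ?thesis unfolding two_minus_two_cos by (simp add: power_divide)
qed

lemma two_minus_two_cos_approx:
  fixes x :: real
  shows "\<bar>x\<^sup>2 - 2 * (1 - cos x)\<bar> \<le> (x\<^sup>2)\<^sup>2"
proof -
  define u where "u = x / 2"
  have "x\<^sup>2 - 2 * (1 - cos x) = - (4 * ((sin u - u) * (u + sin u)))"
    unfolding two_minus_two_cos u_def [symmetric]
    by (simp add: u_def power2_eq_square field_simps)
  hence "\<bar>x\<^sup>2 - 2 * (1 - cos x)\<bar> = 4 * (\<bar>sin u - u\<bar> * \<bar>u + sin u\<bar>)"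
    by (simp only: abs_minus_cancel abs_mult abs_numeral)
  also have "\<dots> \<le> 4 * (\<bar>u\<bar> ^ 3 / 6 * (2 * \<bar>u\<bar>))"
    using abs_sin_minus_self_le[of u] abs_sin_x_le_abs_x[of u] abs_triangle_ineq[of u "sin u"]
    by (intro mult_left_mono mult_mono) auto
  also have "\<dots> = 4 / 3 * \<bar>u\<bar> ^ 4" by (simp add: eval_nat_numeral)
  also have "\<dots> \<le> 16 * \<bar>u\<bar> ^ 4" by (intro mult_right_mono) auto
  also have "\<dots> = (x\<^sup>2)\<^sup>2" by (simp add: u_def power_divide eval_nat_numeral)
  finally show ?thesis .
qed

lemma abs_power_diff_le:
  fixes a b c :: real
  assumes "0 \<le> a" "a \<le> c" "0 \<le> b" "b \<le> c"
  shows "\<bar>a ^ n - b ^ n\<bar> \<le> real n * c ^ (n - 1) * \<bar>a - b\<bar>"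
proof (induction n)
  case (Suc n)
  have c: "0 \<le> c" using assms by simp
  have "a ^ Suc n - b ^ Suc n = a * (a ^ n - b ^ n) + b ^ n * (a - b)"
    by (simp add: algebra_simps)
  hence "\<bar>a ^ Suc n - b ^ Suc n\<bar> \<le> a * \<bar>a ^ n - b ^ n\<bar> + b ^ n * \<bar>a - b\<bar>"
    using abs_triangle_ineq[of "a * (a ^ n - b ^ n)" "b ^ n * (a - b)"] assms by (simp add: abs_mult)
  also have "\<dots> \<le> c * (real n * c ^ (n - 1) * \<bar>a - b\<bar>) + c ^ n * \<bar>a - b\<bar>"
    using assms Suc.IH c by (intro add_mono mult_mono mult_right_mono power_mono) auto
  also have "\<dots> = real (Suc n) * c ^ (Suc n - 1) * \<bar>a - b\<bar>"
    by (cases n) (simp_all add: algebra_simps)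
  finally show ?case .
qed simp

lemma power_add_le:
  fixes p q :: real
  assumes "0 \<le> p" "0 \<le> q"
  shows "(p + q) ^ k \<le> 2 ^ k * (p ^ k + q ^ k)"
proof -
  have "(p + q) ^ k \<le> (2 * max p q) ^ k" using assms by (intro power_mono) auto
  also have "\<dots> = 2 ^ k * max p q ^ k" by (rule power_mult_distrib)
  also have "\<dots> \<le> 2 ^ k * (p ^ k + q ^ k)"
    using assms by (intro mult_left_mono) (auto simp: max_def)
  finally show ?thesis .
qed

text \<open>The identity D/A + 2c/G = (D + 2c)/A + 2c (A - G)/(A G) separates the errors of
  numerator and denominator; \<open>W\<close> is a common lower scale for \<open>A\<close> and
  \<open>G\<close>, and \<open>s\<close> the relative error.\<close>

lemma quotient_comparison:
  fixes A D G W c s M1 M2 \<kappa> :: real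
  assumes W: "0 < W" "W \<le> G" and \<kappa>: "0 < \<kappa>" "\<kappa> * W \<le> A" and c: "0 \<le> c" and s: "0 \<le> s"
    and D: "\<bar>D + 2 * c\<bar> \<le> M2 * s" and A: "\<bar>A - G\<bar> \<le> M1 * (s * W)"
  shows "\<bar>D / A + 2 * c / G\<bar> \<le> (M2 + 2 * c * M1) / \<kappa> * (s / W)"
proof -
  have G: "0 < G" using W by simp
  have kW: "0 < \<kappa> * W" using W \<kappa> by simp
  have Ap: "0 < A" using kW \<kappa> by simp
  have "D / A + 2 * c / G = (D + 2 * c) / A + 2 * c * (A - G) / (A * G)"
    using Ap G by (simp add: field_simps)
  hence "\<bar>D / A + 2 * c / G\<bar> \<le> \<bar>(D + 2 * c) / A\<bar> + \<bar>2 * c * (A - G) / (A * G)\<bar>"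
    by (simp only: abs_triangle_ineq)
  also have "\<bar>(D + 2 * c) / A\<bar> = \<bar>D + 2 * c\<bar> / A" using Ap by simp
  also have "\<dots> \<le> M2 * s / (\<kappa> * W)"
    using D \<kappa> kW by (intro frac_le) auto
  also have "\<bar>2 * c * (A - G) / (A * G)\<bar> = 2 * c * \<bar>A - G\<bar> / (A * G)"
    using Ap G c by (simp add: abs_mult)
  also have "\<dots> \<le> 2 * c * (M1 * (s * W)) / ((\<kappa> * W) * W)"
  proof (intro frac_le mult_left_mono mult_mono)
    show "0 \<le> 2 * c * (M1 * (s * W))"
      by (rule mult_nonneg_nonneg) (use c order_trans[OF abs_ge_zero A] in auto)
  qed (use W \<kappa> kW c A Ap in auto)
  also have "M2 * s / (\<kappa> * W) + 2 * c * (M1 * (s * W)) / ((\<kappa> * W) * W) = (M2 + 2 * c * M1) / \<kappa> * (s / W)"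
    using W \<kappa> by (simp add: field_simps)
  finally show ?thesis by simp
qed

text \<open>The kernel numerator is y^n + t Q, with y = |1 + z|^2 close to \<phi>^2 and Q close to
  c. In its r-derivative the factor 2r - 2 cos \<phi> and the term with 1 - r^2 are O(\<phi>^2 + t),
  so only -2 r Q, close to -2c, survives. The estimates hold for all |\<phi>| \<le> pi, so no
  neighbourhood of -1 has to be singled out.\<close>

lemma kernel_num_log_deriv_bound:
  assumes n: "0 < n"
  defines "c \<equiv> real ((2 * (n - 1)) choose (n - 1))"
  obtains M where "0 \<le> M"
    "\<And>r \<phi>. 1 / 2 \<le> r \<Longrightarrow> r < 1 \<Longrightarrow> \<bar>\<phi>\<bar> \<le> pi \<Longrightarrow>
      \<bar>r * kernel_num_deriv n r \<phi> / kernel_num n r \<phi> + 2 * c / (\<phi> ^ (2 * n) + c * (1 - r\<^sup>2))\<bar>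
        \<le> M * ((\<phi>\<^sup>2 + (1 - r\<^sup>2)) / (\<phi> ^ (2 * n) + (1 - r\<^sup>2)))"
proof -
  obtain B where B: "0 \<le> B"
    "\<And>r \<phi>. 0 \<le> r \<Longrightarrow> r \<le> 1 \<Longrightarrow> \<bar>res_polar n r \<phi> - res_polar n 1 0\<bar> \<le> B * (1 - r + \<phi>\<^sup>2)"
    "\<And>r \<phi>. 0 \<le> r \<Longrightarrow> r \<le> 1 \<Longrightarrow> \<bar>res_polar_deriv n r \<phi>\<bar> \<le> B"
    using res_polar_bounds[of n] by metis
  have c1: "res_polar n 1 0 = c" unfolding c_def by (rule res_polar_1_0[OF n])
  have c: "1 \<le> c" using res_polar_ge_1[OF n, of 1 0] c1 by simp
  \<comment> \<open>The factor 2^(n-1) is from \<open>power_add_le\<close>; 16 and 17 bound p =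
    \<phi>^2, since pi < 4, and s = p + t.\<close>
  define K where "K = 2 ^ (n - 1) * (16 ^ (n - 1) + 17 :: real)"
  have K: "1 \<le> K" "0 \<le> K"
  proof -
    have "1 * 1 \<le> K" unfolding K_def by (intro mult_mono) (auto intro: add_increasing)
    thus "1 \<le> K" "0 \<le> K" by auto
  qed
  define M1 where "M1 = real n * K + B"
  define M2 where "M2 = real n * 17 ^ (n - 1) * 2 + 2 * B + 2 * c + B"
  \<comment> \<open>18 = 2 * 9: r \<ge> 1/2 and the lower bound \<phi>^2/9 for 2 - 2 cos \<phi> give
    y \<ge> p/18.\<close>
  define \<kappa> where "\<kappa> = 1 / (18::real) ^ n"
  have \<kappa>: "0 < \<kappa>" "\<kappa> \<le> 1" by (auto simp: \<kappa>_def)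
  define M where "M = (M2 + 2 * c * M1) / \<kappa>"
  show thesis
  proof
    show "0 \<le> M" unfolding M_def M1_def M2_def using \<kappa> B c K
      by (intro divide_nonneg_pos add_nonneg_nonneg mult_nonneg_nonneg) auto
    fix r \<phi> :: real assume r: "1 / 2 \<le> r" "r < 1" and \<phi>: "\<bar>\<phi>\<bar> \<le> pi"
    define p where "p = \<phi>\<^sup>2"
    define t where "t = 1 - r\<^sup>2"
    define X where "X = 2 * (1 - cos \<phi>)"
    define y where "y = 1 - 2 * r * cos \<phi> + r\<^sup>2"
    define Q where "Q = res_polar n r \<phi>"
    define Q' where "Q' = res_polar_deriv n r \<phi>"
    have r2: "r\<^sup>2 < 1" using r by (simp add: abs_square_less_1)
    have t: "0 < t" "t \<le> 1" using r2 by (auto simp: t_def)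
    have "t = (1 - r) * (1 + r)" by (simp add: t_def power2_eq_square algebra_simps)
    hence rt: "1 - r \<le> t" using mult_left_mono[of 1 "1 + r" "1 - r"] r by simp
    have p: "0 \<le> p" "p \<le> 16"
    proof -
      have "\<bar>\<phi>\<bar>\<^sup>2 \<le> 4\<^sup>2" using \<phi> pi_less_4 by (intro power_mono) auto
      thus "0 \<le> p" "p \<le> 16" by (auto simp: p_def)
    qed
    have \<phi>p: "\<phi> ^ (2 * n) = p ^ n" by (simp add: p_def power_mult)
    have X: "p / 9 \<le> X" "0 \<le> X" "X \<le> p" "\<bar>p - X\<bar> \<le> p\<^sup>2"
      using two_minus_two_cos_lower[OF \<phi>] one_minus_cos_bounds[of \<phi>] two_minus_two_cos_approx[of \<phi>]
      by (auto simp: X_def p_def)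
    have yX: "y = (1 - r)\<^sup>2 + r * X"
      by (simp add: y_def X_def power2_eq_square algebra_simps)
    have rX: "0 \<le> (1 - r) * X" "(1 - r) * X \<le> t * p"
      using r rt X t by (auto intro!: mult_mono)
    have rsq: "0 \<le> (1 - r)\<^sup>2" "(1 - r)\<^sup>2 \<le> t\<^sup>2" using rt r by (auto intro!: power_mono)
    have tsq: "t\<^sup>2 \<le> t" using t by (simp add: power2_eq_square mult_left_le)
    have yX': "y = (1 - r)\<^sup>2 + X - (1 - r) * X" by (simp add: yX algebra_simps)
    have y_low: "p / 18 \<le> y"
    proof -
      have "1 / 2 * (p / 9) \<le> r * X" using r X p by (intro mult_mono) auto
      thus ?thesis using rsq yX by linarith
    qed
    have y0: "0 \<le> y" using y_low p by simp
    have y_up: "y \<le> p + t\<^sup>2" using yX' rX rsq X by simp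
    \<comment> \<open>The three discrepancies (1-r)^2, (1-r) X and p - X are all quadratic in p and
      t.\<close>
    have yp: "\<bar>y - p\<bar> \<le> (p + t)\<^sup>2"
    proof -
      have e: "(p + t)\<^sup>2 = p\<^sup>2 + t\<^sup>2 + 2 * (t * p)" by (simp add: power2_eq_square algebra_simps)
      have "0 \<le> t * p" using t p by simp
      thus ?thesis unfolding e yX' using rX rsq X(4) unfolding abs_le_iff by (intro conjI; linarith)
    qed
    define s where "s = p + t"
    have s: "0 \<le> s" "s \<le> 17" using p t by (auto simp: s_def)
    define W where "W = p ^ n + t"
    have W: "0 < W" using p t by (auto simp: W_def intro: add_nonneg_pos)
    define G where "G = p ^ n + c * t"
    have WG: "W \<le> G" using c t by (simp add: W_def G_def)
    \<comment> \<open>The square s^2 in \<open>yp\<close> is spent in two halves: this bound lets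
      one s combine with the power n - 1 into W, and the other s stays as the relative error in
      \<open>An\<close>.\<close>
    have Kbd: "s * (p + t\<^sup>2) ^ (n - 1) \<le> K * W"
    proof (cases "n = 1")
      case True
      have "s \<le> W" by (simp add: s_def W_def True)
      also have "\<dots> \<le> K * W" using K W by simp
      finally show ?thesis using True by simp
    next
      case False
      have pn: "p * p ^ (n - 1) = p ^ n" using n by (cases n) auto
      have p16: "p ^ (n - 1) \<le> 16 ^ (n - 1)" using p by (intro power_mono)
      have tt: "(t\<^sup>2) ^ (n - 1) \<le> t"
      proof -
        have "(t\<^sup>2) ^ (n - 1) = t ^ (2 * (n - 1))" by (simp add: power_mult)
        also have "\<dots> \<le> t ^ 1" using t n False by (intro power_decreasing) auto
        finally show ?thesis by simp
      qed
      have "s * (p + t\<^sup>2) ^ (n - 1) \<le> s * (2 ^ (n - 1) * (p ^ (n - 1) + (t\<^sup>2) ^ (n - 1)))"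
        using s p by (intro mult_left_mono power_add_le) auto
      also have "\<dots> = 2 ^ (n - 1) * (p ^ n + t * p ^ (n - 1) + s * (t\<^sup>2) ^ (n - 1))"
        unfolding s_def pn [symmetric] by (simp add: algebra_simps)
      also have "\<dots> \<le> 2 ^ (n - 1) * ((16 ^ (n - 1) + 17) * p ^ n + t * 16 ^ (n - 1) + 17 * t)"
      proof (rule mult_left_mono, intro add_mono)
        have "1 * p ^ n \<le> (16 ^ (n - 1) + 17) * p ^ n"
          using p by (intro mult_right_mono) (auto intro: add_increasing)
        thus "p ^ n \<le> (16 ^ (n - 1) + 17) * p ^ n" by simp
        show "t * p ^ (n - 1) \<le> t * 16 ^ (n - 1)" using t p16 by simp
        show "s * (t\<^sup>2) ^ (n - 1) \<le> 17 * t" using s tt by (intro mult_mono) auto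
      qed auto
      also have "\<dots> = K * W" by (simp add: K_def W_def algebra_simps)
      finally show ?thesis .
    qed
    have An: "\<bar>y ^ n - p ^ n\<bar> \<le> real n * K * (s * W)"
    proof -
      have "\<bar>y ^ n - p ^ n\<bar> \<le> real n * (p + t\<^sup>2) ^ (n - 1) * \<bar>y - p\<bar>"
        using y0 y_up p by (intro abs_power_diff_le) auto
      also have "\<dots> \<le> real n * (p + t\<^sup>2) ^ (n - 1) * s\<^sup>2"
        using yp p by (intro mult_left_mono) (auto simp: s_def)
      also have "\<dots> = real n * s * (s * (p + t\<^sup>2) ^ (n - 1))"
        by (simp add: power2_eq_square)
      also have "\<dots> \<le> real n * s * (K * W)"
        using Kbd s by (intro mult_left_mono) auto
      finally show ?thesis by (simp add: mult_ac)
    qed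
    have Qc: "\<bar>Q - c\<bar> \<le> B * s"
    proof -
      have "\<bar>Q - c\<bar> \<le> B * (1 - r + p)" using B(2)[of r \<phi>] r c1 by (simp add: Q_def p_def)
      also have "\<dots> \<le> B * s" using B(1) rt by (intro mult_left_mono) (auto simp: s_def)
      finally show ?thesis .
    qed
    have A: "kernel_num n r \<phi> = y ^ n + t * Q"
      by (simp add: kernel_num_def y_def t_def Q_def)
    have AG: "\<bar>kernel_num n r \<phi> - G\<bar> \<le> M1 * (s * W)"
    proof -
      have "kernel_num n r \<phi> - G = (y ^ n - p ^ n) + t * (Q - c)"
        by (simp add: A G_def algebra_simps)
      hence "\<bar>kernel_num n r \<phi> - G\<bar> \<le> \<bar>y ^ n - p ^ n\<bar> + t * \<bar>Q - c\<bar>"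
        using abs_triangle_ineq[of "y ^ n - p ^ n" "t * (Q - c)"] t by (simp add: abs_mult)
      also have "\<dots> \<le> real n * K * (s * W) + W * (B * s)"
        using An Qc t p s B(1) by (intro add_mono mult_mono) (auto simp: W_def)
      finally show ?thesis by (simp add: M1_def algebra_simps)
    qed
    have Alow: "\<kappa> * W \<le> kernel_num n r \<phi>"
    proof -
      have "\<kappa> * p ^ n = (p / 18) ^ n" by (simp add: \<kappa>_def power_divide)
      also have "\<dots> \<le> y ^ n" using y_low p by (intro power_mono) auto
      finally have "\<kappa> * p ^ n \<le> y ^ n" .
      moreover have "\<kappa> * t \<le> Q * t"
        using res_polar_ge_1[OF n, of r \<phi>] \<kappa> t by (intro mult_right_mono) (auto simp: Q_def)
      ultimately show ?thesis unfolding A W_def by (simp add: algebra_simps)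
    qed
    have D: "\<bar>r * kernel_num_deriv n r \<phi> + 2 * c\<bar> \<le> M2 * s"
    proof -
      define U where "U = real n * y ^ (n - 1)"
      have U: "0 \<le> U" "U \<le> real n * 17 ^ (n - 1)"
        using y0 y_up tsq p t unfolding U_def by (auto intro!: mult_left_mono power_mono)
      define V where "V = r * (2 * r - 2 * cos \<phi>)"
      have V: "\<bar>V\<bar> \<le> 2 * s"
      proof -
        have "2 * r - 2 * cos \<phi> = X - 2 * (1 - r)" by (simp add: X_def)
        hence "\<bar>2 * r - 2 * cos \<phi>\<bar> \<le> 2 * s"
          using X rt r p t unfolding s_def by (simp add: abs_le_iff)
        hence "r * \<bar>2 * r - 2 * cos \<phi>\<bar> \<le> 1 * (2 * s)" using r by (intro mult_mono) auto
        thus ?thesis using r by (simp add: V_def abs_mult)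
      qed
      \<comment> \<open>The cancellation is -2 r^2 Q + 2c = -2 r^2 (Q - c) + 2 t c, whose terms are
        both O(s).\<close>
      have eq: "r * kernel_num_deriv n r \<phi> + 2 * c = U * V - 2 * r\<^sup>2 * (Q - c) + 2 * t * c + t * r * Q'"
        unfolding kernel_num_deriv_def y_def [symmetric] Q_def [symmetric] Q'_def [symmetric]
          t_def [symmetric] U_def V_def
        by (simp add: t_def power2_eq_square algebra_simps)
      have "\<bar>U * V\<bar> \<le> (real n * 17 ^ (n - 1)) * (2 * s)"
        unfolding abs_mult using U V s by (intro mult_mono) auto
      moreover have "\<bar>2 * r\<^sup>2 * (Q - c)\<bar> \<le> 2 * (B * s)"
      proof -
        have "r\<^sup>2 * \<bar>Q - c\<bar> \<le> 1 * (B * s)" using Qc r2 by (intro mult_mono) auto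
        thus ?thesis by (simp add: abs_mult)
      qed
      moreover have "\<bar>2 * t * c\<bar> \<le> 2 * c * s"
        using t c p by (simp add: s_def mult.commute mult_left_mono)
      moreover have "\<bar>t * r * Q'\<bar> \<le> B * s"
      proof -
        have "(t * r) * \<bar>Q'\<bar> \<le> (s * 1) * B"
          using B(3)[of r \<phi>] r t p s by (intro mult_mono) (auto simp: Q'_def s_def)
        thus ?thesis using t r by (simp add: abs_mult mult.commute)
      qed
      ultimately have "\<bar>r * kernel_num_deriv n r \<phi> + 2 * c\<bar> \<le>
          (real n * 17 ^ (n - 1)) * (2 * s) + 2 * (B * s) + 2 * c * s + B * s"
        unfolding eq by linarith
      thus ?thesis by (simp add: M2_def algebra_simps)
    qed
    show "\<bar>r * kernel_num_deriv n r \<phi> / kernel_num n r \<phi> + 2 * c / (\<phi> ^ (2 * n) + c * (1 - r\<^sup>2))\<bar>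
        \<le> M * ((\<phi>\<^sup>2 + (1 - r\<^sup>2)) / (\<phi> ^ (2 * n) + (1 - r\<^sup>2)))"
      using quotient_comparison[OF W WG \<kappa>(1) Alow _ s(1) D AG] c
      by (simp add: M_def G_def W_def s_def p_def t_def power_mult)
  qed
qed

section \<open>Expected number of zeros\<close>

lemma continuous_on_res_polar [continuous_intros]:
  fixes f g :: "'b::t2_space \<Rightarrow> real"
  assumes "continuous_on A f" "continuous_on A g"
  shows "continuous_on A (\<lambda>x. res_polar n (f x) (g x))"
  unfolding res_polar_def by (intro continuous_intros assms)

lemma continuous_on_res_polar_deriv [continuous_intros]:
  fixes f g :: "'b::t2_space \<Rightarrow> real"
  assumes "continuous_on A f" "continuous_on A g"
  shows "continuous_on A (\<lambda>x. res_polar_deriv n (f x) (g x))"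
  unfolding res_polar_deriv_def by (intro continuous_intros assms)

lemma continuous_on_kernel_num [continuous_intros]:
  fixes f g :: "'b::t2_space \<Rightarrow> real"
  assumes "continuous_on A f" "continuous_on A g"
  shows "continuous_on A (\<lambda>x. kernel_num n (f x) (g x))"
  unfolding kernel_num_def by (intro continuous_intros assms)

lemma continuous_on_kernel_num_deriv [continuous_intros]:
  fixes f g :: "'b::t2_space \<Rightarrow> real"
  assumes "continuous_on A f" "continuous_on A g"
  shows "continuous_on A (\<lambda>x. kernel_num_deriv n (f x) (g x))"
  unfolding kernel_num_deriv_def by (intro continuous_intros assms)

lemma integral_unit_interval_angle:
  fixes f :: "real \<Rightarrow> real"
  assumes "continuous_on {-pi..pi} f"
  shows "integral {0..1} (\<lambda>x. f (2 * pi * x - pi)) = integral {-pi..pi} f / (2 * pi)"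
proof -
  have "((\<lambda>x. (2 * pi) *\<^sub>R f (2 * pi * x - pi)) has_integral
      integral {2 * pi * 0 - pi..2 * pi * 1 - pi} f) {0..1}"
  proof (rule has_integral_substitution[where c="- pi" and d=pi and f=f
        and g="\<lambda>x. 2 * pi * x - pi" and g'="\<lambda>x. 2 * pi"])
    show "(\<lambda>x. 2 * pi * x - pi) ` {0..1} \<subseteq> {-pi..pi}"
      by (auto simp: mult_left_le)
    show "((\<lambda>x. 2 * pi * x - pi) has_field_derivative 2 * pi) (at x within {0..1})" for x
      by (auto intro!: derivative_eq_intros)
  qed (use assms in auto)
  from has_integral_mult_right[OF this, of "1 / (2 * pi)"]
  show ?thesis by (simp add: integral_unique)
qed

definition log_deriv_mean :: "nat \<Rightarrow> real \<Rightarrow> real" where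
  "log_deriv_mean n r = integral {-pi..pi} (\<lambda>\<phi>. kernel_num_deriv n r \<phi> / kernel_num n r \<phi>) / (2 * pi)"

text \<open>Integrating the pointwise comparison gives r I1 = -2c I2 up to M I3, where I2 is the
  Beta integral up to bounded tails and I3 has the size of the error term.\<close>

lemma log_deriv_mean_asymptotics:
  assumes n: "0 < n"
  obtains C where "\<And>r. 1 / 2 \<le> r \<Longrightarrow> r < 1 \<Longrightarrow>
    \<bar>r * log_deriv_mean n r / 2 + D_const n * (1 - r\<^sup>2) powr (- ((2 * real n - 1) / (2 * real n)))\<bar>
      \<le> C * error_scale n (1 - r\<^sup>2)"
proof -
  define c where "c = real ((2 * (n - 1)) choose (n - 1))"
  define a where "a = 1 / (2 * real n)"
  have c: "0 < c" by (simp add: c_def)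
  obtain M where M: "0 \<le> M"
    "\<And>r \<phi>. 1 / 2 \<le> r \<Longrightarrow> r < 1 \<Longrightarrow> \<bar>\<phi>\<bar> \<le> pi \<Longrightarrow>
      \<bar>r * kernel_num_deriv n r \<phi> / kernel_num n r \<phi> + 2 * c / (\<phi> ^ (2 * n) + c * (1 - r\<^sup>2))\<bar>
        \<le> M * ((\<phi>\<^sup>2 + (1 - r\<^sup>2)) / (\<phi> ^ (2 * n) + (1 - r\<^sup>2)))"
    using kernel_num_log_deriv_bound[OF n] unfolding c_def by blast
  show thesis
  proof
    fix r :: real assume r: "1 / 2 \<le> r" "r < 1"
    define t where "t = 1 - r\<^sup>2"
    have "0 < r\<^sup>2" "r\<^sup>2 < 1" using r by (auto simp: abs_square_less_1)
    hence t: "0 < t" "t < 1" by (auto simp: t_def)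
    have pos: "\<phi> ^ (2 * n) + e > 0" if "0 < e" for \<phi> e :: real
      using that by (auto intro!: add_nonneg_pos)
    have kp: "kernel_num n r \<phi> > 0" for \<phi>
      using kernel_num_pos[OF n] r by simp
    define I1 where "I1 = integral {-pi..pi} (\<lambda>\<phi>. kernel_num_deriv n r \<phi> / kernel_num n r \<phi>)"
    define I2 where "I2 = integral {-pi..pi} (\<lambda>\<phi>. 1 / (\<phi> ^ (2 * n) + c * t))"
    define I3 where "I3 = integral {-pi..pi} (\<lambda>\<phi>. (\<phi>\<^sup>2 + t) / (\<phi> ^ (2 * n) + t))"
    have h1: "((\<lambda>\<phi>. kernel_num_deriv n r \<phi> / kernel_num n r \<phi>) has_integral I1) {-pi..pi}"
      unfolding I1_def using kp
      by (intro integrable_integral integrable_continuous_real continuous_intros)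
         (auto simp: less_imp_neq [symmetric])
    have h2: "((\<lambda>\<phi>. 1 / (\<phi> ^ (2 * n) + c * t)) has_integral I2) {-pi..pi}"
      unfolding I2_def using pos[of "c * t"] c t
      by (intro integrable_integral integrable_continuous_real continuous_intros)
         (auto simp: less_imp_neq [symmetric])
    have h3: "((\<lambda>\<phi>. (\<phi>\<^sup>2 + t) / (\<phi> ^ (2 * n) + t)) has_integral I3) {-pi..pi}"
      unfolding I3_def using pos[of t] t
      by (intro integrable_integral integrable_continuous_real continuous_intros)
         (auto simp: less_imp_neq [symmetric])
    have s: "((\<lambda>\<phi>. r * (kernel_num_deriv n r \<phi> / kernel_num n r \<phi>) + 2 * c * (1 / (\<phi> ^ (2 * n) + c * t)))
        has_integral (r * I1 + 2 * c * I2)) {-pi..pi}"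
      by (intro has_integral_add has_integral_mult_right h1 h2)
    have b: "\<bar>r * (kernel_num_deriv n r \<phi> / kernel_num n r \<phi>) + 2 * c * (1 / (\<phi> ^ (2 * n) + c * t))\<bar>
        \<le> M * ((\<phi>\<^sup>2 + t) / (\<phi> ^ (2 * n) + t))" if "\<phi> \<in> {-pi..pi}" for \<phi>
      using M(2)[OF r, of \<phi>] that by (simp add: t_def abs_le_iff)
    have m: "((\<lambda>\<phi>. M * ((\<phi>\<^sup>2 + t) / (\<phi> ^ (2 * n) + t))) has_integral M * I3) {-pi..pi}"
      by (intro has_integral_mult_right h3)
    have "r * I1 + 2 * c * I2 \<le> M * I3"
      by (rule has_integral_le[OF s m]) (use b in \<open>auto simp: abs_le_iff\<close>)
    moreover have "- (M * I3) \<le> r * I1 + 2 * c * I2"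
      by (rule has_integral_le[OF has_integral_neg[OF m] s]) (use b in \<open>fastforce simp: abs_le_iff\<close>)
    ultimately have 1: "\<bar>r * I1 + 2 * c * I2\<bar> \<le> M * I3" by (simp add: abs_le_iff)
    have es: "1 \<le> error_scale n t" by (rule error_scale_ge_1[OF n t])
    have 2: "M * I3 \<le> M * (4 * pi * error_scale n t)"
      unfolding I3_def using M(1) integral_error_bound[OF n t] by (rule mult_left_mono[rotated])
    have 3: "\<bar>I2 - 2 * (c * t) powr (a - 1) * a * pi / sin (pi * a)\<bar> \<le> 1"
      unfolding I2_def a_def using c t by (intro integral_inverse_power_plus_bounds n) auto
    define E where "E = I2 - 2 * (c * t) powr (a - 1) * a * pi / sin (pi * a)"
    \<comment> \<open>The prefactor c and the c inside the denominator combine: c (ct)^(a-1) = c^a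
      t^(a-1), which produces the power 1/(2n) of the binomial.\<close>
    have main: "D_const n * t powr (- ((2 * real n - 1) / (2 * real n))) =
        c * (c * t) powr (a - 1) * a / sin (pi * a)"
    proof -
      have e: "- ((2 * real n - 1) / (2 * real n)) = a - 1"
        using n by (simp add: a_def field_simps)
      have "c * (c * t) powr (a - 1) = c powr 1 * c powr (a - 1) * t powr (a - 1)"
        using c t by (simp add: powr_mult)
      also have "c powr 1 * c powr (a - 1) = c powr a"
        by (simp only: powr_add [symmetric]) simp
      finally have "c * (c * t) powr (a - 1) = c powr a * t powr (a - 1)" .
      moreover have "D_const n = a / sin (pi * a) * c powr a"
        by (simp add: D_const_def a_def c_def)
      ultimately show ?thesis unfolding e by simp
    qed
    \<comment> \<open>In 4 pi, a factor 2 pi is the length of the circle and the remaining 2 comes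
      from halving log K.\<close>
    have "r * log_deriv_mean n r / 2 + D_const n * t powr (- ((2 * real n - 1) / (2 * real n))) =
        (r * I1 + 2 * c * I2) / (4 * pi) - 2 * c * E / (4 * pi)"
      unfolding main log_deriv_mean_def I1_def [symmetric] E_def by (simp add: field_simps)
    also have "\<bar>\<dots>\<bar> \<le> \<bar>(r * I1 + 2 * c * I2) / (4 * pi)\<bar> + \<bar>2 * c * E / (4 * pi)\<bar>"
      by (rule abs_triangle_ineq4)
    also have "\<dots> \<le> M * error_scale n t + 2 * c * error_scale n t"
    proof (rule add_mono)
      have "\<bar>r * I1 + 2 * c * I2\<bar> \<le> M * error_scale n t * (4 * pi)"
        using 1 2 by (simp add: mult_ac)
      thus "\<bar>(r * I1 + 2 * c * I2) / (4 * pi)\<bar> \<le> M * error_scale n t"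
        by (simp add: divide_le_eq)
      have "\<bar>E\<bar> / (4 * pi) \<le> 1 / 1"
        using 3 pi_ge_two by (intro frac_le) (auto simp: E_def)
      hence "\<bar>E\<bar> / (4 * pi) \<le> error_scale n t" using es by linarith
      hence "2 * c * (\<bar>E\<bar> / (4 * pi)) \<le> 2 * c * error_scale n t"
        by (rule mult_left_mono) (use c in simp)
      moreover have "\<bar>2 * c * E / (4 * pi)\<bar> = 2 * c * (\<bar>E\<bar> / (4 * pi))"
        using c by (simp add: abs_mult)
      ultimately show "\<bar>2 * c * E / (4 * pi)\<bar> \<le> 2 * c * error_scale n t"
        by (simp only:)
    qed
    finally show "\<bar>r * log_deriv_mean n r / 2 + D_const n * (1 - r\<^sup>2) powr (- ((2 * real n - 1) / (2 * real n)))\<bar>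
      \<le> (M + 2 * c) * error_scale n (1 - r\<^sup>2)"
      by (simp add: t_def distrib_right)
  qed
qed

context binomial_process begin

text \<open>The denominator 1 - r^2 of the kernel yields r/(1-r^2), the binomial constant
  disappears, and \<open>kernel_num\<close> is differentiated under the integral sign.\<close>

lemma H_has_derivative:
  assumes r: "0 < r" "r < 1"
  shows "(H has_real_derivative (r / (1 - r\<^sup>2) + log_deriv_mean n r / 2)) (at r)"
proof -
  define C where "C = real ((2 * n) choose n)"
  have C: "0 < C" by (simp add: C_def)
  define f where "f s x = ln (kernel_num n s (2 * pi * x - pi)) / 2 - ln (1 - s\<^sup>2) / 2 - ln C / 2" for s x
  define f' where "f' s x = kernel_num_deriv n s (2 * pi * x - pi) / kernel_num n s (2 * pi * x - pi) / 2
      + s / (1 - s\<^sup>2)" for s x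
  have kp: "kernel_num n s \<phi> > 0" if "s \<in> {0<..<1}" for s \<phi>
    using kernel_num_pos[OF n_pos] that by simp
  have s2: "1 - s\<^sup>2 > 0" if "s \<in> {0<..<1}" for s :: real
    using that by (simp add: abs_square_less_1)
  have s2': "s\<^sup>2 \<noteq> 1" if "0 < s" "s < 1" for s :: real
    using s2[of s] that by simp
  have Heq: "H s = integral (cbox 0 1) (f s)" if s: "s \<in> {0<..<1}" for s
    unfolding H_def cbox_interval
  proof (intro integral_cong)
    fix x :: real
    show "ln (kernel n (circ s x)) / 2 = f s x"
    proof -
      have "kernel n (circ s x) = kernel_num n s (2 * pi * x - pi) / ((1 - s\<^sup>2) * C)"
        unfolding C_def using s by (intro kernel_circ) auto
      hence "ln (kernel n (circ s x)) = ln (kernel_num n s (2 * pi * x - pi)) - (ln (1 - s\<^sup>2) + ln C)"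
        using kp[OF s, of "2 * pi * x - pi"] s2[OF s] C by (simp add: ln_div ln_mult)
      thus ?thesis by (simp add: f_def field_simps)
    qed
  qed
  have "((\<lambda>s. integral (cbox 0 1) (f s)) has_real_derivative integral (cbox 0 1) (f' r)) (at r within {0<..<1})"
  proof (rule leibniz_rule_field_derivative)
    fix s x :: real assume s: "s \<in> {0<..<1}"
    show "((\<lambda>s. f s x) has_real_derivative f' s x) (at s within {0<..<1})"
      unfolding f_def f'_def using kp[OF s, of "2 * pi * x - pi"] s2[OF s]
      by (auto intro!: derivative_eq_intros kernel_num_has_derivative simp: field_simps)
    show "f s integrable_on cbox 0 1"
      unfolding f_def cbox_interval using kp[OF s]
      by (intro integrable_continuous_real continuous_intros) (auto simp: less_imp_neq [symmetric])
  next
    show "continuous_on ({0<..<1} \<times> cbox 0 1) (\<lambda>(s, x). f' s x)"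
      unfolding f'_def split_beta
      by (intro continuous_intros) (auto simp: kp less_imp_neq [symmetric] s2')
  qed (use r in auto)
  moreover have "at r within {0<..<1} = at r"
    using r by (intro at_within_open) auto
  ultimately have "((\<lambda>s. integral (cbox 0 1) (f s)) has_real_derivative integral (cbox 0 1) (f' r)) (at r)"
    by (simp only:)
  hence "(H has_real_derivative integral (cbox 0 1) (f' r)) (at r)"
    by (rule has_field_derivative_transform_within_open[where S="{0<..<1}"]) (use r Heq in auto)
  also have "integral (cbox 0 1) (f' r) = r / (1 - r\<^sup>2) + log_deriv_mean n r / 2"
  proof -
    define g where "g \<phi> = kernel_num_deriv n r \<phi> / kernel_num n r \<phi>" for \<phi>
    have g: "continuous_on A (\<lambda>x. g (h x))" if "continuous_on A h" for A and h :: "real \<Rightarrow> real"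
      unfolding g_def using kp r that by (intro continuous_intros) (auto simp: less_imp_neq [symmetric])
    have gi: "(\<lambda>x. g (2 * pi * x - pi)) integrable_on {0..1}"
      by (intro integrable_continuous_real g continuous_intros)
    have k: "((\<lambda>x. r / (1 - r\<^sup>2)) has_integral r / (1 - r\<^sup>2)) {0..1::real}"
      using has_integral_const_real[of "r / (1 - r\<^sup>2)" 0 1] by simp
    have "((\<lambda>x. g (2 * pi * x - pi) / 2 + r / (1 - r\<^sup>2)) has_integral
        (integral {0..1} (\<lambda>x. g (2 * pi * x - pi)) / 2 + r / (1 - r\<^sup>2))) {0..1}"
      by (intro has_integral_add has_integral_divide k integrable_integral gi)
    hence "integral (cbox 0 1) (f' r) = integral {0..1} (\<lambda>x. g (2 * pi * x - pi)) / 2 + r / (1 - r\<^sup>2)"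
      unfolding f'_def g_def cbox_interval by (simp add: integral_unique)
    also have "integral {0..1} (\<lambda>x. g (2 * pi * x - pi)) = log_deriv_mean n r"
      using integral_unit_interval_angle[OF g[OF continuous_on_id]] by (simp add: log_deriv_mean_def g_def)
    finally show ?thesis by simp
  qed
  finally show ?thesis .
qed

text \<open>The quotient q is a difference quotient of \<open>H\<close> with respect to log r, so it
  tends to r H'(r). For \<rho> > r it bounds the expected count at r from above and for \<rho> < r
  from below; letting \<rho> tend to r from both sides needs no continuity of the count.\<close>

lemma expected_zeros_eq:
  assumes r: "0 < r" "r < 1"
  defines "v \<equiv> r\<^sup>2 / (1 - r\<^sup>2) + r * log_deriv_mean n r / 2"
  shows "0 \<le> v" "expected_zeros M \<xi> r = ennreal v"
proof -
  define q where "q \<rho> = (H \<rho> - H r) / ln (\<rho> / r)" for \<rho>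
  have lim: "(q \<longlongrightarrow> v) (at r)"
  proof -
    have dl: "(ln has_real_derivative 1 / r) (at r)"
      using r by (auto intro!: derivative_eq_intros)
    have "((\<lambda>\<rho>. ((H \<rho> - H r) / (\<rho> - r)) / ((ln \<rho> - ln r) / (\<rho> - r))) \<longlongrightarrow>
        (r / (1 - r\<^sup>2) + log_deriv_mean n r / 2) / (1 / r)) (at r)"
      by (rule tendsto_divide[OF H_has_derivative[OF r, unfolded has_field_derivative_iff]
            dl[unfolded has_field_derivative_iff]]) (use r in auto)
    also have "(r / (1 - r\<^sup>2) + log_deriv_mean n r / 2) / (1 / r) = v"
      by (simp add: v_def power2_eq_square field_simps)
    finally show ?thesis
    proof (rule Lim_transform_eventually)
      have "eventually (\<lambda>\<rho>. \<rho> > 0 \<and> \<rho> \<noteq> r) (at r)"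
        using r eventually_at_in_open[of "{0<..}" r] by (auto elim: eventually_mono)
      thus "eventually (\<lambda>\<rho>. ((H \<rho> - H r) / (\<rho> - r)) / ((ln \<rho> - ln r) / (\<rho> - r)) = q \<rho>) (at r)"
        by eventually_elim (use r in \<open>auto simp: q_def ln_div\<close>)
    qed
  qed
  have limr: "(q \<longlongrightarrow> v) (at_right r)" and liml: "(q \<longlongrightarrow> v) (at_left r)"
    using lim by (auto simp: filterlim_at_split)
  have evr: "eventually (\<lambda>\<rho>. r < \<rho> \<and> \<rho> < 1) (at_right r)"
    using r eventually_at_right by blast
  have evl: "eventually (\<lambda>\<rho>. 0 < \<rho> \<and> \<rho> < r) (at_left r)"
    using r eventually_at_left by blast
  show v: "0 \<le> v"
  proof (rule tendsto_lowerbound[OF limr])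
    show "eventually (\<lambda>\<rho>. 0 \<le> q \<rho>) (at_right r)"
      using evr by eventually_elim
        (use r expected_zeros_bounds(1) in \<open>auto simp: q_def intro!: divide_nonneg_nonneg\<close>)
  qed simp
  have "expected_zeros M \<xi> r \<le> ennreal v"
  proof (rule tendsto_lowerbound[OF tendsto_ennrealI[OF limr]])
    show "eventually (\<lambda>\<rho>. expected_zeros M \<xi> r \<le> ennreal (q \<rho>)) (at_right r)"
      using evr by eventually_elim (use r expected_zeros_bounds(2) in \<open>auto simp: q_def\<close>)
  qed simp
  moreover have "ennreal v \<le> expected_zeros M \<xi> r"
  proof (rule tendsto_upperbound[OF tendsto_ennrealI[OF liml]])
    show "eventually (\<lambda>\<rho>. ennreal (q \<rho>) \<le> expected_zeros M \<xi> r) (at_left r)"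
      using evl
    proof eventually_elim
      case (elim \<rho>)
      have "q \<rho> = (H r - H \<rho>) / ln (r / \<rho>)"
      proof -
        have "ln (\<rho> / r) = - ln (r / \<rho>)" using elim r by (simp add: ln_div)
        thus ?thesis by (simp add: q_def minus_divide_left [symmetric] minus_divide_right [symmetric] diff_divide_distrib)
      qed
      thus ?case using expected_zeros_bounds(3)[of \<rho> r] elim r by simp
    qed
  qed simp
  ultimately show "expected_zeros M \<xi> r = ennreal v" by (rule antisym)
qed

end

theorem theorem1p3:
  fixes n :: nat and M :: "'a measure" and \<xi> :: "int \<Rightarrow> 'a \<Rightarrow> complex"
  assumes "0 < n"
    and "prob_space M"
    and "complex_gaussian_process M \<xi>"
    and "circularly_symmetric M \<xi>"
    and "stationary M \<xi>"
    and "centered M \<xi>"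
    and "has_covariance M \<xi> (gamma_cov n)"
  shows "(\<forall>r\<in>{0<..<1}. expected_zeros M \<xi> r < \<infinity>) \<and>
    (\<lambda>r. enn2real (expected_zeros M \<xi> r)
          - (r\<^sup>2 / (1 - r\<^sup>2)
             - D_const n * (1 - r\<^sup>2) powr (- ((2 * real n - 1) / (2 * real n)))))
      \<in> O[at_left 1](\<lambda>r. error_scale n (1 - r\<^sup>2))"
proof -
  interpret prob_space M by fact
  interpret binomial_process M n \<xi>
    by (unfold_locales; fact)
  obtain C where C: "\<And>r. 1 / 2 \<le> r \<Longrightarrow> r < 1 \<Longrightarrow>
    \<bar>r * log_deriv_mean n r / 2 + D_const n * (1 - r\<^sup>2) powr (- ((2 * real n - 1) / (2 * real n)))\<bar>
      \<le> C * error_scale n (1 - r\<^sup>2)"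
    using log_deriv_mean_asymptotics[OF assms(1)] by blast
  show ?thesis
  proof (intro conjI ballI)
    fix r :: real assume "r \<in> {0<..<1}"
    thus "expected_zeros M \<xi> r < \<infinity>" by (simp add: expected_zeros_eq(2))
  next
    have "eventually (\<lambda>r::real. 1 / 2 < r \<and> r < 1) (at_left 1)"
      using eventually_at_left_real[of "1 / 2" "1::real"] by simp
    thus "(\<lambda>r. enn2real (expected_zeros M \<xi> r)
          - (r\<^sup>2 / (1 - r\<^sup>2)
             - D_const n * (1 - r\<^sup>2) powr (- ((2 * real n - 1) / (2 * real n)))))
      \<in> O[at_left 1](\<lambda>r. error_scale n (1 - r\<^sup>2))"
    proof (intro bigoI[of _ C], eventually_elim)
      case (elim r)
      \<comment> \<open>The term r^2/(1-r^2) cancels exactly, leaving the error bound for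
        \<open>log_deriv_mean\<close>.\<close>
      have "enn2real (expected_zeros M \<xi> r) = r\<^sup>2 / (1 - r\<^sup>2) + r * log_deriv_mean n r / 2"
        using expected_zeros_eq[of r] elim by simp
      moreover have "0 \<le> error_scale n (1 - r\<^sup>2)"
        by (simp add: error_scale_def)
      ultimately show ?case
        using C[of r] elim by (simp add: algebra_simps)
    qed
  qed
qed

end
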